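(* Fix a family of query ranges. Suppose that for every set of $n$ colored points there is a randomized Monte Carlo data structure with $P(n)$ (expected) preprocessing time and $S(n)$ space that decides in $Q_1(n)$ time whether the number of distinct colors in a query range is exactly $1$, such that if the true answer is yes it returns ``yes'' with probability $\Omega(1)$ and otherwise it always returns ``no''; and that moreover decides without error whether the query range is empty and, if not, reports one point in it, in $Q_0(n)$ time. Assume $P(n)/n$ and $S(n)/n$ are nondecreasing. Then there is a randomized Las Vegas data structure with $O(P(n)\log n)$ expected preprocessing time and $O(S(n)\log n)$ space that reports all $k$ distinct colors of the points in a query range in $O(k(Q_0(n)+Q_1(n)))$ expected time.
   Context: Colored range reporting: given $n$ points each with a color, report the set of distinct colors of points in a query range. A Las Vegas data structure always answers correctly; expected query time is over the data structure's random choices, for a query range fixed independently of them.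
   Formalization: Q_0(n) and Q_1(n) are additionally assumed nondecreasing and S(n) positive; the query bound uses max(1,k) in place of k, since an empty answer cannot take zero time. Without monotone query times the claimed bound can fail. *)

theory Defs
  imports "HOL-Probability.SPMF"
begin

text \<open>
  Computation model: a randomized word RAM running structured programs. A cell or register holds
  a machine word, a point, a query range (both have constant description size), or a further
  datum such as a coordinate. The remaining unit-cost instructions on these values (coordinate
  comparisons, bit operations, ...) depend on the geometric setting, so they are an arbitrary
  parameter \<open>F\<close>.
\<close>

datatype ('p, 'o) val = Num nat | Point 'p | Range "'p set" | Datum 'o

datatype binop = Add | Sub | Mul | Div | Less | Eq

datatype exp = Const nat | Reg nat | Op binop exp exp | Prim nat "exp list"

datatype com =
    Skip
  | Assign nat exp
  | Load nat exp
  | Store exp exp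
  | Rand nat exp
  | Report exp
  | Seq com com
  | Cond exp com com
  | While exp com

record ('p, 'o) state =
  regs :: "nat \<Rightarrow> ('p, 'o) val"
  mem :: "nat \<Rightarrow> ('p, 'o) val"
  out :: "('p, 'o) val list"
  clock :: nat

type_synonym ('p, 'o) prims = "nat \<Rightarrow> ('p, 'o) val list \<Rightarrow> ('p, 'o) val"

fun num :: "('p, 'o) val \<Rightarrow> nat" where
  "num (Num k) = k"
| "num _ = 0"

fun apply_op :: "binop \<Rightarrow> nat \<Rightarrow> nat \<Rightarrow> nat" where
  "apply_op Add a b = a + b"
| "apply_op Sub a b = a - b"
| "apply_op Mul a b = a * b"
| "apply_op Div a b = a div b"
| "apply_op Less a b = of_bool (a < b)"
| "apply_op Eq a b = of_bool (a = b)"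

fun eval :: "('p, 'o) prims \<Rightarrow> (nat \<Rightarrow> ('p, 'o) val) \<Rightarrow> exp \<Rightarrow> ('p, 'o) val" where
  "eval F \<rho> (Const k) = Num k"
| "eval F \<rho> (Reg r) = \<rho> r"
| "eval F \<rho> (Op f a b) = Num (apply_op f (num (eval F \<rho> a)) (num (eval F \<rho> b)))"
| "eval F \<rho> (Prim i es) = F i (map (eval F \<rho>) es)"

definition tick :: "('p, 'o) state \<Rightarrow> ('p, 'o) state" where
  "tick s = s\<lparr>clock := Suc (clock s)\<rparr>"

text \<open>
  In \<open>exec F w c s\<close> all words and addresses must be below \<open>w\<close>; a program that exceeds this bound
  gets stuck. Mass missing from the resulting subdistribution accounts for divergence and for
  being stuck. Every executed atomic command and every evaluated guard costs one time unit;
  expressions have constant size because programs do not depend on the input.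
  \<open>Rand r e\<close> draws an integer uniformly below the value of \<open>e\<close>.
\<close>

partial_function (spmf) exec ::
  "('p, 'o) prims \<Rightarrow> nat \<Rightarrow> com \<Rightarrow> ('p, 'o) state \<Rightarrow> ('p, 'o) state spmf" where
  "exec F w c s = (case c of
      Skip \<Rightarrow> return_spmf (tick s)
    | Assign r e \<Rightarrow>
        (let v = eval F (regs s) e in
         if num v < w then return_spmf ((tick s)\<lparr>regs := (regs s)(r := v)\<rparr>)
         else return_pmf None)
    | Load r e \<Rightarrow>
        (let a = num (eval F (regs s) e) in
         if a < w then return_spmf ((tick s)\<lparr>regs := (regs s)(r := mem s a)\<rparr>)
         else return_pmf None)
    | Store e e' \<Rightarrow>
        (let a = num (eval F (regs s) e); v = eval F (regs s) e' in
         if a < w \<and> num v < w then return_spmf ((tick s)\<lparr>mem := (mem s)(a := v)\<rparr>)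
         else return_pmf None)
    | Rand r e \<Rightarrow>
        (let m = num (eval F (regs s) e) in
         if m < w then map_spmf (\<lambda>k. (tick s)\<lparr>regs := (regs s)(r := Num k)\<rparr>) (spmf_of_set {..<m})
         else return_pmf None)
    | Report e \<Rightarrow>
        (let v = eval F (regs s) e in
         if num v < w then return_spmf ((tick s)\<lparr>out := out s @ [v]\<rparr>)
         else return_pmf None)
    | Seq c1 c2 \<Rightarrow> bind_spmf (exec F w c1 s) (exec F w c2)
    | Cond e c1 c2 \<Rightarrow>
        (if num (eval F (regs s) e) \<noteq> 0 then exec F w c1 (tick s) else exec F w c2 (tick s))
    | While e c1 \<Rightarrow>
        (if num (eval F (regs s) e) \<noteq> 0
         then bind_spmf (exec F w c1 (tick s)) (exec F w (While e c1))
         else return_spmf (tick s)))"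

definition expected_time :: "('p, 'o) state spmf \<Rightarrow> ennreal" where
  "expected_time p = (\<integral>\<^sup>+ s. ennreal (real (clock s)) \<partial>measure_spmf p)"

text \<open>
  Blank cells contain \<open>Num 0\<close>; only finitely many cells are ever nonblank.
\<close>

definition space :: "(nat \<Rightarrow> ('p, 'o) val) \<Rightarrow> nat" where
  "space M = card {a. M a \<noteq> Num 0}"

type_synonym 'p colored = "('p \<times> nat) list"

definition valid_input :: "'p colored \<Rightarrow> bool" where
  "valid_input xs \<longleftrightarrow> xs \<noteq> [] \<and> distinct (map fst xs)"

definition colors_in :: "'p colored \<Rightarrow> 'p set \<Rightarrow> nat set" where
  "colors_in xs r = snd ` {x \<in> set xs. fst x \<in> r}"

text \<open>
  Words have \<open>O(log (n + U))\<close> bits, where \<open>U\<close> is the largest color; the exponent \<open>c\<close> is the hidden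
  constant and may depend on the data structure but not on the input.
\<close>

definition word_bound :: "nat \<Rightarrow> 'p colored \<Rightarrow> nat" where
  "word_bound c xs = (length xs + Max (snd ` set xs) + 2) ^ c"

text \<open>
  The input array: the number of points in cell 0, followed by alternating points and colors.
\<close>

definition input_mem :: "'p colored \<Rightarrow> nat \<Rightarrow> ('p, 'o) val" where
  "input_mem xs a =
     (if a = 0 then Num (length xs)
      else let i = (a - 1) div 2 in
        if i < length xs then (if odd a then Point (fst (xs ! i)) else Num (snd (xs ! i)))
        else Num 0)"

definition preprocess ::
  "('p, 'o) prims \<Rightarrow> nat \<Rightarrow> com \<Rightarrow> 'p colored \<Rightarrow> ('p, 'o) state spmf" where
  "preprocess F c build xs = exec F (word_bound c xs) build
     \<lparr>regs = (\<lambda>_. Num 0), mem = input_mem xs, out = [], clock = 0\<rparr>"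

text \<open>
  Only memory survives preprocessing. Each query starts from the memory left by the preprocessing:
  changes made by a query could be undone afterwards at the cost of a constant factor.
\<close>

definition query ::
  "('p, 'o) prims \<Rightarrow> nat \<Rightarrow> com \<Rightarrow> 'p colored \<Rightarrow> 'p set \<Rightarrow> ('p, 'o) state \<Rightarrow> ('p, 'o) state spmf" where
  "query F c qry xs r s = exec F (word_bound c xs) qry
     \<lparr>regs = (\<lambda>_. Num 0)(0 := Range r), mem = mem s, out = [], clock = 0\<rparr>"

text \<open>
  The joint experiment: preprocessing followed by one query chosen independently of the random
  choices. The clock of the result measures the query only.
\<close>

definition preprocess_query ::
  "('p, 'o) prims \<Rightarrow> nat \<Rightarrow> com \<Rightarrow> com \<Rightarrow> 'p colored \<Rightarrow> 'p set \<Rightarrow> ('p, 'o) state spmf" where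
  "preprocess_query F c build qry xs r = bind_spmf (preprocess F c build xs) (query F c qry xs r)"

text \<open>
  The preprocessing time is bounded in expectation, the space in the worst case over the random
  choices.
\<close>

definition preprocessing_bounds ::
  "('p, 'o) prims \<Rightarrow> nat \<Rightarrow> (nat \<Rightarrow> real) \<Rightarrow> (nat \<Rightarrow> real) \<Rightarrow> com \<Rightarrow> bool" where
  "preprocessing_bounds F c P S build \<longleftrightarrow>
     (\<forall>xs. valid_input xs \<longrightarrow>
        lossless_spmf (preprocess F c build xs) \<and>
        expected_time (preprocess F c build xs) \<le> ennreal (P (length xs)) \<and>
        (\<forall>s \<in> set_spmf (preprocess F c build xs). real (space (mem s)) \<le> S (length xs)))"

definition query_always ::
  "('p, 'o) prims \<Rightarrow> nat \<Rightarrow> 'p set set \<Rightarrow> com \<Rightarrow> com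
    \<Rightarrow> ('p colored \<Rightarrow> 'p set \<Rightarrow> ('p, 'o) state \<Rightarrow> bool) \<Rightarrow> bool" where
  "query_always F c ranges build qry ok \<longleftrightarrow>
     (\<forall>xs. valid_input xs \<longrightarrow> (\<forall>r \<in> ranges. \<forall>s \<in> set_spmf (preprocess F c build xs).
        lossless_spmf (query F c qry xs r s) \<and> (\<forall>t \<in> set_spmf (query F c qry xs r s). ok xs r t)))"

definition yes :: "('p, 'o) state \<Rightarrow> bool" where
  "yes t \<longleftrightarrow> regs t 0 = Num 1"

definition no :: "('p, 'o) state \<Rightarrow> bool" where
  "no t \<longleftrightarrow> regs t 0 = Num 0"

definition one_color_test ::
  "('p, 'o) prims \<Rightarrow> nat \<Rightarrow> 'p set set \<Rightarrow> (nat \<Rightarrow> real) \<Rightarrow> com \<Rightarrow> com \<Rightarrow> bool" where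
  "one_color_test F c ranges Q1 build q1 \<longleftrightarrow>
     query_always F c ranges build q1 (\<lambda>xs r t.
        real (clock t) \<le> Q1 (length xs) \<and> (yes t \<or> no t) \<and>
        (card (colors_in xs r) \<noteq> 1 \<longrightarrow> no t)) \<and>
     (\<exists>\<delta>>0. \<forall>xs. valid_input xs \<longrightarrow> (\<forall>r \<in> ranges. card (colors_in xs r) = 1 \<longrightarrow>
        measure (measure_spmf (preprocess_query F c build q1 xs r)) {t. yes t} \<ge> \<delta>))"

text \<open>A reported point is returned together with its color.\<close>

definition emptiness_test ::
  "('p, 'o) prims \<Rightarrow> nat \<Rightarrow> 'p set set \<Rightarrow> (nat \<Rightarrow> real) \<Rightarrow> com \<Rightarrow> com \<Rightarrow> bool" where
  "emptiness_test F c ranges Q0 build q0 \<longleftrightarrow>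
     query_always F c ranges build q0 (\<lambda>xs r t.
        real (clock t) \<le> Q0 (length xs) \<and>
        (if \<forall>(p, col) \<in> set xs. p \<notin> r then no t
         else yes t \<and> (\<exists>(p, col) \<in> set xs. p \<in> r \<and> regs t 1 = Point p \<and> regs t 2 = Num col)))"

definition monte_carlo_ds ::
  "('p, 'o) prims \<Rightarrow> 'p set set
    \<Rightarrow> (nat \<Rightarrow> real) \<Rightarrow> (nat \<Rightarrow> real) \<Rightarrow> (nat \<Rightarrow> real) \<Rightarrow> (nat \<Rightarrow> real) \<Rightarrow> bool" where
  "monte_carlo_ds F ranges P S Q0 Q1 \<longleftrightarrow>
     (\<exists>c build q0 q1.
        preprocessing_bounds F c P S build \<and>
        emptiness_test F c ranges Q0 build q0 \<and>
        one_color_test F c ranges Q1 build q1)"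

definition las_vegas_reporting_ds ::
  "('p, 'o) prims \<Rightarrow> 'p set set
    \<Rightarrow> (nat \<Rightarrow> real) \<Rightarrow> (nat \<Rightarrow> real) \<Rightarrow> (nat \<Rightarrow> nat \<Rightarrow> real) \<Rightarrow> bool" where
  "las_vegas_reporting_ds F ranges P S T \<longleftrightarrow>
     (\<exists>c build qry.
        preprocessing_bounds F c P S build \<and>
        query_always F c ranges build qry (\<lambda>xs r t.
          distinct (out t) \<and> set (out t) = Num ` colors_in xs r) \<and>
        (\<forall>xs. valid_input xs \<longrightarrow> (\<forall>r \<in> ranges.
           expected_time (preprocess_query F c build qry xs r)
             \<le> ennreal (T (length xs) (card (colors_in xs r))))))"

end

theory Submission
  imports Defs
begin

text \<open>
  The colors are placed at random distinct leaves of a complete binary tree with \<open>N = O(n)\<close>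
  leaves, and every node receives Monte Carlo structures for the points whose color lies below it.
  The point sets of one level are disjoint, so superadditivity of \<open>P\<close> and \<open>S\<close> bounds the cost of a
  level by \<open>P n\<close> and \<open>S n\<close>. A query descends from the root. It abandons a node whose range is empty,
  reports the color of the found point if the one-color test says yes or the node is a leaf, and
  visits both children otherwise; since a yes is never wrong, the answer is always correct.

  Call a node crowded if it contains at least two of the \<open>k\<close> query colors. A level with \<open>2^j\<close> nodes has
  at most \<open>2^j\<close> crowded nodes, and in expectation at most \<open>O(k^2 / 2^j)\<close>, because two colors collide
  there with probability \<open>O(1 / 2^j)\<close>. Summing the smaller bound over all levels gives \<open>O(k)\<close> crowded
  nodes. Below them each color continues along a path that stops with probability at least \<open>\<delta>\<close> at
  every step, as the structures of different nodes are built independently. So \<open>O(k)\<close> nodes are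
  visited in expectation.
\<close>

text \<open>The obstacle is to tie this argument to concrete programs whose randomness is spread
  over three stages: the draw of the leaves, the builds at the nodes, and the queries to them.
  Independence of events is never stated. For a fixed memory the expected number of visits is a
  polynomial in the failure probabilities of the nodes, of degree at most one in each, so the builds
  are averaged out one node at a time; a bound on the crowded nodes is carried through the draw of
  the leaves as a supermartingale. Both are potentials pushed backwards through the program, and one
  rule for the whole preprocessing serves twice: with the elapsed time as potential, and with the
  expected time of a later query. Counting failure and wrong output as infinite lets the same
  estimates certify losslessness and correctness on every outcome. At least twice as many leaves as
  points keep half of the leaves free at each draw. Each given program runs relocated in its own
  block of cells; the room for all blocks raises the word exponent from \<open>c\<close> to
  \<open>c + 6\<close>.\<close>

section \<open>Demonic expectation\<close>

text \<open>
  Failure counts as infinite. A finite value hence certifies that the computation is lossless, and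
  that its support avoids all results where \<open>g\<close> is infinite.
\<close>

definition dexp :: "'a spmf \<Rightarrow> ('a \<Rightarrow> ennreal) \<Rightarrow> ennreal" where
  "dexp p g = (\<integral>\<^sup>+ x. case_option top g x \<partial>measure_pmf p)"

lemma dexp_return [simp]: "dexp (return_spmf x) g = g x"
  by (simp add: dexp_def)

lemma dexp_bind: "dexp (bind_spmf p f) g = dexp p (\<lambda>x. dexp (f x) g)"
  unfolding dexp_def bind_spmf_def nn_integral_bind_pmf
  by (intro nn_integral_cong) (simp split: option.split)

lemma dexp_map: "dexp (map_spmf f p) g = dexp p (\<lambda>x. g (f x))"
  by (simp add: map_spmf_conv_bind_spmf dexp_bind)

lemma dexp_mono: "(\<And>x. x \<in> set_spmf p \<Longrightarrow> g x \<le> h x) \<Longrightarrow> dexp p g \<le> dexp p h"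
  unfolding dexp_def
  by (intro nn_integral_mono_AE) (auto simp: AE_measure_pmf_iff in_set_spmf split: option.split)

lemma dexp_lossless:
  assumes "lossless_spmf p"
  shows "dexp p g = (\<integral>\<^sup>+ x. g x \<partial>measure_spmf p)"
proof -
  have "(\<integral>\<^sup>+ x. g x \<partial>measure_spmf p)
      = (\<integral>\<^sup>+ x. g (the x) * indicator (range Some) x \<partial>measure_pmf p)"
    by (simp add: nn_integral_measure_spmf_conv_measure_pmf nn_integral_restrict_space o_def)
  also have "\<dots> = dexp p g"
    unfolding dexp_def using assms
    by (intro nn_integral_cong_AE)
      (auto simp: AE_measure_pmf_iff lossless_iff_set_pmf_None image_iff split: option.split,
        metis not_None_eq)
  finally show ?thesis ..
qed

lemma dexp_finiteD:
  assumes "dexp p g < top"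
  shows "lossless_spmf p" "\<And>x. x \<in> set_spmf p \<Longrightarrow> g x < top"
proof -
  have *: "AE x in measure_pmf p. case_option top g x \<noteq> top"
    using assms unfolding dexp_def
    by (intro nn_integral_PInf_AE[unfolded infinity_ennreal_def]) auto
  show "lossless_spmf p" using *
    by (auto simp: AE_measure_pmf_iff lossless_iff_set_pmf_None)
  show "g x < top" if "x \<in> set_spmf p" for x
    using * that by (force simp: AE_measure_pmf_iff in_set_spmf less_top)
qed

text \<open>Missing mass counts as 0 on the left and as infinite on the right.\<close>

lemma dexp_ge_integral: "(\<integral>\<^sup>+ x. g x \<partial>measure_spmf p) \<le> dexp p g"
proof (cases "dexp p g = top")
  case False
  then show ?thesis
    using dexp_finiteD(1)[of p g] dexp_lossless[of p g] by (simp add: less_top)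
qed simp

lemma dexp_spmf_of_set:
  assumes "finite A" "A \<noteq> {}"
  shows "dexp (spmf_of_set A) g = sum g A / card A"
  using assms by (simp add: dexp_lossless nn_integral_spmf_of_set)

section \<open>Execution\<close>

lemma exec_Skip: "exec F w Skip s = return_spmf (tick s)"
  by (subst exec.simps) simp
lemma exec_Assign: "exec F w (Assign r e) s =
    (if num (eval F (regs s) e) < w
     then return_spmf (s\<lparr>clock := Suc (clock s), regs := (regs s)(r := eval F (regs s) e)\<rparr>)
     else return_pmf None)"
  by (subst exec.simps) (simp add: tick_def Let_def)
lemma exec_Load: "exec F w (Load r e) s =
    (if num (eval F (regs s) e) < w
     then return_spmf (s\<lparr>clock := Suc (clock s), regs := (regs s)(r := mem s (num (eval F (regs s) e)))\<rparr>)
     else return_pmf None)"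
  by (subst exec.simps) (simp add: tick_def Let_def)
lemma exec_Store: "exec F w (Store e e') s =
    (if num (eval F (regs s) e) < w \<and> num (eval F (regs s) e') < w
     then return_spmf (s\<lparr>clock := Suc (clock s), mem := (mem s)(num (eval F (regs s) e) := eval F (regs s) e')\<rparr>)
     else return_pmf None)"
  by (subst exec.simps) (simp add: tick_def Let_def)
lemma exec_Rand: "exec F w (Rand r e) s =
    (if num (eval F (regs s) e) < w
     then map_spmf (\<lambda>k. s\<lparr>clock := Suc (clock s), regs := (regs s)(r := Num k)\<rparr>)
            (spmf_of_set {..<num (eval F (regs s) e)})
     else return_pmf None)"
  by (subst exec.simps) (simp add: tick_def Let_def)
lemma exec_Report: "exec F w (Report e) s =
    (if num (eval F (regs s) e) < w
     then return_spmf (s\<lparr>clock := Suc (clock s), out := out s @ [eval F (regs s) e]\<rparr>)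
     else return_pmf None)"
  by (subst exec.simps) (simp add: tick_def Let_def)
lemma exec_Seq: "exec F w (Seq c1 c2) s = bind_spmf (exec F w c1 s) (exec F w c2)"
  by (subst exec.simps) simp
lemma exec_Cond: "exec F w (Cond e c1 c2) s =
    (if num (eval F (regs s) e) \<noteq> 0 then exec F w c1 (tick s) else exec F w c2 (tick s))"
  by (subst exec.simps) simp
lemma exec_While: "exec F w (While e c) s =
    (if num (eval F (regs s) e) \<noteq> 0
     then bind_spmf (exec F w c (tick s)) (exec F w (While e c)) else return_spmf (tick s))"
  by (subst exec.simps) simp

lemmas exec_rules = exec_Skip exec_Assign exec_Load exec_Store exec_Rand exec_Report exec_Seq exec_Cond

text \<open>Strict growth of the clock later forces \<open>P n \<ge> n\<close> and query times of at
  least 1. The finite change of memory is what makes \<open>space\<close> meaningful, since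
  \<open>card\<close> of an infinite set would be 0.\<close>

lemma exec_support:
  "\<forall>w c s. \<forall>t\<in>set_spmf (exec F w c s). clock s < clock t \<and> finite {a. mem t a \<noteq> mem s a}"
proof (induction rule: exec.fixp_induct)
  case 1
  show ?case by simp
next
  case 2
  show ?case by (simp add: bot_fun_def)
next
  case (3 exec')
  have trans: "finite {a. f a \<noteq> (h a :: 'c)}" if "finite {a. f a \<noteq> g a}" "finite {a. g a \<noteq> h a}"
    for f g h :: "nat \<Rightarrow> 'c"
    by (rule finite_subset[OF _ finite_UnI[OF that]]) auto
  have IH: "clock s < clock t \<and> finite {a. mem t a \<noteq> mem s a}"
    if "t \<in> set_spmf (exec' F w c s)" for w c s t
    using 3 that by auto
  have IH2: "clock s < clock u \<and> finite {a. mem u a \<noteq> mem s a}"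
    if "t \<in> set_spmf (exec' F w c s)" "u \<in> set_spmf (exec' F w c' t)"
    for w c c' s t u
    using IH[OF that(1)] IH[OF that(2)] trans[of "mem u" "mem t" "mem s"] by auto
  show ?case
  proof (intro allI ballI, goal_cases)
    case (1 w c s t)
    then show ?case
      using IH[of _ w _ "tick s"] IH2[of _ w _ s] IH2[of _ w _ "tick s"]
      by (cases c) (fastforce simp: Let_def tick_def set_bind_spmf split: if_splits)+
  qed
qed

section \<open>Relocation\<close>

fun shift_exp :: "nat \<Rightarrow> exp \<Rightarrow> exp" where
  "shift_exp K (Const k) = Const k"
| "shift_exp K (Reg r) = Reg (K + r)"
| "shift_exp K (Op f a b) = Op f (shift_exp K a) (shift_exp K b)"
| "shift_exp K (Prim i es) = Prim i (map (shift_exp K) es)"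

text \<open>The base address is read from register \<open>B\<close> at run time, so one program text
  serves all blocks. \<open>Report\<close> becomes \<open>Skip\<close>: the output of an inner
  program must not reach the user, but its time unit is kept.\<close>

fun reloc :: "nat \<Rightarrow> nat \<Rightarrow> com \<Rightarrow> com" where
  "reloc K B Skip = Skip"
| "reloc K B (Assign r e) = Assign (K + r) (shift_exp K e)"
| "reloc K B (Load r e) = Load (K + r) (Op Add (Reg B) (shift_exp K e))"
| "reloc K B (Store e e') = Store (Op Add (Reg B) (shift_exp K e)) (shift_exp K e')"
| "reloc K B (Rand r e) = Rand (K + r) (shift_exp K e)"
| "reloc K B (Report e) = Skip"
| "reloc K B (Seq c1 c2) = Seq (reloc K B c1) (reloc K B c2)"
| "reloc K B (Cond e c1 c2) = Cond (shift_exp K e) (reloc K B c1) (reloc K B c2)"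
| "reloc K B (While e c) = While (shift_exp K e) (reloc K B c)"

fun exp_regs :: "exp \<Rightarrow> nat set" where
  "exp_regs (Const k) = {}"
| "exp_regs (Reg r) = {r}"
| "exp_regs (Op f a b) = exp_regs a \<union> exp_regs b"
| "exp_regs (Prim i es) = (\<Union>e\<in>set es. exp_regs e)"

fun com_regs :: "com \<Rightarrow> nat set" where
  "com_regs Skip = {}"
| "com_regs (Assign r e) = insert r (exp_regs e)"
| "com_regs (Load r e) = insert r (exp_regs e)"
| "com_regs (Store e e') = exp_regs e \<union> exp_regs e'"
| "com_regs (Rand r e) = insert r (exp_regs e)"
| "com_regs (Report e) = exp_regs e"
| "com_regs (Seq c1 c2) = com_regs c1 \<union> com_regs c2"
| "com_regs (Cond e c1 c2) = exp_regs e \<union> com_regs c1 \<union> com_regs c2"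
| "com_regs (While e c) = exp_regs e \<union> com_regs c"

lemma finite_exp_regs: "finite (exp_regs e)"
  by (induction e) auto

lemma finite_com_regs: "finite (com_regs c)"
  by (induction c) (auto simp: finite_exp_regs)

text \<open>
  The state of a host program \<open>s\<close> that simulates a program in state \<open>t\<close>, whose registers are the
  registers of the host from \<open>K\<close> on, and whose memory is the block of \<open>W\<close> cells from \<open>b\<close> on.
\<close>

definition embed ::
  "nat \<Rightarrow> nat \<Rightarrow> nat \<Rightarrow> nat \<Rightarrow> ('p, 'o) state \<Rightarrow> ('p, 'o) state \<Rightarrow> ('p, 'o) state" where
  "embed K M b W s t =
    \<lparr>regs = (\<lambda>r. if K \<le> r \<and> r < K + M then regs t (r - K) else regs s r),
     mem = (\<lambda>a. if b \<le> a \<and> a < b + W then mem t (a - b) else mem s a),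
     out = out s, clock = clock s + clock t\<rparr>"

lemma embed_simps [simp]:
  "out (embed K M b W s t) = out s"
  "clock (embed K M b W s t) = clock s + clock t"
  by (simp_all add: embed_def)

lemma regs_embed_low [simp]: "r < K \<Longrightarrow> regs (embed K M b W s t) r = regs s r"
  by (simp add: embed_def)

lemma regs_embed_sub: "r < M \<Longrightarrow> regs (embed K M b W s t) (K + r) = regs t r"
  by (simp add: embed_def)

lemma mem_embed_sub: "a < W \<Longrightarrow> mem (embed K M b W s t) (b + a) = mem t a"
  by (simp add: embed_def)

lemma eval_shift:
  "exp_regs e \<subseteq> {..<M} \<Longrightarrow> eval F (regs (embed K M b W s t)) (shift_exp K e) = eval F (regs t) e"
proof (induction e)
  case (Prim i es)
  then have "map (eval F (regs (embed K M b W s t)) \<circ> shift_exp K) es = map (eval F (regs t)) es"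
    by (intro map_cong refl) (auto simp: UN_subset_iff)
  then show ?case by (simp only: eval.simps shift_exp.simps list.map_comp)
qed (simp_all add: regs_embed_sub)

lemma embed_tick: "tick (embed K M b W s t) = embed K M b W s (tick t)"
  by (auto simp: embed_def tick_def fun_eq_iff)

lemma embed_clock:
  "(embed K M b W s t)\<lparr>clock := Suc (clock s + clock t)\<rparr> = embed K M b W s (t\<lparr>clock := Suc (clock t)\<rparr>)"
  by (auto simp: embed_def fun_eq_iff)

lemma embed_regs:
  assumes "r < M"
  shows "(embed K M b W s t)\<lparr>clock := Suc (clock s + clock t),
      regs := (regs (embed K M b W s t))(K + r := v)\<rparr>
    = embed K M b W s (t\<lparr>clock := Suc (clock t), regs := (regs t)(r := v)\<rparr>)"
  using assms by (auto simp: embed_def fun_eq_iff)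

lemma embed_mem:
  assumes "a < W"
  shows "(embed K M b W s t)\<lparr>clock := Suc (clock s + clock t),
      mem := (mem (embed K M b W s t))(b + a := v)\<rparr>
    = embed K M b W s (t\<lparr>clock := Suc (clock t), mem := (mem t)(a := v)\<rparr>)"
  using assms by (auto simp: embed_def fun_eq_iff)

lemma embed_out: "embed K M b W s (t\<lparr>clock := k, out := x\<rparr>) = embed K M b W s (t\<lparr>clock := k\<rparr>)"
  by (auto simp: embed_def fun_eq_iff)

lemma ord_spmf_bind_map:
  fixes h :: "'a \<Rightarrow> 'a"
  assumes "ord_spmf (=) (map_spmf h p) q" "\<And>x. ord_spmf (=) (map_spmf h (f x)) (g (h x))"
  shows "ord_spmf (=) (map_spmf h (bind_spmf p f)) (bind_spmf q g)"
proof -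
  have "ord_spmf (\<lambda>x. (=) (h x)) p q"
    using assms(1) by (simp only: ord_spmf_map_spmf1)
  then have "ord_spmf (\<lambda>x. (=) (h x)) (bind_spmf p f) (bind_spmf q g)"
    by (rule ord_spmf_bindI) (use assms(2) in \<open>auto simp only: ord_spmf_map_spmf1\<close>)
  then show ?thesis by (simp only: ord_spmf_map_spmf1)
qed

text \<open>Only an inequality can be expected: where the guest gets stuck at its word bound
  \<open>w'\<close>, the host may go on. Below that bound all addresses of the guest lie in its
  block of \<open>W\<close> cells. The name \<open>E\<close> hides the \<open>exec\<close> of the
  host, so that fixed point induction unrolls the guest alone.\<close>

lemma exec_reloc_ord:
  assumes s: "regs s B = Num b" "B < K" and W: "w' \<le> W" "b + w' \<le> w"
    and E: "E = exec F w"
  shows "\<forall>c t. com_regs c \<subseteq> {..<M} \<longrightarrow>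
    ord_spmf (=) (map_spmf (embed K M b W s) (exec F w' c t))
      (E (reloc K B c) (embed K M b W s t))"
proof (induction rule: exec.fixp_induct)
  case 1
  show ?case by (simp add: split_def)
next
  case 2
  show ?case by (simp add: bot_fun_def)
next
  case (3 exec')
  have IH: "ord_spmf (=) (map_spmf (embed K M b W s) (exec' F w' c t))
      (E (reloc K B c) (embed K M b W s t))" if "com_regs c \<subseteq> {..<M}" for c t
    using 3 that by auto
  have B: "eval F (regs (embed K M b W s t)) (Reg B) = Num b" for t
    using s by simp
  show ?case
  proof (intro allI impI, goal_cases)
    case (1 c t)
    show ?case
    proof (cases c)
      case (While e c')
      with 1 IH[of c] show ?thesis
        by (auto simp: E exec_While eval_shift embed_tick intro!: ord_spmf_bind_map IH[unfolded E])
    next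
      case (Load r e)
      with 1 W s show ?thesis
        by (auto simp: E exec_Load Let_def eval_shift mem_embed_sub embed_regs tick_def)
    next
      case (Assign r e)
      with 1 W show ?thesis
        by (auto simp: E exec_Assign Let_def eval_shift embed_regs tick_def)
    next
      case (Store e e')
      with 1 W s show ?thesis
        by (auto simp: E exec_Store Let_def eval_shift embed_mem tick_def)
    next
      case (Rand r e)
      with 1 W s show ?thesis
        by (auto simp: E exec_Rand Let_def eval_shift embed_regs tick_def spmf.map_comp o_def
          intro!: ord_spmf_reflI)
    qed (use 1 W in \<open>auto simp: E exec_rules Let_def eval_shift embed_regs
        tick_def embed_clock embed_out intro!: ord_spmf_bind_map IH[unfolded E]\<close>)
  qed
qed

text \<open>A lossless guest leaves no slack: both sides have mass 0 at \<open>None\<close>, which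
  turns the order into an equality.\<close>

lemma exec_reloc:
  assumes "regs s B = Num b" "B < K" "w' \<le> W" "b + w' \<le> w" "com_regs c \<subseteq> {..<M}"
    and "lossless_spmf (exec F w' c t)"
  shows "exec F w (reloc K B c) (embed K M b W s t) = map_spmf (embed K M b W s) (exec F w' c t)"
proof -
  have ord: "ord_spmf (=) (map_spmf (embed K M b W s) (exec F w' c t))
      (exec F w (reloc K B c) (embed K M b W s t))"
    using exec_reloc_ord[OF assms(1-4) refl] assms(5) by blast
  moreover have "pmf (map_spmf (embed K M b W s) (exec F w' c t)) None
      = pmf (exec F w (reloc K B c) (embed K M b W s t)) None"
    using assms(6) ord_spmf_eqD_pmf_None[OF chain_empty ord]
      lossless_map_spmf[of "embed K M b W s" "exec F w' c t"]
    by (simp add: lossless_iff_pmf_None antisym)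
  ultimately show ?thesis
    using ord_spmf_eq_pmf_None_eq[OF chain_empty] by metis
qed

section \<open>The implicit tree\<close>

text \<open>Ancestors in the heap numbering, where the root is 1 and the children of
  \<open>u\<close> are \<open>2 * u\<close> and \<open>2 * u + 1\<close>. Every number also reaches
  0, which is not a node; hence the recurring condition \<open>0 < u\<close>.\<close>

definition reaches :: "nat \<Rightarrow> nat \<Rightarrow> bool" where
  "reaches l u \<longleftrightarrow> (\<exists>i. l div 2 ^ i = u)"

lemma reaches_refl [simp]: "reaches u u"
  unfolding reaches_def by (rule exI[of _ 0]) simp

lemma reaches_half: "reaches u v \<Longrightarrow> reaches u (v div 2)"
  unfolding reaches_def by (metis div_mult2_eq power_Suc2)

lemma reaches_half_iff: "reaches l u \<longleftrightarrow> u = l \<or> reaches (l div 2) u"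
proof
  assume "reaches l u"
  then obtain i where i: "l div 2 ^ i = u" unfolding reaches_def by auto
  show "u = l \<or> reaches (l div 2) u"
  proof (cases i)
    case (Suc j)
    then show ?thesis using i unfolding reaches_def by (metis div_mult2_eq power_Suc)
  qed (use i in auto)
next
  assume "u = l \<or> reaches (l div 2) u"
  then show "reaches l u"
    unfolding reaches_def by (metis div_by_1 div_mult2_eq power_0 power_Suc)
qed

lemma reaches_le: "reaches l u \<Longrightarrow> u \<le> l"
  unfolding reaches_def by auto

lemma reaches_siblings: "0 < v \<Longrightarrow> \<not> (reaches l (2 * v) \<and> reaches l (2 * v + 1))"
proof (induction l rule: less_induct)
  case (less l)
  show ?case
  proof
    assume "reaches l (2 * v) \<and> reaches l (2 * v + 1)"
    then have "l = 2 * v \<or> reaches (l div 2) (2 * v)" "l = 2 * v + 1 \<or> reaches (l div 2) (2 * v + 1)"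
      using reaches_half_iff[of l "2 * v"] reaches_half_iff[of l "2 * v + 1"] by auto
    moreover have "\<not> reaches v (2 * v + 1)" "\<not> reaches v (2 * v)"
      using less.prems reaches_le[of v "2 * v + 1"] reaches_le[of v "2 * v"] by auto
    ultimately have "reaches (l div 2) (2 * v) \<and> reaches (l div 2) (2 * v + 1)"
      by auto
    moreover have "l \<noteq> 0"
      using less.prems reaches_le[of "l div 2" "2 * v"] calculation by (cases "l = 0") auto
    ultimately show False using less.IH[of "l div 2"] less.prems by simp
  qed
qed

lemma reaches_children:
  assumes "reaches l u" "l \<noteq> u"
  shows "reaches l (2 * u) \<or> reaches l (2 * u + 1)"
  using assms
proof (induction l rule: less_induct)
  case (less l)
  then have *: "reaches (l div 2) u"
    by (subst (asm) reaches_half_iff) auto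
  show ?case
  proof (cases "l div 2 = u")
    case True
    then have "l = 2 * u \<or> l = 2 * u + 1" by auto
    then show ?thesis by auto
  next
    case False
    then have "l \<noteq> 0" using * by (cases "l = 0") (auto simp: reaches_def)
    then show ?thesis
      using less.IH[of "l div 2"] * False
        reaches_half_iff[of l "2 * u"] reaches_half_iff[of l "2 * u + 1"] by auto
  qed
qed

lemma reaches_iff_children:
  assumes "u < N" "N \<le> l"
  shows "reaches l u \<longleftrightarrow> reaches l (2 * u) \<or> reaches l (2 * u + 1)"
  using reaches_children[of l u] reaches_half[of l "2 * u"] reaches_half[of l "2 * u + 1"] assms
  by auto

lemma reaches_root: "0 < l \<Longrightarrow> reaches l 1"
proof (induction l rule: less_induct)
  case (less l)
  show ?case
  proof (cases "l = 1")
    case False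
    then show ?thesis
      using less.IH[of "l div 2"] less.prems reaches_half_iff[of l 1] by auto
  qed simp
qed

lemma reaches_leaf:
  assumes "reaches l u" "l < 2 * N" "N \<le> u"
  shows "l = u"
  using assms reaches_half_iff[of l u] reaches_le[of "l div 2" u] by auto

text \<open>Sandwiching \<open>l\<close> between multiples of \<open>2 ^ i\<close> pins the number
  of steps. Sharing an ancestor on level \<open>j\<close> thereby becomes equality of two quotients,
  the form in which collisions are counted.\<close>

lemma reaches_level:
  assumes l: "l \<in> {2 ^ L..<2 * 2 ^ L}" and u: "u \<in> {2 ^ j..<2 * 2 ^ j}" and "j \<le> L" "reaches l u"
  shows "u = l div 2 ^ (L - j)"
proof -
  obtain i where i: "l div 2 ^ i = u" using assms unfolding reaches_def by auto
  have "u * 2 ^ i \<le> l" "l < (u + 1) * 2 ^ i"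
    using i by (metis div_times_less_eq_dividend, metis dividend_less_div_times add.commute
      distrib_right mult_1 zero_less_numeral zero_less_power)
  then have 1: "(2::nat) ^ (j + i) < 2 * 2 ^ L" "(2::nat) ^ L < 2 * 2 ^ (j + i)"
  proof -
    have "(2::nat) ^ j * 2 ^ i \<le> u * 2 ^ i" "(u + 1) * 2 ^ i \<le> 2 * 2 ^ j * 2 ^ i"
      using u by (intro mult_le_mono1; simp)+
    with \<open>u * 2 ^ i \<le> l\<close> \<open>l < (u + 1) * 2 ^ i\<close> l
    show "(2::nat) ^ (j + i) < 2 * 2 ^ L" "(2::nat) ^ L < 2 * 2 ^ (j + i)"
      by (simp_all only: power_add atLeastLessThan_iff mult.assoc) linarith+
  qed
  then have "(2::nat) ^ (j + i) < 2 ^ Suc L" "(2::nat) ^ L < 2 ^ Suc (j + i)" by auto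
  then have "j + i < Suc L" "L < Suc (j + i)"
    using power_strict_increasing_iff[of "2::nat"] by (metis one_less_numeral_iff semiring_norm(76))+
  then have "i = L - j" by linarith
  with i show ?thesis by simp
qed

text \<open>This is the origin of the logarithmic factor: a point is copied only into the nodes that
  its leaf reaches.\<close>

lemma card_reached:
  assumes "l < 2 * 2 ^ L"
  shows "card {u. 0 < u \<and> reaches l u} \<le> L + 1"
  using assms
proof (induction L arbitrary: l)
  case 0
  then have "{u. 0 < u \<and> reaches l u} \<subseteq> {1}" using reaches_le by force
  then show ?case using card_mono[of "{1::nat}"] by fastforce
next
  case (Suc L)
  have "{u. 0 < u \<and> reaches l u} \<subseteq> insert l {u. 0 < u \<and> reaches (l div 2) u}"
    using reaches_half_iff[of l] by auto
  moreover have fin: "finite {u. 0 < u \<and> reaches (l div 2) u}"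
    by (rule finite_subset[of _ "{..l div 2}"]) (auto dest: reaches_le)
  ultimately have "card {u. 0 < u \<and> reaches l u} \<le> Suc (card {u. 0 < u \<and> reaches (l div 2) u})"
    using card_mono[of "insert l {u. 0 < u \<and> reaches (l div 2) u}"] card_insert_le_m1
    by (metis (no_types, lifting) card_insert_if finite_insert le_SucI le_trans order_refl)
  also have "\<dots> \<le> Suc (L + 1)" using Suc.IH[of "l div 2"] Suc.prems by simp
  finally show ?case by simp
qed

function subtree :: "nat \<Rightarrow> nat \<Rightarrow> nat list" where
  "subtree N v = v # (if 0 < v \<and> v < N then subtree N (2 * v) @ subtree N (2 * v + 1) else [])"
  by pat_completeness auto
termination by (relation "Wellfounded.measure (\<lambda>(N, v). N - v)") auto

declare subtree.simps [simp del]

lemma self_in_subtree [simp]: "v \<in> set (subtree N v)"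
  by (subst subtree.simps) simp

lemma subtree_reaches: "u \<in> set (subtree N v) \<Longrightarrow> reaches u v"
proof (induction N v rule: subtree.induct)
  case (1 N v)
  then show ?case
    using reaches_half[of u "2 * v"] reaches_half[of u "2 * v + 1"]
    by (auto simp: subtree.simps[of N v] split: if_splits)
qed

lemma subtree_bounds: "\<lbrakk>u \<in> set (subtree N v); 0 < v; v < 2 * N\<rbrakk> \<Longrightarrow> v \<le> u \<and> u < 2 * N"
proof (induction N v rule: subtree.induct)
  case (1 N v)
  then show ?case by (fastforce simp: subtree.simps[of N v] split: if_splits)
qed

lemma distinct_subtree: "0 < v \<Longrightarrow> distinct (subtree N v)"
proof (induction N v rule: subtree.induct)
  case (1 N v)
  have "v \<notin> set (subtree N (2 * v))" "v \<notin> set (subtree N (2 * v + 1))"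
    using reaches_le[OF subtree_reaches] \<open>0 < v\<close> by fastforce+
  moreover have "set (subtree N (2 * v)) \<inter> set (subtree N (2 * v + 1)) = {}"
    using reaches_siblings[OF \<open>0 < v\<close>] subtree_reaches by blast
  moreover have "subtree N v = v # subtree N (2 * v) @ subtree N (2 * v + 1)" if "v < N"
    using that \<open>0 < v\<close> by (subst subtree.simps) (simp only: if_True simp_thms)
  moreover have "subtree N v = [v]" if "\<not> v < N"
    using that by (subst subtree.simps) (simp only: if_False simp_thms)
  ultimately show ?case
    using "1.IH" \<open>0 < v\<close>
    by (cases "v < N") (simp_all only: distinct.simps distinct_append set_append Un_iff, simp_all)
qed

section \<open>Expected number of visited nodes as a function of the failure probabilities\<close>

text \<open>
  The expected number of nodes visited below \<open>v\<close>, if the search goes on below an inner node \<open>u\<close>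
  with probability \<open>\<theta> u\<close>.
\<close>

function cost :: "nat \<Rightarrow> (nat \<Rightarrow> ennreal) \<Rightarrow> nat \<Rightarrow> ennreal" where
  "cost N \<theta> v = 1 + (if 0 < v \<and> v < N then \<theta> v * (cost N \<theta> (2 * v) + cost N \<theta> (2 * v + 1)) else 0)"
  by pat_completeness auto
termination by (relation "Wellfounded.measure (\<lambda>(N, \<theta>, v). N - v)") auto

declare cost.simps [simp del]

text \<open>Numbers only grow downwards, so no index smaller than \<open>v\<close> occurs below
  \<open>v\<close>.\<close>

lemma cost_upd: "u < v \<Longrightarrow> cost N (\<theta>(u := x)) v = cost N \<theta> v"
proof (induction N \<theta> v rule: cost.induct)
  case (1 N \<theta> v)
  then show ?case
    by (subst (1 2) cost.simps) (simp add: fun_upd_other del: fun_upd_apply)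
qed

lemma cost_finite: "(\<And>u. \<theta> u < top) \<Longrightarrow> cost N \<theta> v < top"
proof (induction N \<theta> v rule: cost.induct)
  case (1 N \<theta> v)
  then show ?case
    by (subst cost.simps) (auto simp: ennreal_mult_less_top)
qed

lemma cost_mono: "(\<And>u. \<theta> u \<le> \<theta>' u) \<Longrightarrow> cost N \<theta> v \<le> cost N \<theta>' v"
proof (induction N \<theta> v rule: cost.induct)
  case (1 N \<theta> v)
  then show ?case
    by (subst (1 2) cost.simps) (auto intro!: mult_mono add_mono)
qed

text \<open>No downward path meets a node twice, so \<open>cost\<close> is affine in each single
  value of \<open>\<theta>\<close> and an expectation passes through it. Applied to one node after
  the other, this takes the place of a statement about independence.\<close>

lemma cost_expectation:
  assumes "lossless_spmf p"
  shows "(\<integral>\<^sup>+ b. cost N (\<theta>(u := \<phi> b)) v \<partial>measure_spmf p) = cost N (\<theta>(u := \<integral>\<^sup>+ b. \<phi> b \<partial>measure_spmf p)) v"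
proof (induction N \<theta> v rule: cost.induct)
  case (1 N \<theta> v)
  have e: "emeasure (measure_spmf p) (Sigma_Algebra.space (measure_spmf p)) = 1"
    using assms
    by (simp add: measure_spmf.emeasure_eq_measure weight_spmf_def[symmetric] lossless_weight_spmfD)
  then have const: "(\<integral>\<^sup>+ b. c \<partial>measure_spmf p) = c" for c
    by simp
  show ?case
  proof (cases "0 < v \<and> v < N")
    case True
    show ?thesis
    proof (cases "u = v")
      case True
      then show ?thesis
        using \<open>0 < v \<and> v < N\<close>
        by (subst (1 2) cost.simps) (simp add: cost_upd nn_integral_add nn_integral_multc const e)
    next
      case False
      then show ?thesis
        using \<open>0 < v \<and> v < N\<close> 1
        by (subst (1 2) cost.simps)
          (simp add: nn_integral_add nn_integral_cmult e fun_upd_other del: fun_upd_apply)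
    qed
  next
    case False
    then have "cost N \<theta>' v = 1" for \<theta>' by (subst cost.simps) auto
    then show ?thesis by (simp add: e)
  qed
qed

text \<open>Each child brings a constant 1. At a crowded node the weight 2 pays for both children.
  With one color left, going on with probability at most \<open>1 - \<delta>\<close> saves
  \<open>\<delta> * (2 / \<delta>) = 2\<close> of the last term, which pays the same. With no color
  the search stops at once.\<close>

lemma cost_bound:
  fixes \<kappa> :: "nat \<Rightarrow> nat"
  assumes \<delta>: "0 < \<delta>" "\<delta> \<le> 1"
    and split: "\<And>v. 0 < v \<Longrightarrow> v < N \<Longrightarrow> \<kappa> v = \<kappa> (2 * v) + \<kappa> (2 * v + 1)"
    and \<theta>0: "\<And>v. \<kappa> v = 0 \<Longrightarrow> \<theta> v = 0"
    and \<theta>1: "\<And>v. \<kappa> v = 1 \<Longrightarrow> \<theta> v \<le> ennreal (1 - \<delta>)"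
    and \<theta>2: "\<And>v. \<theta> v \<le> 1"
  shows "cost N \<theta> v \<le> ennreal (1 + 2 * real (length (filter (\<lambda>u. u < N \<and> 2 \<le> \<kappa> u) (subtree N v)))
           + 2 / \<delta> * real (\<kappa> v))"
  using split \<theta>0 \<theta>1 \<theta>2
proof (induction N \<theta> v rule: cost.induct)
  case (1 N \<theta> v)
  note \<theta> = "1.prems"(2-4)
  define m where "m w = real (length (filter (\<lambda>u. u < N \<and> 2 \<le> \<kappa> u) (subtree N w)))" for w
  define b where "b w = 1 + 2 * m w + 2 / \<delta> * real (\<kappa> w)" for w
  have b: "1 \<le> b w" "0 \<le> m w" for w using \<open>0 < \<delta>\<close> by (auto simp: b_def m_def)
  show ?case
  proof (cases "0 < v \<and> v < N")
    case True
    have IH: "cost N \<theta> (2 * v) \<le> ennreal (b (2 * v))" "cost N \<theta> (2 * v + 1) \<le> ennreal (b (2 * v + 1))"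
      unfolding b_def m_def
      by (rule "1.IH"(1)[OF True "1.prems"], assumption+, rule "1.IH"(2)[OF True "1.prems"], assumption+)
    have m: "m v = (if 2 \<le> \<kappa> v then 1 else 0) + m (2 * v) + m (2 * v + 1)"
      using True by (simp add: m_def subtree.simps[of N v])
    have \<kappa>: "\<kappa> v = \<kappa> (2 * v) + \<kappa> (2 * v + 1)" using "1.prems"(1)[of v] True by blast
    have "cost N \<theta> v = 1 + \<theta> v * (cost N \<theta> (2 * v) + cost N \<theta> (2 * v + 1))"
      using True by (subst cost.simps) simp
    also have "\<dots> \<le> 1 + \<theta> v * (ennreal (b (2 * v)) + ennreal (b (2 * v + 1)))"
      by (intro add_mono mult_mono IH) auto
    also have "\<dots> = 1 + \<theta> v * ennreal (b (2 * v) + b (2 * v + 1))"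
      using b(1)[of "2 * v"] b(1)[of "2 * v + 1"] by simp
    also have "\<dots> \<le> ennreal (b v)"
    proof -
      consider "\<kappa> v = 0" | "\<kappa> v = 1" | "2 \<le> \<kappa> v" by linarith
      then show ?thesis
      proof cases
        case 1
        then show ?thesis using \<theta>(1) b(1)[of v] by simp
      next
        case 2
        have z: "\<theta> v * ennreal (b (2 * v) + b (2 * v + 1)) \<le> ennreal ((1 - \<delta>) * (b (2 * v) + b (2 * v + 1)))"
          using \<theta>(2)[OF 2] \<delta> b(1)[of "2 * v"] b(1)[of "2 * v + 1"]
          by (subst ennreal_mult) (auto intro!: mult_right_mono)
        have "1 + (1 - \<delta>) * (b (2 * v) + b (2 * v + 1)) \<le> b v"
        proof -
          have "real (\<kappa> (2 * v)) + real (\<kappa> (2 * v + 1)) = 1"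
            using 2 \<kappa> by (metis of_nat_1 of_nat_add)
          then have "2 / \<delta> * real (\<kappa> (2 * v)) + 2 / \<delta> * real (\<kappa> (2 * v + 1)) = 2 / \<delta>"
            by (metis distrib_left mult.right_neutral)
          then have "b (2 * v) + b (2 * v + 1) = 2 + 2 * m v + 2 / \<delta>"
            using 2 by (simp add: b_def m)
          moreover have "(1 - \<delta>) * (2 + 2 * m v + 2 / \<delta>) \<le> 2 * m v + 2 / \<delta>"
          proof -
            have "(1 - \<delta>) * (2 + 2 * m v + 2 / \<delta>) = 2 * m v + 2 / \<delta> - \<delta> * (2 + 2 * m v)"
              using \<delta> by (simp add: field_simps)
            moreover have "0 \<le> \<delta> * (2 + 2 * m v)" using \<delta> b(2)[of v] by simp
            ultimately show ?thesis by linarith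
          qed
          moreover have "b v = 1 + 2 * m v + 2 / \<delta>" using 2 by (simp add: b_def)
          ultimately show ?thesis by (simp only:)
        qed
        then have "ennreal 1 + ennreal ((1 - \<delta>) * (b (2 * v) + b (2 * v + 1))) \<le> ennreal (b v)"
          using \<delta> b(1)[of "2 * v"] b(1)[of "2 * v + 1"]
          by (subst ennreal_plus[symmetric]) (auto intro!: ennreal_leI simp del: ennreal_1 ennreal_plus)
        moreover have "1 + \<theta> v * ennreal (b (2 * v) + b (2 * v + 1))
            \<le> ennreal 1 + ennreal ((1 - \<delta>) * (b (2 * v) + b (2 * v + 1)))"
          using z by (simp only: ennreal_1 add_left_mono)
        ultimately show ?thesis by (rule order_trans[rotated])
      next
        case 3
        have "1 + \<theta> v * ennreal (b (2 * v) + b (2 * v + 1)) \<le> ennreal 1 + ennreal (b (2 * v) + b (2 * v + 1))"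
          using \<theta>(3)[of v] mult_right_mono[of "\<theta> v" 1] by (auto intro!: add_left_mono)
        also have "\<dots> = ennreal (1 + (b (2 * v) + b (2 * v + 1)))"
          using b(1)[of "2 * v"] b(1)[of "2 * v + 1"] by (subst ennreal_plus) auto
        also have "1 + (b (2 * v) + b (2 * v + 1)) = b v"
          using 3 by (simp add: b_def m \<kappa> algebra_simps)
        finally show ?thesis .
      qed
    qed
    finally show ?thesis by (simp add: b_def m_def)
  next
    case False
    then have "cost N \<theta> v = ennreal 1" by (subst cost.simps) auto
    also have "\<dots> \<le> ennreal (b v)" using b(1)[of v] by (intro ennreal_leI)
    finally show ?thesis by (simp add: b_def m_def)
  qed
qed


section \<open>Collisions of a random injection\<close>

definition load :: "(nat \<Rightarrow> nat) \<Rightarrow> nat set \<Rightarrow> nat \<Rightarrow> nat" where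
  "load T K u = card {c \<in> K. reaches (T c) u}"

lemma load_children:
  assumes "finite K" "0 < v" "v < N" "\<And>c. c \<in> K \<Longrightarrow> N \<le> T c"
  shows "load T K v = load T K (2 * v) + load T K (2 * v + 1)"
proof -
  have "{c \<in> K. reaches (T c) v} = {c \<in> K. reaches (T c) (2 * v)} \<union> {c \<in> K. reaches (T c) (2 * v + 1)}"
    using reaches_iff_children[OF assms(3)] assms(4) by auto
  moreover have "{c \<in> K. reaches (T c) (2 * v)} \<inter> {c \<in> K. reaches (T c) (2 * v + 1)} = {}"
    using reaches_siblings[OF assms(2)] by auto
  ultimately show ?thesis
    unfolding load_def using assms(1) by (simp add: card_Un_disjoint)
qed

text \<open>The value for not yet assigned colors bounds the probability of a later collision.\<close>

definition collide :: "nat \<Rightarrow> nat \<Rightarrow> nat \<Rightarrow> nat \<Rightarrow> real" where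
  "collide L j l l' =
    (if l \<noteq> 0 \<and> l' \<noteq> 0 then of_bool (l div 2 ^ (L - j) = l' div 2 ^ (L - j)) else 2 / 2 ^ j)"

definition collisions :: "nat \<Rightarrow> nat \<Rightarrow> nat set \<Rightarrow> (nat \<Rightarrow> nat) \<Rightarrow> real" where
  "collisions L J K T = (\<Sum>j\<in>{J..<L}. \<Sum>(c, d)\<in>{(c, d). c \<in> K \<and> d \<in> K \<and> c \<noteq> d}. collide L j (T c) (T d))"

lemma collide_nonneg: "0 \<le> collide L j l l'"
  by (simp add: collide_def)

lemma finite_pairs: "finite K \<Longrightarrow> finite {(c, d). c \<in> K \<and> d \<in> K \<and> c \<noteq> d}"
  by (rule finite_subset[of _ "K \<times> K"]) auto

text \<open>A crowded node is the common ancestor of two colors that collide on its level, so the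
  crowded nodes are an image of the set of colliding pairs.\<close>

lemma level_multi_le:
  assumes K: "finite K" and T: "\<And>c. c \<in> K \<Longrightarrow> T c \<in> {2 ^ L..<2 * 2 ^ L}" and "j < L"
  shows "real (card {u \<in> {2 ^ j..<2 * 2 ^ j}. 2 \<le> load T K u})
    \<le> (\<Sum>(c, d)\<in>{(c, d). c \<in> K \<and> d \<in> K \<and> c \<noteq> d}. collide L j (T c) (T d))"
proof -
  define X where "X = {(c, d). c \<in> K \<and> d \<in> K \<and> c \<noteq> d \<and> T c div 2 ^ (L - j) = T d div 2 ^ (L - j)}"
  have X: "finite X" using finite_subset[OF _ finite_pairs[OF K], of X] by (auto simp: X_def)
  have "{u \<in> {2 ^ j..<2 * 2 ^ j}. 2 \<le> load T K u} \<subseteq> (\<lambda>(c, d). T c div 2 ^ (L - j)) ` X"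
  proof
    fix u assume u: "u \<in> {u \<in> {2 ^ j..<2 * 2 ^ j}. 2 \<le> load T K u}"
    then have "2 \<le> card {c \<in> K. reaches (T c) u}" by (simp add: load_def)
    then obtain c d where "c \<noteq> d" "c \<in> K" "d \<in> K" "reaches (T c) u" "reaches (T d) u"
      using card_le_Suc0_iff_eq[of "{c \<in> K. reaches (T c) u}"] K by force
    moreover from this have "u = T c div 2 ^ (L - j)" "u = T d div 2 ^ (L - j)"
      using reaches_level[OF T, of _ u j] u \<open>j < L\<close> by auto
    ultimately show "u \<in> (\<lambda>(c, d). T c div 2 ^ (L - j)) ` X"
      by (intro image_eqI[of _ _ "(c, d)"]) (auto simp: X_def)
  qed
  then have "card {u \<in> {2 ^ j..<2 * 2 ^ j}. 2 \<le> load T K u} \<le> card X"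
    using surj_card_le[OF X] by blast
  then have "real (card {u \<in> {2 ^ j..<2 * 2 ^ j}. 2 \<le> load T K u}) \<le> (\<Sum>x\<in>X. 1)" by simp
  also have "\<dots> = (\<Sum>(c, d)\<in>X. collide L j (T c) (T d))"
    using T by (intro sum.cong refl) (force simp: X_def collide_def)
  also have "\<dots> \<le> (\<Sum>(c, d)\<in>{(c, d). c \<in> K \<and> d \<in> K \<and> c \<noteq> d}. collide L j (T c) (T d))"
    using finite_pairs[OF K] by (intro sum_mono2) (auto simp: X_def collide_nonneg)
  finally show ?thesis .
qed

lemma nodes_by_level: "{1..<2 ^ L} = (\<Union>j<L. {2 ^ j..<2 * 2 ^ j :: nat})"
proof (induction L)
  case (Suc L)
  have "{1..<2 ^ Suc L} = {1..<2 ^ L} \<union> {2 ^ L..<2 * 2 ^ L :: nat}"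
    by (auto simp: not_less intro: le_less_trans less_le_trans)
  then show ?case by (simp only: Suc lessThan_Suc UN_insert Un_commute)
qed simp

text \<open>The levels before \<open>J\<close> have fewer than \<open>2 ^ J\<close> nodes
  altogether; from \<open>J\<close> on, collisions are counted. The threshold \<open>J\<close> stays
  free until \<open>k\<close> is known.\<close>

lemma multi_le:
  assumes K: "finite K" and T: "\<And>c. c \<in> K \<Longrightarrow> T c \<in> {2 ^ L..<2 * 2 ^ L}"
  shows "real (length (filter (\<lambda>u. u < 2 ^ L \<and> 2 \<le> load T K u) (subtree (2 ^ L) 1)))
    \<le> 2 ^ J + collisions L J K T"
proof -
  define M where "M j = {u \<in> {2 ^ j..<2 * 2 ^ j}. 2 \<le> load T K u}" for j
  have M: "finite (M j)" "card (M j) \<le> 2 ^ j" for j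
  proof -
    show "finite (M j)" by (simp add: M_def)
    have "card (M j) \<le> card {2 ^ j..<2 * 2 ^ j :: nat}" by (rule card_mono) (auto simp: M_def)
    then show "card (M j) \<le> 2 ^ j" by simp
  qed
  have "length (filter (\<lambda>u. u < 2 ^ L \<and> 2 \<le> load T K u) (subtree (2 ^ L) 1))
      = card (set (filter (\<lambda>u. u < 2 ^ L \<and> 2 \<le> load T K u) (subtree (2 ^ L) 1)))"
    by (intro distinct_card[symmetric] distinct_filter distinct_subtree) simp
  also have "\<dots> \<le> card (\<Union>j<L. M j)"
  proof (rule card_mono)
    show "set (filter (\<lambda>u. u < 2 ^ L \<and> 2 \<le> load T K u) (subtree (2 ^ L) 1)) \<subseteq> (\<Union>j<L. M j)"
    proof
      fix u assume u: "u \<in> set (filter (\<lambda>u. u < 2 ^ L \<and> 2 \<le> load T K u) (subtree (2 ^ L) 1))"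
      then have "1 \<le> u" using subtree_bounds[of u "2 ^ L" 1] by auto
      then have "u \<in> (\<Union>j<L. {2 ^ j..<2 * 2 ^ j})"
        using u unfolding nodes_by_level[symmetric] by simp
      then show "u \<in> (\<Union>j<L. M j)" using u by (auto simp: M_def)
    qed
  qed (use M in auto)
  also have "\<dots> \<le> (\<Sum>j<L. card (M j))" by (rule card_UN_le) simp
  also have "real \<dots> \<le> (\<Sum>j<J. 2 ^ j) + (\<Sum>j\<in>{J..<L}. real (card (M j)))"
  proof -
    have "(\<Sum>j<L. real (card (M j))) \<le> (\<Sum>j\<in>{..<J} \<union> {J..<L}. real (card (M j)))"
      by (rule sum_mono2) auto
    also have "\<dots> = (\<Sum>j<J. real (card (M j))) + (\<Sum>j\<in>{J..<L}. real (card (M j)))"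
      by (rule sum.union_disjoint) auto
    also have "(\<Sum>j<J. real (card (M j))) \<le> (\<Sum>j<J. 2 ^ j)"
      using M(2) by (intro sum_mono) (metis of_nat_le_iff of_nat_numeral of_nat_power)
    finally show ?thesis by simp
  qed
  also have "(\<Sum>j<J. 2 ^ j :: real) \<le> 2 ^ J"
    by (induction J) auto
  also have "(\<Sum>j\<in>{J..<L}. real (card (M j))) \<le> collisions L J K T"
    unfolding collisions_def M_def using level_multi_le[OF K T] by (intro sum_mono) auto
  finally show ?thesis by simp
qed

text \<open>In the empty table every pair has the value \<open>2 / 2 ^ j\<close>, and the geometric
  series over the levels from \<open>J\<close> on sums to at most \<open>4 / 2 ^ J\<close>.\<close>

lemma collisions_empty:
  assumes "finite K"
  shows "collisions L J K (\<lambda>_. 0) \<le> 4 * (real (card K))\<^sup>2 / 2 ^ J"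
proof -
  have "card {(c, d). c \<in> K \<and> d \<in> K \<and> c \<noteq> d} \<le> card (K \<times> K)"
    using assms by (intro card_mono) auto
  then have pairs: "real (card {(c, d). c \<in> K \<and> d \<in> K \<and> c \<noteq> d}) \<le> (real (card K))\<^sup>2"
    by (simp add: card_cartesian_product power2_eq_square flip: of_nat_mult)
  have geo: "(\<Sum>j\<in>{J..<L}. 2 / 2 ^ j :: real) \<le> 4 / 2 ^ J"
  proof (cases "J \<le> L")
    case True
    then have "(\<Sum>j\<in>{J..<L}. 2 / 2 ^ j :: real) = 4 / 2 ^ J - 4 / 2 ^ L"
    proof (induction L rule: dec_induct)
      case (step m)
      have "(\<Sum>j = J..<Suc m. 2 / 2 ^ j :: real) = 4 / 2 ^ J - 4 / 2 ^ m + 2 / 2 ^ m"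
        using step by (simp only: sum.atLeastLessThan_Suc)
      then show ?case by (simp add: field_simps)
    qed simp
    then show ?thesis by simp
  qed simp
  have "collisions L J K (\<lambda>_. 0)
      = (\<Sum>j\<in>{J..<L}. real (card {(c, d). c \<in> K \<and> d \<in> K \<and> c \<noteq> d}) * (2 / 2 ^ j))"
    by (simp add: collisions_def collide_def split_def)
  also have "\<dots> = real (card {(c, d). c \<in> K \<and> d \<in> K \<and> c \<noteq> d}) * (\<Sum>j\<in>{J..<L}. 2 / 2 ^ j)"
    by (simp only: sum_distrib_left)
  also have "\<dots> \<le> (real (card K))\<^sup>2 * (4 / 2 ^ J)"
    by (intro mult_mono pairs geo sum_nonneg) auto
  finally show ?thesis by (simp add: mult.commute)
qed

text \<open>A node of level \<open>j\<close> has \<open>2 ^ (L - j)\<close> leaves below it, and the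
  draw is among at least \<open>2 ^ L / 2\<close> distinct ones; this explains the 2 in the value of
  an unassigned pair.\<close>

lemma average_hits_le:
  fixes A :: "nat \<Rightarrow> nat"
  assumes "inj_on A {..<m}" "2 ^ L \<le> 2 * m" "0 < m" "j \<le> L"
  shows "(\<Sum>i<m. of_bool (A i div 2 ^ (L - j) = x)) / real m \<le> 2 / 2 ^ j"
proof -
  define B :: nat where "B = 2 ^ (L - j)"
  have "(\<Sum>i<m. of_bool (A i div B = x)) = real (card {i \<in> {..<m}. A i div B = x})"
    by (simp add: of_bool_def sum.If_cases Int_def)
  also have "card {i \<in> {..<m}. A i div B = x} = card (A ` {i \<in> {..<m}. A i div B = x})"
    by (intro card_image[symmetric] inj_on_subset[OF assms(1)]) auto
  also have "\<dots> \<le> card {x * B..<x * B + B}"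
  proof (rule card_mono)
    show "A ` {i \<in> {..<m}. A i div B = x} \<subseteq> {x * B..<x * B + B}"
      using dividend_less_div_times[of B] by (auto simp: B_def add.commute)
  qed simp
  finally have "(\<Sum>i<m. of_bool (A i div B = x)) \<le> real B" by simp
  then have "(\<Sum>i<m. of_bool (A i div B = x)) / real m \<le> real B / real m"
    by (intro divide_right_mono) auto
  also have "\<dots> \<le> 2 / 2 ^ j"
  proof -
    have "real B * 2 ^ j = 2 ^ L"
      using assms(4) by (simp add: B_def flip: power_add)
    also have "\<dots> \<le> 2 * real m"
      using assms(2) by (metis of_nat_le_iff of_nat_mult of_nat_numeral of_nat_power)
    finally show ?thesis using assms(3) by (simp add: field_simps)
  qed
  finally show ?thesis by (simp add: B_def)
qed

text \<open>If the draw completes the pair, the value \<open>2 / 2 ^ j\<close> is traded for an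
  event of at most that probability. If the pair stays incomplete or is not touched, its value does
  not change.\<close>

lemma average_collide_le:
  fixes A :: "nat \<Rightarrow> nat"
  assumes A: "inj_on A {..<m}" "2 ^ L \<le> 2 * m" "0 < m" "j \<le> L" "\<And>i. i < m \<Longrightarrow> A i \<noteq> 0"
    and "c \<noteq> d" "T e = 0"
  shows "(\<Sum>i<m. collide L j ((T(e := A i)) c) ((T(e := A i)) d)) / real m \<le> collide L j (T c) (T d)"
proof -
  consider "c = e" "T d \<noteq> 0" | "d = e" "T c \<noteq> 0" | "c = e" "T d = 0" | "d = e" "T c = 0" | "c \<noteq> e" "d \<noteq> e"
    by blast
  then show ?thesis
  proof cases
    case 1
    then have "(\<Sum>i<m. collide L j ((T(e := A i)) c) ((T(e := A i)) d))
        = (\<Sum>i<m. of_bool (A i div 2 ^ (L - j) = T d div 2 ^ (L - j)))"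
      using assms by (intro sum.cong) (auto simp: collide_def)
    then show ?thesis
      using average_hits_le[OF A(1-4)] 1 assms by (simp add: collide_def)
  next
    case 2
    then have "(\<Sum>i<m. collide L j ((T(e := A i)) c) ((T(e := A i)) d))
        = (\<Sum>i<m. of_bool (A i div 2 ^ (L - j) = T c div 2 ^ (L - j)))"
      using assms by (intro sum.cong) (auto simp: collide_def)
    then show ?thesis
      using average_hits_le[OF A(1-4)] 2 assms by (simp add: collide_def)
  next
    case 3
    then have "(\<Sum>i<m. collide L j ((T(e := A i)) c) ((T(e := A i)) d)) = (\<Sum>i<m. 2 / 2 ^ j)"
      using assms by (intro sum.cong) (auto simp: collide_def)
    then show ?thesis using 3 assms by (simp add: collide_def)
  next
    case 4
    then have "(\<Sum>i<m. collide L j ((T(e := A i)) c) ((T(e := A i)) d)) = (\<Sum>i<m. 2 / 2 ^ j)"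
      using assms by (intro sum.cong) (auto simp: collide_def)
    then show ?thesis using 4 assms by (simp add: collide_def)
  next
    case 5
    then show ?thesis using \<open>0 < m\<close> by simp
  qed
qed

lemma average_collisions_le:
  fixes A :: "nat \<Rightarrow> nat"
  assumes "inj_on A {..<m}" "2 ^ L \<le> 2 * m" "0 < m" "\<And>i. i < m \<Longrightarrow> A i \<noteq> 0" "T e = 0"
  shows "(\<Sum>i<m. collisions L J K (T(e := A i))) / real m \<le> collisions L J K T"
proof -
  have "(\<Sum>i<m. collisions L J K (T(e := A i))) / real m
    = (\<Sum>j\<in>{J..<L}. \<Sum>(c, d)\<in>{(c, d). c \<in> K \<and> d \<in> K \<and> c \<noteq> d}.
        (\<Sum>i<m. collide L j ((T(e := A i)) c) ((T(e := A i)) d)) / real m)"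
    unfolding collisions_def split_def sum_divide_distrib
    by (subst sum.swap) (intro sum.cong refl, subst sum.swap, simp)
  also have "\<dots> \<le> collisions L J K T"
    unfolding collisions_def using assms
    by (intro sum_mono) (auto intro!: average_collide_le simp del: fun_upd_apply)
  finally show ?thesis .
qed

section \<open>Two-dimensional memory\<close>

text \<open>
  Memory consists of blocks of \<open>W\<close> cells, where \<open>W\<close> is kept in register 2. Block 0 contains the input
  and finally the header, block 1 the color table and later the stack of a query, block 2 the free
  leaves, block 3 the number of points of each node, and the blocks \<open>2 * u + 2\<close> and \<open>2 * u + 3\<close>
  belong to the node \<open>u > 0\<close>. Simulated programs use the registers from 16 on.
\<close>

definition addr :: "nat \<Rightarrow> nat \<Rightarrow> nat \<Rightarrow> nat" where
  "addr W x y = x * W + y"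

definition flat :: "nat \<Rightarrow> (nat \<Rightarrow> nat \<Rightarrow> ('p, 'o) val) \<Rightarrow> nat \<Rightarrow> ('p, 'o) val" where
  "flat W G a = G (a div W) (a mod W)"

lemma flat_addr: "y < W \<Longrightarrow> flat W G (addr W x y) = G x y"
  by (simp add: flat_def addr_def)

lemma flat_low: "y < W \<Longrightarrow> flat W G y = G 0 y"
  by (simp add: flat_def)

lemma flat_upd:
  assumes "y < W"
  shows "(flat W G)(addr W x y := v) = flat W (G(x := (G x)(y := v)))"
proof
  fix a
  have "a = addr W x y \<longleftrightarrow> a div W = x \<and> a mod W = y"
    using assms by (auto simp: addr_def)
  then show "((flat W G)(addr W x y := v)) a = flat W (G(x := (G x)(y := v))) a"
    by (auto simp: flat_def)
qed

lemma flat_block: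
  assumes "0 < W"
  shows "(\<lambda>a. if addr W x 0 \<le> a \<and> a < addr W x 0 + W then m (a - addr W x 0) else flat W G a)
    = flat W (G(x := m))"
proof
  fix a
  have *: "addr W x 0 \<le> a \<and> a < addr W x 0 + W \<longleftrightarrow> a div W = x"
    using assms div_nat_eqI[of W x a] dividend_less_div_times[of W a] div_times_less_eq_dividend[of a W]
    by (auto simp: addr_def mult.commute)
  have "a - addr W x 0 = a mod W" if "a div W = x"
    using that by (auto simp: addr_def minus_div_mult_eq_mod)
  then show "(if addr W x 0 \<le> a \<and> a < addr W x 0 + W then m (a - addr W x 0) else flat W G a)
    = flat W (G(x := m)) a"
    unfolding * by (auto simp: flat_def)
qed

definition conf ::
  "nat \<Rightarrow> (nat \<Rightarrow> ('p, 'o) val) \<Rightarrow> (nat \<Rightarrow> nat \<Rightarrow> ('p, 'o) val) \<Rightarrow> ('p, 'o) val list \<Rightarrow> nat \<Rightarrow> ('p, 'o) state" where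
  "conf W \<rho> G ou k = \<lparr>regs = \<rho>, mem = flat W G, out = ou, clock = k\<rparr>"

lemma conf_simps [simp]:
  "regs (conf W \<rho> G ou k) = \<rho>" "mem (conf W \<rho> G ou k) = flat W G"
  "out (conf W \<rho> G ou k) = ou" "clock (conf W \<rho> G ou k) = k"
  by (simp_all add: conf_def)

definition Adr :: "exp \<Rightarrow> exp \<Rightarrow> exp" where
  "Adr ex ey = Op Add (Op Mul ex (Reg 2)) ey"

lemma eval_Adr: "\<rho> 2 = Num W \<Longrightarrow>
  eval F \<rho> (Adr ex ey) = Num (addr W (num (eval F \<rho> ex)) (num (eval F \<rho> ey)))"
  by (simp add: Adr_def addr_def)

lemma addr_less:
  assumes "x < X" "y < W" "X * W \<le> w"
  shows "addr W x y < w"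
proof -
  have "addr W x y < Suc x * W" using assms by (simp add: addr_def)
  also have "\<dots> \<le> X * W" using assms by (intro mult_le_mono1) simp
  finally show ?thesis using assms by simp
qed

lemma conf_Skip: "exec F w Skip (conf W \<rho> G ou k) = return_spmf (conf W \<rho> G ou (Suc k))"
  by (simp add: exec_Skip tick_def conf_def)

lemma conf_Assign: "num (eval F \<rho> e) < w \<Longrightarrow>
  exec F w (Assign r e) (conf W \<rho> G ou k) = return_spmf (conf W (\<rho>(r := eval F \<rho> e)) G ou (Suc k))"
  by (simp add: exec_Assign conf_def)

lemma conf_Load_low: "num (eval F \<rho> e) < W \<Longrightarrow> W \<le> w \<Longrightarrow>
  exec F w (Load r e) (conf W \<rho> G ou k)
    = return_spmf (conf W (\<rho>(r := G 0 (num (eval F \<rho> e)))) G ou (Suc k))"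
  by (simp add: exec_Load conf_def flat_low)

lemma conf_Load: "\<rho> 2 = Num W \<Longrightarrow> num (eval F \<rho> ey) < W \<Longrightarrow> num (eval F \<rho> ex) < X \<Longrightarrow> X * W \<le> w \<Longrightarrow>
  exec F w (Load r (Adr ex ey)) (conf W \<rho> G ou k)
    = return_spmf (conf W (\<rho>(r := G (num (eval F \<rho> ex)) (num (eval F \<rho> ey)))) G ou (Suc k))"
  using addr_less[of "num (eval F \<rho> ex)" X "num (eval F \<rho> ey)" W w]
  by (simp add: exec_Load eval_Adr conf_def flat_addr)

lemma conf_Store: "\<rho> 2 = Num W \<Longrightarrow> num (eval F \<rho> ey) < W \<Longrightarrow> num (eval F \<rho> ex) < X \<Longrightarrow> X * W \<le> w \<Longrightarrow>
  num (eval F \<rho> e) < w \<Longrightarrow>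
  exec F w (Store (Adr ex ey) e) (conf W \<rho> G ou k)
    = return_spmf (conf W \<rho> (G(num (eval F \<rho> ex) :=
        (G (num (eval F \<rho> ex)))(num (eval F \<rho> ey) := eval F \<rho> e))) ou (Suc k))"
  using addr_less[of "num (eval F \<rho> ex)" X "num (eval F \<rho> ey)" W w]
  by (simp add: exec_Store eval_Adr conf_def flat_upd)

lemma conf_Report: "num (eval F \<rho> e) < w \<Longrightarrow>
  exec F w (Report e) (conf W \<rho> G ou k) = return_spmf (conf W \<rho> G (ou @ [eval F \<rho> e]) (Suc k))"
  by (simp add: exec_Report conf_def)

lemma conf_Rand: "num (eval F \<rho> e) < w \<Longrightarrow>
  exec F w (Rand r e) (conf W \<rho> G ou k)
    = map_spmf (\<lambda>j. conf W (\<rho>(r := Num j)) G ou (Suc k)) (spmf_of_set {..<num (eval F \<rho> e)})"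
  by (simp add: exec_Rand conf_def)

lemma conf_Cond: "exec F w (Cond e c1 c2) (conf W \<rho> G ou k)
    = exec F w (if num (eval F \<rho> e) \<noteq> 0 then c1 else c2) (conf W \<rho> G ou (Suc k))"
  by (simp add: exec_Cond tick_def conf_def)

lemma conf_While: "exec F w (While e c) (conf W \<rho> G ou k)
    = (if num (eval F \<rho> e) \<noteq> 0
       then bind_spmf (exec F w c (conf W \<rho> G ou (Suc k))) (exec F w (While e c))
       else return_spmf (conf W \<rho> G ou (Suc k)))"
  by (subst exec_While) (simp add: tick_def conf_def)

lemma exec_sub:
  assumes "\<rho> 1 = Num (addr W x 0)" "1 < K" "\<And>r. r < M \<Longrightarrow> \<rho> (K + r) = \<rho>' r"
    and "0 < W" "w' \<le> W" "addr W x 0 + w' \<le> w" "com_regs c \<subseteq> {..<M}"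
    and "lossless_spmf (exec F w' c \<lparr>regs = \<rho>', mem = G x, out = [], clock = 0\<rparr>)"
  shows "exec F w (reloc K 1 c) (conf W \<rho> G ou k)
    = map_spmf (\<lambda>t. conf W (\<lambda>r. if K \<le> r \<and> r < K + M then regs t (r - K) else \<rho> r)
          (G(x := mem t)) ou (k + clock t))
        (exec F w' c \<lparr>regs = \<rho>', mem = G x, out = [], clock = 0\<rparr>)"
proof -
  \<comment> \<open>The host already agrees with the initial state of the guest on the register
    window and on the block, so it is an embedding of that state.\<close>
  have "conf W \<rho> G ou k = embed K M (addr W x 0) W (conf W \<rho> G ou k)
      \<lparr>regs = \<rho>', mem = G x, out = [], clock = 0\<rparr>"
  proof -
    have "\<rho> = (\<lambda>r. if K \<le> r \<and> r < K + M then \<rho>' (r - K) else \<rho> r)"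
      using assms(3) by (auto simp: fun_eq_iff) (metis add_diff_inverse_nat add_less_cancel_left leD)
    then show ?thesis
      using flat_block[OF assms(4), of x "G x" G]
      by (simp add: embed_def conf_def cong: if_cong)
  qed
  then have "exec F w (reloc K 1 c) (conf W \<rho> G ou k)
    = map_spmf (embed K M (addr W x 0) W (conf W \<rho> G ou k))
       (exec F w' c \<lparr>regs = \<rho>', mem = G x, out = [], clock = 0\<rparr>)"
    using exec_reloc[of "conf W \<rho> G ou k" 1 "addr W x 0" K w' W w c M F
       "\<lparr>regs = \<rho>', mem = G x, out = [], clock = 0\<rparr>"] assms by simp
  also have "embed K M (addr W x 0) W (conf W \<rho> G ou k) =
      (\<lambda>t. conf W (\<lambda>r. if K \<le> r \<and> r < K + M then regs t (r - K) else \<rho> r)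
          (G(x := mem t)) ou (k + clock t))"
    by (rule ext) (simp add: embed_def conf_def flat_block[OF assms(4)] cong: if_cong)
  finally show ?thesis .
qed

text \<open>A guest expects blank registers, whereas the window still holds what the previous guest
  left there.\<close>

fun reset :: "nat \<Rightarrow> nat \<Rightarrow> com" where
  "reset K 0 = Skip"
| "reset K (Suc M) = Seq (reset K M) (Assign (K + M) (Const 0))"

lemma conf_reset: "0 < w \<Longrightarrow> exec F w (reset K M) (conf W \<rho> G ou k)
    = return_spmf (conf W (\<lambda>r. if K \<le> r \<and> r < K + M then Num 0 else \<rho> r) G ou (k + M + 1))"
proof (induction M)
  case 0
  have "(\<lambda>r. if K \<le> r \<and> r < K then Num 0 else \<rho> r) = \<rho>" by (auto simp: fun_eq_iff)
  then show ?case by (simp add: conf_Skip)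
next
  case (Suc M)
  have "(\<lambda>r. if K \<le> r \<and> r < K + M then Num 0 else \<rho> r)(K + M := Num 0)
      = (\<lambda>r. if K \<le> r \<and> r < K + Suc M then Num 0 else \<rho> r)"
    by (auto simp: fun_eq_iff)
  then show ?case using Suc by (simp add: exec_Seq conf_Assign)
qed

text \<open>The exponent is a constant of the program, so the unfolded product has constant size and
  is evaluated by one command.\<close>

fun pow_exp :: "exp \<Rightarrow> nat \<Rightarrow> exp" where
  "pow_exp e 0 = Const 1"
| "pow_exp e (Suc k) = Op Mul e (pow_exp e k)"

lemma eval_pow_exp: "eval F \<rho> (pow_exp e k) = Num (num (eval F \<rho> e) ^ k)"
  by (induction k) auto

lemma less_addr_bound: "a < W \<Longrightarrow> 0 < X \<Longrightarrow> X * W \<le> w \<Longrightarrow> a < (w::nat)"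
  by (metis less_le_trans mult_le_mono1 mult_1 Suc_leI One_nat_def order_trans)

section \<open>Deterministic phases of the preprocessing\<close>

abbreviation inc :: "nat \<Rightarrow> com" where
  "inc r \<equiv> Assign r (Op Add (Reg r) (Const 1))"

text \<open>The maximal color is needed to compute the block width. With truncated subtraction,
  \<open>u + (c - u)\<close> is the maximum of \<open>u\<close> and \<open>c\<close>.\<close>

definition scan :: com where
  "scan = While (Op Less (Reg 5) (Reg 4))
    (Seq (Load 11 (Op Add (Op Mul (Const 2) (Reg 5)) (Const 2)))
    (Seq (Assign 6 (Op Add (Reg 6) (Op Sub (Reg 11) (Reg 6)))) (inc 5)))"

definition double :: com where
  "double = While (Op Less (Reg 3) (Op Mul (Const 2) (Reg 4))) (Assign 3 (Op Mul (Const 2) (Reg 3)))"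

definition fill :: com where
  "fill = While (Op Less (Reg 7) (Reg 3))
    (Seq (Store (Adr (Const 2) (Reg 7)) (Op Add (Reg 3) (Reg 7))) (inc 7))"

lemma input_mem_point: "i < length xs \<Longrightarrow> input_mem xs (Suc (2 * i)) = Point (fst (xs ! i))"
  and input_mem_color: "i < length xs \<Longrightarrow> input_mem xs (Suc (Suc (2 * i))) = Num (snd (xs ! i))"
  by (simp_all add: input_mem_def)

lemma exec_scan:
  assumes "G 0 = input_mem xs" "\<rho> 4 = Num (length xs)" "\<rho> 5 = Num i" "\<rho> 6 = Num u" "i \<le> length xs"
    and "2 * length xs + 2 < W" "W \<le> w" "u < W" "\<And>x. x \<in> set xs \<Longrightarrow> snd x < W"
  shows "\<exists>\<rho>'. exec F w scan (conf W \<rho> G ou k)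
      = return_spmf (conf W \<rho>' G ou (k + 4 * (length xs - i) + 1))
    \<and> \<rho>' 6 = Num (Max (insert u (snd ` set (drop i xs)))) \<and> (\<forall>r. r \<notin> {5, 6, 11} \<longrightarrow> \<rho>' r = \<rho> r)"
  using assms
proof (induction "length xs - i" arbitrary: i u \<rho> k)
  case 0
  then show ?case
    by (intro exI[of _ \<rho>]) (simp add: scan_def conf_While)
next
  case (Suc d)
  then have i: "i < length xs" by simp
  define c where "c = snd (xs ! i)"
  define \<rho>1 where "\<rho>1 = \<rho>(11 := Num c, 6 := Num (u + (c - u)), 5 := Num (i + 1))"
  have c: "c < W" "u + (c - u) < w" "i + 1 < w" "u + (c - u) = max u c"
    using Suc.prems(6-8) Suc.prems(9)[OF nth_mem[OF i]] i by (auto simp: c_def max_def)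
  have "exec F w scan (conf W \<rho> G ou k) = exec F w scan (conf W \<rho>1 G ou (k + 4))"
    unfolding scan_def
    apply (subst conf_While)
    using Suc.prems i c(1-3)
    by (simp add: exec_Seq conf_Load_low conf_Assign input_mem_color \<rho>1_def flip: c_def, simp add: eval_nat_numeral)
  moreover have "\<exists>\<rho>'. exec F w scan (conf W \<rho>1 G ou (k + 4))
      = return_spmf (conf W \<rho>' G ou (k + 4 + 4 * (length xs - (i + 1)) + 1))
    \<and> \<rho>' 6 = Num (Max (insert (max u c) (snd ` set (drop (i + 1) xs))))
    \<and> (\<forall>r. r \<notin> {5, 6, 11} \<longrightarrow> \<rho>' r = \<rho>1 r)"
    using Suc.hyps(2) Suc.prems i c by (intro Suc.hyps(1)) (simp_all add: \<rho>1_def c(4))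
  moreover have "Max (insert (max u c) (snd ` set (drop (i + 1) xs))) = Max (insert u (snd ` set (drop i xs)))"
    using i by (simp add: Cons_nth_drop_Suc[symmetric] c_def insert_commute)
      (cases "drop (Suc i) xs", simp_all add: max.assoc)
  moreover have "k + 4 + 4 * (length xs - (i + 1)) + 1 = k + 4 * (length xs - i) + 1" using i by simp
  ultimately show ?case by (simp only:) (auto simp: \<rho>1_def)
qed

text \<open>The crude linear time bound is enough: each round takes 2 units and lowers
  \<open>2 * n - 2 ^ j\<close> by at least 1.\<close>

lemma exec_double:
  assumes "\<rho> 4 = Num n" "\<rho> 3 = Num (2 ^ j)" "2 ^ j < 4 * n" "4 * n < w"
  shows "\<exists>\<rho>' k' L. exec F w double (conf W \<rho> G ou k) = return_spmf (conf W \<rho>' G ou k')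
    \<and> k' \<le> k + 2 * (2 * n - 2 ^ j) + 1 \<and> \<rho>' 3 = Num (2 ^ L) \<and> 2 * n \<le> 2 ^ L \<and> 2 ^ L < 4 * n
    \<and> (\<forall>r. r \<noteq> 3 \<longrightarrow> \<rho>' r = \<rho> r)"
  using assms
proof (induction "2 * n - 2 ^ j" arbitrary: j \<rho> k rule: less_induct)
  case less
  show ?case
  proof (cases "2 ^ j < 2 * n")
    case False
    then show ?thesis using less.prems
      by (intro exI[of _ \<rho>] exI[of _ "k + 1"] exI[of _ j]) (simp add: double_def conf_While)
  next
    case True
    define \<rho>1 :: "nat \<Rightarrow> ('a, 'b) val" where "\<rho>1 = \<rho>(3 := Num (2 ^ Suc j))"
    have "exec F w double (conf W \<rho> G ou k) = exec F w double (conf W \<rho>1 G ou (k + 2))"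
      unfolding double_def
      apply (subst conf_While)
      using less.prems True by (simp add: conf_Assign \<rho>1_def)
    moreover have "(2::nat) ^ j \<ge> 1" by simp
    moreover have "\<exists>\<rho>' k' L. exec F w double (conf W \<rho>1 G ou (k + 2)) = return_spmf (conf W \<rho>' G ou k')
      \<and> k' \<le> k + 2 + 2 * (2 * n - 2 ^ Suc j) + 1 \<and> \<rho>' 3 = Num (2 ^ L) \<and> 2 * n \<le> 2 ^ L \<and> 2 ^ L < 4 * n
      \<and> (\<forall>r. r \<noteq> 3 \<longrightarrow> \<rho>' r = \<rho>1 r)"
    proof (rule less.hyps)
      show "2 * n - 2 ^ Suc j < 2 * n - 2 ^ j" using True \<open>(2::nat) ^ j \<ge> 1\<close>
        by (simp only: power_Suc)
    qed (use True less.prems in \<open>auto simp: \<rho>1_def\<close>)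
    moreover have "k + 2 + 2 * (2 * n - 2 ^ Suc j) + 1 \<le> k + 2 * (2 * n - 2 ^ j) + 1"
      using True \<open>(2::nat) ^ j \<ge> 1\<close> unfolding power_Suc by linarith
    ultimately show ?thesis by (simp only:) (force simp: \<rho>1_def intro: order_trans)
  qed
qed

lemma exec_fill:
  assumes "\<rho> 2 = Num W" "\<rho> 3 = Num N" "\<rho> 7 = Num m" "m \<le> N" "2 * N < W" "3 * W \<le> w"
  shows "\<exists>\<rho>'. exec F w fill (conf W \<rho> G ou k)
      = return_spmf (conf W \<rho>' (G(2 := \<lambda>y. if m \<le> y \<and> y < N then Num (N + y) else G 2 y)) ou
          (k + 3 * (N - m) + 1))
    \<and> \<rho>' 7 = Num N \<and> (\<forall>r. r \<noteq> 7 \<longrightarrow> \<rho>' r = \<rho> r)"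
  using assms
proof (induction "N - m" arbitrary: m \<rho> G k)
  case 0
  have "G(2 := \<lambda>y. if m \<le> y \<and> y < N then Num (N + y) else G 2 y) = G"
    using 0 by (auto simp: fun_eq_iff)
  with 0 show ?case
    by (intro exI[of _ \<rho>]) (simp add: fill_def conf_While)
next
  case (Suc d)
  then have m: "m < N" by simp
  define \<rho>1 :: "nat \<Rightarrow> ('a, 'b) val" where "\<rho>1 = \<rho>(7 := Num (m + 1))"
  define G1 where "G1 = G(2 := (G 2)(m := Num (N + m)))"
  have "exec F w fill (conf W \<rho> G ou k) = exec F w fill (conf W \<rho>1 G1 ou (k + 3))"
    unfolding fill_def
    apply (subst conf_While)
    using Suc.prems m
    by (simp add: exec_Seq conf_Store[where X = 3] conf_Assign \<rho>1_def G1_def, simp add: eval_nat_numeral)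
  moreover have "G1(2 := \<lambda>y. if m + 1 \<le> y \<and> y < N then Num (N + y) else G1 2 y)
      = G(2 := \<lambda>y. if m \<le> y \<and> y < N then Num (N + y) else G 2 y)"
    using m by (auto simp: G1_def fun_eq_iff)
  moreover have "k + 3 + 3 * (N - (m + 1)) + 1 = k + 3 * (N - m) + 1" using m by simp
  moreover have "\<exists>\<rho>'. exec F w fill (conf W \<rho>1 G1 ou (k + 3))
      = return_spmf (conf W \<rho>' (G1(2 := \<lambda>y. if m + 1 \<le> y \<and> y < N then Num (N + y) else G1 2 y)) ou
          (k + 3 + 3 * (N - (m + 1)) + 1))
    \<and> \<rho>' 7 = Num N \<and> (\<forall>r. r \<noteq> 7 \<longrightarrow> \<rho>' r = \<rho>1 r)"
    using Suc.hyps(2) Suc.prems m by (intro Suc.hyps(1)) (auto simp: \<rho>1_def)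
  ultimately show ?case by (simp only:) (auto simp: \<rho>1_def)
qed

section \<open>Random assignment of colors to leaves\<close>

text \<open>A Fisher-Yates step: the last free leaf moves into the gap, so that the free leaves
  remain a prefix of the array and the next draw is again uniform below a number.\<close>

definition take_leaf :: com where
  "take_leaf = Seq (Load 9 (Adr (Const 2) (Reg 8)))
    (Seq (Store (Adr (Const 1) (Reg 11)) (Reg 9))
    (Seq (Assign 7 (Op Sub (Reg 7) (Const 1)))
    (Seq (Load 10 (Adr (Const 2) (Reg 7)))
    (Store (Adr (Const 2) (Reg 8)) (Reg 10)))))"

definition assign :: com where
  "assign = While (Op Less (Reg 5) (Reg 4))
    (Seq (Load 11 (Op Add (Op Mul (Const 2) (Reg 5)) (Const 2)))
    (Seq (Load 9 (Adr (Const 1) (Reg 11)))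
    (Seq (Cond (Reg 9) Skip (Seq (Rand 8 (Reg 7)) take_leaf)) (inc 5))))"

text \<open>
  \<open>T\<close> is the color table (with value 0 for unassigned colors), and \<open>A\<close> lists the \<open>m\<close> free leaves.
\<close>

definition shuffle_inv :: "nat \<Rightarrow> nat \<Rightarrow> (nat \<Rightarrow> nat) \<Rightarrow> (nat \<Rightarrow> nat) \<Rightarrow> bool" where
  "shuffle_inv N m T A \<longleftrightarrow> m \<le> N \<and> inj_on A {..<m} \<and> A ` {..<m} \<subseteq> {N..<2 * N} \<and>
     inj_on T {c. T c \<noteq> 0} \<and> T ` {c. T c \<noteq> 0} \<subseteq> {N..<2 * N} - A ` {..<m}"

lemma shuffle_inv_step:
  assumes inv: "shuffle_inv N m T A" and "j < m" "T c = 0" "0 < N"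
  shows "shuffle_inv N (m - 1) (T(c := A j)) (A(j := A (m - 1)))"
proof -
  let ?A = "A(j := A (m - 1))"
  have A: "inj_on A {..<m}" "A ` {..<m} \<subseteq> {N..<2 * N}"
    and T: "inj_on T {c. T c \<noteq> 0}" "T ` {c. T c \<noteq> 0} \<subseteq> {N..<2 * N} - A ` {..<m}" "m \<le> N"
    using inv by (auto simp: shuffle_inv_def)
  \<comment> \<open>The new array is the old one read through \<open>f\<close>, which is injective
    below \<open>m - 1\<close> and avoids the drawn slot \<open>j\<close>.\<close>
  define f where "f i = (if i = j then m - 1 else i)" for i
  have f: "inj_on f {..<m - 1}" "f ` {..<m - 1} \<subseteq> {..<m} - {j}" "?A = A \<circ> f"
    using \<open>j < m\<close> by (auto simp: f_def inj_on_def fun_eq_iff)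
  have sub: "?A ` {..<m - 1} \<subseteq> A ` {..<m} - {A j}"
  proof -
    have "?A ` {..<m - 1} \<subseteq> A ` ({..<m} - {j})"
      unfolding f(3) image_comp[symmetric] using f(2) by (rule image_mono)
    also have "\<dots> \<subseteq> A ` {..<m} - {A j}"
      using inj_onD[OF A(1)] \<open>j < m\<close> by blast
    finally show ?thesis .
  qed
  have Aj: "A j \<in> {N..<2 * N}" "A j \<in> A ` {..<m}" using A(2) \<open>j < m\<close> by blast+
  have c: "{d. (T(c := A j)) d \<noteq> 0} = insert c {d. T d \<noteq> 0}"
    using Aj(1) \<open>0 < N\<close> by auto
  have "inj_on ?A {..<m - 1}"
    unfolding f(3) using f(1,2) by (intro comp_inj_on inj_on_subset[OF A(1)]) auto
  moreover have "inj_on (T(c := A j)) {d. (T(c := A j)) d \<noteq> 0}"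
    unfolding c using T(1,2) Aj(2) \<open>T c = 0\<close> by (auto simp: inj_on_def)
  moreover have "(T(c := A j)) ` {d. (T(c := A j)) d \<noteq> 0} \<subseteq> {N..<2 * N} - ?A ` {..<m - 1}"
    unfolding c using T(2) sub Aj(1) \<open>T c = 0\<close> by (auto simp del: o_apply)
  moreover have "?A ` {..<m - 1} \<subseteq> {N..<2 * N}" "m - 1 \<le> N"
    using sub A(2) T(3) by (blast, linarith)
  ultimately show ?thesis
    unfolding shuffle_inv_def by blast
qed

text \<open>The hypothesis \<open>step\<close> makes \<open>\<Psi>\<close> a supermartingale of the random assignment.\<close>

lemma exec_assign:
  fixes xs :: "'p colored" and N W w :: nat and F :: "('p, 'o) prims" and \<Psi> :: "(nat \<Rightarrow> nat) \<Rightarrow> ennreal"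
  assumes W: "2 * length xs + 2 < W" "2 * N < W" "3 * W \<le> w" "\<And>x. x \<in> set xs \<Longrightarrow> snd x < W"
    and N: "2 * length xs \<le> N"
    and step: "\<And>m T A e. \<lbrakk>shuffle_inv N m T A; N \<le> 2 * m; 0 < m; T e = 0\<rbrakk>
        \<Longrightarrow> (\<Sum>j<m. \<Psi> (T(e := A j))) / of_nat m \<le> \<Psi> T"
    and fin: "\<And>\<rho> G T k. \<lbrakk>\<And>r. r \<notin> {5, 7, 8, 9, 10, 11} \<Longrightarrow> \<rho> r = \<rho>0 r; \<And>x. x \<noteq> 1 \<Longrightarrow> x \<noteq> 2 \<Longrightarrow> G x = G0 x;
        G 1 = (\<lambda>y. Num (T y)); \<And>y. N \<le> y \<Longrightarrow> G 2 y = G0 2 y; inj_on T (snd ` set xs);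
        T ` snd ` set xs \<subseteq> {N..<2 * N}; {c. T c \<noteq> 0} = snd ` set xs; k \<le> k0\<rbrakk>
        \<Longrightarrow> g (conf W \<rho> G ou (k + 1)) \<le> \<Psi> T"
    and G: "\<And>x. x \<noteq> 1 \<Longrightarrow> x \<noteq> 2 \<Longrightarrow> G x = G0 x" "G 1 = (\<lambda>y. Num (T y))" "\<And>y. N \<le> y \<Longrightarrow> G 2 y = G0 2 y"
      "\<And>y. y < m \<Longrightarrow> G 2 y = Num (A y)" "G0 0 = input_mem xs"
    and \<rho>0: "\<rho>0 2 = Num W" "\<rho>0 4 = Num (length xs)"
    and \<rho>: "\<And>r. r \<notin> {5, 7, 8, 9, 10, 11} \<Longrightarrow> \<rho> r = \<rho>0 r" "\<rho> 5 = Num i" "\<rho> 7 = Num m"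
    and inv: "shuffle_inv N m T A" "N \<le> m + i" "i \<le> length xs" "{c. T c \<noteq> 0} = snd ` set (take i xs)"
    and k: "k + 11 * (length xs - i) \<le> k0"
  shows "dexp (exec F w assign (conf W \<rho> G ou k)) g \<le> \<Psi> T"
  using G(1-4) \<rho> inv k
proof (induction "length xs - i" arbitrary: i m T A \<rho> G k)
  case 0
  then have i: "i = length xs" by simp
  have "exec F w assign (conf W \<rho> G ou k) = return_spmf (conf W \<rho> G ou (k + 1))"
    using \<open>\<rho> 5 = Num i\<close> i \<rho>0(2) "0.prems"(5)[of 4]
    unfolding assign_def by (subst conf_While) simp
  moreover have "g (conf W \<rho> G ou (k + 1)) \<le> \<Psi> T"
  proof (rule fin)
    have T: "{c. T c \<noteq> 0} = snd ` set xs" using "0.prems"(11) i by simp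
    then show "{c. T c \<noteq> 0} = snd ` set xs" .
    have "shuffle_inv N m T A" by fact
    then show "inj_on T (snd ` set xs)" "T ` snd ` set xs \<subseteq> {N..<2 * N}"
      unfolding shuffle_inv_def T by blast+
  qed (use "0.prems"(1-3,5,12) i in \<open>simp_all\<close>)
  ultimately show ?case by simp
next
  case (Suc d)
  then have i: "i < length xs" by simp
  define c where "c = snd (xs ! i)"
  have c: "c < W" using W(4) i by (simp add: c_def)
  have \<rho>2: "\<rho> 2 = Num W" "\<rho> 4 = Num (length xs)" "G 0 = input_mem xs"
    using Suc.prems(1)[of 0] Suc.prems(5)[of 2] Suc.prems(5)[of 4] \<rho>0 G(5) by auto
  have bound: "W \<le> w" "2 * i + 2 < W" "i + 1 < w" using W i by linarith+
  have w0: "0 < W" using W by linarith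
  \<comment> \<open>Each processed point has used at most one leaf, so \<open>m\<close> is at least
    \<open>N - i\<close>, and \<open>i\<close> is below the number of points, which is at most
    \<open>N / 2\<close>: half of the leaves are still free.\<close>
  have m: "0 < m" "m \<le> N" "N \<le> 2 * m" "m < w" "m < W"
  proof -
    show "m \<le> N" using Suc.prems(8) by (simp add: shuffle_inv_def)
    then show "0 < m" "N \<le> 2 * m" "m < w" "m < W"
      using Suc.prems(9) N i W(2,3) by linarith+
  qed
  define \<rho>1 where "\<rho>1 = \<rho>(11 := Num c, 9 := Num (T c))"
  have start: "exec F w assign (conf W \<rho> G ou k)
      = bind_spmf (exec F w (if T c \<noteq> 0 then Skip else Seq (Rand 8 (Reg 7)) take_leaf) (conf W \<rho>1 G ou (k + 4)))
          (\<lambda>s. bind_spmf (exec F w (inc 5) s) (exec F w assign))"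
    unfolding assign_def
    apply (subst conf_While)
    using Suc.prems(2,6) \<rho>2 bound i c W(3) w0
    by (simp add: exec_Seq conf_Load_low conf_Load[where X = 3] conf_Cond input_mem_color \<rho>1_def
        flip: c_def, simp add: eval_nat_numeral)
  have take: "snd ` set (take (i + 1) xs) = insert c (snd ` set (take i xs))"
    using i by (simp add: take_Suc_conv_app_nth c_def)
  show ?case
  proof (cases "T c = 0")
    case False
    have "exec F w assign (conf W \<rho> G ou k) = exec F w assign (conf W (\<rho>1(5 := Num (i + 1))) G ou (k + 6))"
      using False bound Suc.prems(6) unfolding start
      by (simp add: conf_Skip conf_Assign \<rho>1_def, simp add: add.commute)
    also have "dexp \<dots> g \<le> \<Psi> T"
    proof (rule Suc.hyps(1)[where i = "i + 1" and m = m and A = A])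
      show "{c. T c \<noteq> 0} = snd ` set (take (i + 1) xs)"
        unfolding take using False Suc.prems(11) by auto
    qed (use Suc.hyps(2) Suc.prems(1-10,12) i in \<open>simp_all add: \<rho>1_def\<close>)
    finally show ?thesis .
  next
    case True
    define \<rho>2 where "\<rho>2 j = \<rho>1(8 := Num j, 9 := Num (A j), 7 := Num (m - 1), 10 := Num (A (m - 1)),
      5 := Num (i + 1))" for j
    define G2 where "G2 j = G(1 := (G 1)(c := Num (A j)), 2 := (G 2)(j := Num (A (m - 1))))" for j
    have A: "A j < w" if "j < m" for j
    proof -
      have "A j < 2 * N" using that Suc.prems(8) by (auto simp: shuffle_inv_def)
      then show ?thesis using W bound by linarith
    qed
    have run: "bind_spmf (exec F w take_leaf (conf W (\<rho>1(8 := Num j)) G ou (k + 5)))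
        (exec F w (inc 5)) = return_spmf (conf W (\<rho>2 j) (G2 j) ou (k + 11))" if j: "j < m" for j
      using j A[OF j] A[of "m - 1"] m bound \<rho>2 Suc.prems(4)[of j] Suc.prems(4)[of "m - 1"] Suc.prems(6,7) c W(3)
      unfolding take_leaf_def
      by (simp add: exec_Seq conf_Load[where X = 3] conf_Store[where X = 3] conf_Assign \<rho>1_def \<rho>2_def G2_def
           fun_upd_twist[of 7 8] fun_upd_twist[of 7 9])
    have "exec F w assign (conf W \<rho> G ou k)
      = bind_spmf (spmf_of_set {..<m}) (\<lambda>j. exec F w assign (conf W (\<rho>2 j) (G2 j) ou (k + 11)))"
    proof -
      have "exec F w (Seq (Rand 8 (Reg 7)) take_leaf) (conf W \<rho>1 G ou (k + 4))
        = bind_spmf (spmf_of_set {..<m}) (\<lambda>j. exec F w take_leaf (conf W (\<rho>1(8 := Num j)) G ou (k + 5)))"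
        using m(4) Suc.prems(7)
        by (simp add: exec_Seq conf_Rand bind_map_spmf o_def \<rho>1_def add.commute)
      then have "exec F w assign (conf W \<rho> G ou k) = bind_spmf (spmf_of_set {..<m}) (\<lambda>j.
          bind_spmf (bind_spmf (exec F w take_leaf (conf W (\<rho>1(8 := Num j)) G ou (k + 5)))
            (exec F w (inc 5))) (exec F w assign))"
        using True by (simp only: start bind_spmf_assoc simp_thms if_False)
      also have "\<dots> = bind_spmf (spmf_of_set {..<m}) (\<lambda>j. exec F w assign (conf W (\<rho>2 j) (G2 j) ou (k + 11)))"
        using run by (intro bind_spmf_cong refl) simp
      finally show ?thesis .
    qed
    also have "dexp \<dots> g = (\<Sum>j<m. dexp (exec F w assign (conf W (\<rho>2 j) (G2 j) ou (k + 11))) g) / of_nat m"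
      using m by (simp add: dexp_bind dexp_spmf_of_set lessThan_empty_iff)
    also have "\<dots> \<le> (\<Sum>j<m. \<Psi> (T(c := A j))) / of_nat m"
    proof (intro divide_right_mono_ennreal sum_mono)
      fix j assume "j \<in> {..<m}"
      then have j: "j < m" by simp
      show "dexp (exec F w assign (conf W (\<rho>2 j) (G2 j) ou (k + 11))) g \<le> \<Psi> (T(c := A j))"
      proof (rule Suc.hyps(1)[where i = "i + 1" and m = "m - 1" and A = "A(j := A (m - 1))"])
        have "A j \<noteq> 0" using j m Suc.prems(8) by (force simp: shuffle_inv_def)
        then show "{d. (T(c := A j)) d \<noteq> 0} = snd ` set (take (i + 1) xs)"
          unfolding take using Suc.prems(11) by auto
        show "shuffle_inv N (m - 1) (T(c := A j)) (A(j := A (m - 1)))"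
          using m by (intro shuffle_inv_step Suc.prems(8) j True) linarith
        show "G2 j 2 y = Num ((A(j := A (m - 1))) y)" if "y < m - 1" for y
          using that Suc.prems(4) by (auto simp: G2_def)
        show "G2 j 2 y = G0 2 y" if "N \<le> y" for y
          using that Suc.prems(3) j m by (auto simp: G2_def)
        show "G2 j 1 = (\<lambda>y. Num ((T(c := A j)) y))"
          using Suc.prems(2) by (auto simp: G2_def fun_eq_iff)
      qed (use Suc.hyps(2) Suc.prems(1,5,9,10,12) i m in \<open>simp_all add: \<rho>2_def \<rho>1_def G2_def\<close>)
    qed
    also have "\<dots> \<le> \<Psi> T"
      by (rule step[OF Suc.prems(8) m(3,1) True])
    finally show ?thesis .
  qed
qed

section \<open>Distribution of the points over the nodes\<close>

definition append_to :: "nat \<Rightarrow> com" where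
  "append_to d = Seq (Store (Adr (Op Add (Op Mul (Const 2) (Reg 9)) (Const d)) (Const 0)) (Op Add (Reg 12) (Const 1)))
    (Seq (Store (Adr (Op Add (Op Mul (Const 2) (Reg 9)) (Const d)) (Op Add (Op Mul (Const 2) (Reg 12)) (Const 1))) (Reg 10))
    (Store (Adr (Op Add (Op Mul (Const 2) (Reg 9)) (Const d)) (Op Add (Op Mul (Const 2) (Reg 12)) (Const 2))) (Reg 11)))"

definition climb :: com where
  "climb = While (Reg 9)
    (Seq (Load 12 (Adr (Const 3) (Reg 9)))
    (Seq (append_to 2) (Seq (append_to 3)
    (Seq (Store (Adr (Const 3) (Reg 9)) (Op Add (Reg 12) (Const 1)))
    (Assign 9 (Op Div (Reg 9) (Const 2)))))))"

definition distribute :: com where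
  "distribute = While (Op Less (Reg 5) (Reg 4))
    (Seq (Load 10 (Op Add (Op Mul (Const 2) (Reg 5)) (Const 1)))
    (Seq (Load 11 (Op Add (Op Mul (Const 2) (Reg 5)) (Const 2)))
    (Seq (Load 9 (Adr (Const 1) (Reg 11)))
    (Seq climb (inc 5)))))"

text \<open>The lists have the format of an input array, so the given build program can run on the
  blocks as they stand.\<close>

definition stores :: "(nat \<Rightarrow> nat \<Rightarrow> ('p, 'o) val) \<Rightarrow> (nat \<Rightarrow> 'p colored) \<Rightarrow> bool" where
  "stores G ls \<longleftrightarrow> (\<forall>u>0. G 3 u = Num (length (ls u)) \<and> G (2 * u + 2) = input_mem (ls u) \<and>
     G (2 * u + 3) = input_mem (ls u))"

lemma input_mem_snoc:
  "input_mem (l @ [(p, c)]) = (input_mem l)(0 := Num (length l + 1),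
     2 * length l + 1 := Point p, 2 * length l + 2 := Num c)"
proof
  fix a
  show "input_mem (l @ [(p, c)]) a = ((input_mem l)(0 := Num (length l + 1),
     2 * length l + 1 := Point p, 2 * length l + 2 := Num c)) a"
  proof (cases "a = 0")
    case False
    define i where "i = (a - 1) div 2"
    have a: "a = (if odd a then 2 * i + 1 else 2 * i + 2)"
      using False unfolding i_def by (auto elim!: oddE evenE)
    show ?thesis
    proof (cases "i = length l")
      case True
      then show ?thesis using False a i_def[symmetric]
        by (cases "odd a") (auto simp: input_mem_def Let_def)
    next
      case ne: False
      then have "a \<noteq> 2 * length l + 1" "a \<noteq> 2 * length l + 2" using a by (auto split: if_splits)
      then show ?thesis using False ne i_def[symmetric]
        by (auto simp: input_mem_def Let_def nth_append)
    qed
  qed (simp add: input_mem_def)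
qed

lemma exec_append_to:
  fixes l :: "'p colored"
  assumes "\<rho> 2 = Num W" "\<rho> 9 = Num v" "\<rho> 10 = Point p" "\<rho> 11 = Num c" "\<rho> 12 = Num (length l)"
    and "G (2 * v + d) = input_mem l"
    and "2 * v + d < X" "X * W \<le> w" "2 * length l + 2 < W" "c < W"
  shows "exec F w (append_to d) (conf W \<rho> G ou k)
    = return_spmf (conf W \<rho> (G(2 * v + d := input_mem (l @ [(p, c)]))) ou (k + 3))"
proof -
  have "0 < W" "0 < X" using assms by auto
  then have w: "c < w" "length l + 1 < w" "0 < w"
    using less_addr_bound[of c W X w] less_addr_bound[of "length l + 1" W X w] assms by auto
  have "exec F w (append_to d) (conf W \<rho> G ou k)
    = return_spmf (conf W \<rho> (G(2 * v + d := (G (2 * v + d))(0 := Num (length l + 1),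
     2 * length l + 1 := Point p, 2 * length l + 2 := Num c))) ou (k + 3))"
    unfolding append_to_def using assms w \<open>0 < W\<close>
    by (simp add: exec_Seq conf_Store[where X = X] numeral_3_eq_3)
  then show ?thesis using assms(6) by (simp add: input_mem_snoc)
qed

text \<open>Halving \<open>v < 2 ^ d\<close> gives 0 after at most \<open>d\<close> rounds, and the
  nodes passed are exactly the positive numbers that \<open>v\<close> reaches. A round takes 10
  units: guard, load, two appends of three stores, counter and halving.\<close>

lemma exec_climb:
  fixes ls :: "nat \<Rightarrow> 'p colored" and p :: 'p and G :: "nat \<Rightarrow> nat \<Rightarrow> ('p, 'o) val"
  assumes "\<rho> 2 = Num W" "\<rho> 9 = Num v" "\<rho> 10 = Point p" "\<rho> 11 = Num c"
    and "stores G ls" "v < 2 * N" "v < 2 ^ d" "(4 * N + 4) * W \<le> w" "2 * N < W" "c < W"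
    and "\<And>u. 0 < u \<Longrightarrow> reaches v u \<Longrightarrow> 2 * length (ls u) + 2 < W"
  shows "\<exists>\<rho>' G' k'. exec F w climb (conf W \<rho> G ou k) = return_spmf (conf W \<rho>' G' ou k')
    \<and> (\<forall>r. r \<notin> {9, 12} \<longrightarrow> \<rho>' r = \<rho> r) \<and> G' 0 = G 0 \<and> G' 1 = G 1 \<and> G' 2 = G 2 \<and> G' 3 0 = G 3 0
    \<and> stores G' (\<lambda>u. if 0 < u \<and> reaches v u then ls u @ [(p, c)] else ls u) \<and> k' \<le> k + 10 * d + 1"
  using assms
proof (induction d arbitrary: v ls \<rho> G k)
  case 0
  then have "(\<lambda>u. if 0 < u \<and> reaches v u then ls u @ [(p, c)] else ls u) = ls"
    using reaches_le[of 0] by (auto simp: fun_eq_iff)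
  with 0 show ?case
    by (intro exI[of _ \<rho>] exI[of _ G] exI[of _ "k + 1"]) (simp add: climb_def conf_While)
next
  case (Suc d)
  show ?case
  proof (cases "v = 0")
    case True
    then have "(\<lambda>u. if 0 < u \<and> reaches v u then ls u @ [(p, c)] else ls u) = ls"
      using reaches_le[of 0] by (auto simp: fun_eq_iff)
    with Suc.prems True show ?thesis
      by (intro exI[of _ \<rho>] exI[of _ G] exI[of _ "k + 1"]) (simp add: climb_def conf_While)
  next
    case False
    define l where "l = length (ls v)"
    define \<rho>1 where "\<rho>1 = \<rho>(12 := Num l, 9 := Num (v div 2))"
    define G1 where "G1 = G(2 * v + 2 := input_mem (ls v @ [(p, c)]),
      2 * v + 3 := input_mem (ls v @ [(p, c)]), 3 := (G 3)(v := Num (l + 1)))"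
    define ls1 where "ls1 = ls(v := ls v @ [(p, c)])"
    have G: "G 3 v = Num l" "G (2 * v + 2) = input_mem (ls v)" "G (2 * v + 3) = input_mem (ls v)"
      using Suc.prems(5) False by (auto simp: stores_def l_def)
    have l: "2 * l + 2 < W" using Suc.prems(11)[of v] False by (simp add: l_def)
    have X: "3 < 4 * N + 4" "2 * v + 2 < 4 * N + 4" "2 * v + 3 < 4 * N + 4" using Suc.prems(6) by auto
    have w: "v < W" "l + 1 < w" "v div 2 < w"
      using Suc.prems(6,8,9) l less_addr_bound[of "l + 1" W "4 * N + 4" w]
        less_addr_bound[of "v div 2" W "4 * N + 4" w] by auto
    have step: "exec F w climb (conf W \<rho> G ou k) = exec F w climb (conf W \<rho>1 G1 ou (k + 10))"
      unfolding climb_def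
      apply (subst conf_While)
      using Suc.prems(1-4,8,10) False G X w l
      apply (simp add: exec_Seq conf_Load[where X = "4 * N + 4"] conf_Store[where X = "4 * N + 4"]
          conf_Assign)
      apply (subst exec_append_to[where X = "4 * N + 4" and v = v and p = p and c = c and l = "ls v"])
      apply (auto simp: l_def)[10]
      apply (simp add: exec_Seq conf_Load[where X = "4 * N + 4"] conf_Store[where X = "4 * N + 4"]
          conf_Assign)
      apply (subst exec_append_to[where X = "4 * N + 4" and v = v and p = p and c = c and l = "ls v"])
      apply (auto simp: l_def)[10]
      apply (simp add: exec_Seq conf_Load[where X = "4 * N + 4"] conf_Store[where X = "4 * N + 4"]
          conf_Assign \<rho>1_def G1_def)
      by (simp add: fun_upd_twist add.commute)
    have IH: "\<exists>\<rho>' G' k'. exec F w climb (conf W \<rho>1 G1 ou (k + 10)) = return_spmf (conf W \<rho>' G' ou k')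
    \<and> (\<forall>r. r \<notin> {9, 12} \<longrightarrow> \<rho>' r = \<rho>1 r) \<and> G' 0 = G1 0 \<and> G' 1 = G1 1 \<and> G' 2 = G1 2 \<and> G' 3 0 = G1 3 0
    \<and> stores G' (\<lambda>u. if 0 < u \<and> reaches (v div 2) u then ls1 u @ [(p, c)] else ls1 u) \<and> k' \<le> k + 10 + 10 * d + 1"
    proof (rule Suc.IH)
      show "stores G1 ls1"
        using Suc.prems(5) False by (auto simp: stores_def G1_def ls1_def l_def)
      \<comment> \<open>The ancestors still to come are smaller than \<open>v\<close>, so their
        lists have not grown.\<close>
      show "2 * length (ls1 u) + 2 < W" if "0 < u" "reaches (v div 2) u" for u
        using that reaches_le[OF that(2)] reaches_half_iff[of v u] Suc.prems(11)[of u] False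
        by (auto simp: ls1_def)
    qed (use Suc.prems in \<open>simp_all add: \<rho>1_def\<close>)
    have ls1: "(\<lambda>u. if 0 < u \<and> reaches (v div 2) u then ls1 u @ [(p, c)] else ls1 u)
        = (\<lambda>u. if 0 < u \<and> reaches v u then ls u @ [(p, c)] else ls u)"
      using False reaches_half_iff[of v] reaches_le[of "v div 2" v] by (auto simp: ls1_def fun_eq_iff)
    have clk: "k + 10 + 10 * d + 1 = k + 10 * Suc d + 1" by simp
    have G1: "G1 0 = G 0" "G1 1 = G 1" "G1 2 = G 2" "G1 3 0 = G 3 0"
      using False by (auto simp: G1_def)
    have "\<rho>1 r = \<rho> r" if "r \<notin> {9, 12}" for r using that by (simp add: \<rho>1_def)
    then show ?thesis using step IH unfolding ls1 clk G1 by simp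
  qed
qed

text \<open>Per point, the climb takes at most \<open>10 * d + 1\<close> units; the guard, three
  loads and the increment add 5.\<close>

lemma exec_distribute:
  fixes xs :: "'p colored" and G :: "nat \<Rightarrow> nat \<Rightarrow> ('p, 'o) val"
  assumes "\<rho> 2 = Num W" "\<rho> 4 = Num (length xs)" "\<rho> 5 = Num i"
    and "G 0 = input_mem xs" "G 1 = (\<lambda>y. Num (T y))"
    and "stores G (\<lambda>u. filter (\<lambda>x. reaches (T (snd x)) u) (take i xs))"
    and "2 * N \<le> 2 ^ d" "(4 * N + 4) * W \<le> w" "2 * N < W" "2 * length xs + 2 < W"
    and "\<And>x. x \<in> set xs \<Longrightarrow> snd x < W \<and> T (snd x) < 2 * N" "i \<le> length xs"
  shows "\<exists>\<rho>' G' k'. exec F w distribute (conf W \<rho> G ou k) = return_spmf (conf W \<rho>' G' ou k')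
    \<and> (\<forall>r. r \<notin> {5, 9, 10, 11, 12} \<longrightarrow> \<rho>' r = \<rho> r) \<and> G' 0 = G 0 \<and> G' 1 = G 1 \<and> G' 2 = G 2 \<and> G' 3 0 = G 3 0
    \<and> stores G' (\<lambda>u. filter (\<lambda>x. reaches (T (snd x)) u) xs) \<and> k' \<le> k + (10 * d + 6) * (length xs - i) + 1"
  using assms
proof (induction "length xs - i" arbitrary: i \<rho> G k)
  case 0
  then show ?case
    by (intro exI[of _ \<rho>] exI[of _ G] exI[of _ "k + 1"]) (simp add: distribute_def conf_While)
next
  case (Suc m)
  then have i: "i < length xs" by simp
  define c where "c = snd (xs ! i)"
  define p where "p = fst (xs ! i)"
  have x: "xs ! i = (p, c)" by (simp add: c_def p_def)
  have c: "c < W" "T c < 2 * N" using Suc.prems(11)[OF nth_mem[OF i]] by (auto simp: c_def)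
  define \<rho>1 where "\<rho>1 = \<rho>(10 := Point p, 11 := Num c, 9 := Num (T c))"
  have "W \<le> (4 * N + 4) * W" by simp
  then have X: "1 < 4 * N + 4" "W \<le> w" using Suc.prems(8) by linarith+
  have start: "exec F w distribute (conf W \<rho> G ou k)
      = bind_spmf (exec F w climb (conf W \<rho>1 G ou (k + 4))) (\<lambda>s. bind_spmf (exec F w (inc 5) s) (exec F w distribute))"
    unfolding distribute_def
    apply (subst conf_While)
    using Suc.prems(1-5,8,10) i c X
    by (simp add: exec_Seq conf_Load_low conf_Load[where X = "4 * N + 4"] input_mem_point input_mem_color \<rho>1_def
        flip: c_def p_def, simp add: eval_nat_numeral)
  define ls where "ls u = filter (\<lambda>x. reaches (T (snd x)) u) (take i xs)" for u
  have ls1: "stores G' (\<lambda>u. if 0 < u \<and> reaches (T c) u then ls u @ [(p, c)] else ls u)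
      \<longleftrightarrow> stores G' (\<lambda>u. filter (\<lambda>x. reaches (T (snd x)) u) (take (i + 1) xs))" for G' :: "nat \<Rightarrow> nat \<Rightarrow> ('p, 'o) val"
    using i unfolding stores_def
    by (intro all_cong) (simp add: ls_def take_Suc_conv_app_nth x)
  have "\<exists>\<rho>' G' k'. exec F w climb (conf W \<rho>1 G ou (k + 4)) = return_spmf (conf W \<rho>' G' ou k')
    \<and> (\<forall>r. r \<notin> {9, 12} \<longrightarrow> \<rho>' r = \<rho>1 r) \<and> G' 0 = G 0 \<and> G' 1 = G 1 \<and> G' 2 = G 2 \<and> G' 3 0 = G 3 0
    \<and> stores G' (\<lambda>u. if 0 < u \<and> reaches (T c) u then ls u @ [(p, c)] else ls u) \<and> k' \<le> k + 4 + 10 * d + 1"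
  proof (rule exec_climb)
    show "2 * length (ls u) + 2 < W" for u
    proof -
      have "length (ls u) \<le> length (take i xs)" unfolding ls_def by (rule length_filter_le)
      then show ?thesis using Suc.prems(10) by simp
    qed
  qed (use Suc.prems c in \<open>simp_all add: \<rho>1_def ls_def\<close>)
  then obtain \<rho>2 G2 k2 where climb: "exec F w climb (conf W \<rho>1 G ou (k + 4)) = return_spmf (conf W \<rho>2 G2 ou k2)"
    and r2: "\<And>r. r \<notin> {9, 12} \<Longrightarrow> \<rho>2 r = \<rho>1 r" and G2: "G2 0 = G 0" "G2 1 = G 1" "G2 2 = G 2" "G2 3 0 = G 3 0"
    and s2: "stores G2 (\<lambda>u. filter (\<lambda>x. reaches (T (snd x)) u) (take (i + 1) xs))"
    and k2: "k2 \<le> k + 10 * d + 5"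
    unfolding ls1 by (auto simp: add.assoc)
  have "exec F w distribute (conf W \<rho> G ou k) = exec F w distribute (conf W (\<rho>2(5 := Num (i + 1))) G2 ou (k2 + 1))"
    unfolding start climb using r2[of 5] Suc.prems(3,10) i X by (simp add: conf_Assign \<rho>1_def)
  moreover have "\<exists>\<rho>' G' k'. exec F w distribute (conf W (\<rho>2(5 := Num (i + 1))) G2 ou (k2 + 1))
        = return_spmf (conf W \<rho>' G' ou k')
    \<and> (\<forall>r. r \<notin> {5, 9, 10, 11, 12} \<longrightarrow> \<rho>' r = (\<rho>2(5 := Num (i + 1))) r)
    \<and> G' 0 = G2 0 \<and> G' 1 = G2 1 \<and> G' 2 = G2 2 \<and> G' 3 0 = G2 3 0
    \<and> stores G' (\<lambda>u. filter (\<lambda>x. reaches (T (snd x)) u) xs)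
    \<and> k' \<le> k2 + 1 + (10 * d + 6) * (length xs - (i + 1)) + 1"
    using Suc.hyps(2) i r2[of 2] r2[of 4] Suc.prems s2 G2 by (intro Suc.hyps(1)) (simp_all add: \<rho>1_def)
  then obtain \<rho>' G' k' where *: "exec F w distribute (conf W (\<rho>2(5 := Num (i + 1))) G2 ou (k2 + 1))
        = return_spmf (conf W \<rho>' G' ou k')"
    "\<forall>r. r \<notin> {5, 9, 10, 11, 12} \<longrightarrow> \<rho>' r = (\<rho>2(5 := Num (i + 1))) r"
    "G' 0 = G2 0" "G' 1 = G2 1" "G' 2 = G2 2" "G' 3 0 = G2 3 0"
    "stores G' (\<lambda>u. filter (\<lambda>x. reaches (T (snd x)) u) xs)"
    "k' \<le> k2 + 1 + (10 * d + 6) * (length xs - (i + 1)) + 1"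
    by blast
  moreover have "k2 + 1 + (10 * d + 6) * (length xs - (i + 1)) + 1 \<le> k + (10 * d + 6) * (length xs - i) + 1"
  proof -
    have "length xs - i = Suc (length xs - (i + 1))" using i by simp
    then show ?thesis using k2 by simp
  qed
  moreover have "(\<rho>2(5 := Num (i + 1))) r = \<rho> r" if "r \<notin> {5, 9, 10, 11, 12}" for r
    using that r2[of r] by (simp add: \<rho>1_def)
  ultimately show ?case
    unfolding G2 using * by (intro exI[of _ \<rho>'] exI[of _ G'] exI[of _ k']) (simp del: fun_upd_apply)
qed

section \<open>Building the node structures\<close>

text \<open>
  A query may destroy the structure that it uses, so each node gets one independent copy for the
  emptiness test and one for the one-color test.
\<close>

definition build_copy :: "nat \<Rightarrow> nat \<Rightarrow> com \<Rightarrow> com" where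
  "build_copy M d build = Seq (Assign 1 (Adr (Op Add (Op Mul (Const 2) (Reg 9)) (Const d)) (Const 0)))
    (Seq (reset 16 M) (reloc 16 1 build))"

text \<open>Nodes without points are skipped, because nothing is assumed about the given program on
  an empty input.\<close>

definition builds :: "nat \<Rightarrow> com \<Rightarrow> com" where
  "builds M build = While (Op Less (Reg 9) (Op Mul (Const 2) (Reg 3)))
    (Seq (Load 12 (Adr (Const 3) (Reg 9)))
    (Seq (Cond (Reg 12) (Seq (build_copy M 2 build) (build_copy M 3 build)) Skip) (inc 9)))"

lemma addr_block:
  assumes "x < X" "w' \<le> W" "X * W \<le> w"
  shows "addr W x 0 + w' \<le> w"
proof -
  have "addr W x 0 + w' \<le> Suc x * W" using assms(2) by (simp add: addr_def)
  also have "\<dots> \<le> X * W" using assms(1) by (intro mult_le_mono1) simp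
  finally show ?thesis using assms(3) by simp
qed

lemma exec_build_copy:
  fixes G :: "nat \<Rightarrow> nat \<Rightarrow> ('p, 'o) val"
  assumes "\<rho> 2 = Num W" "\<rho> 9 = Num v" "G (2 * v + d) = input_mem l"
    and "2 * v + d < X" "X * W \<le> w" "0 < W" "word_bound c l \<le> W" "com_regs build \<subseteq> {..<M}"
    and "lossless_spmf (preprocess F c build l)"
  shows "exec F w (build_copy M d build) (conf W \<rho> G ou k)
    = map_spmf (\<lambda>t. conf W (\<lambda>r. if 16 \<le> r \<and> r < 16 + M then regs t (r - 16)
          else (\<rho>(1 := Num (addr W (2 * v + d) 0))) r) (G(2 * v + d := mem t)) ou (k + M + 2 + clock t))
        (preprocess F c build l)"
proof -
  define \<rho>1 where "\<rho>1 = \<rho>(1 := Num (addr W (2 * v + d) 0))"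
  define \<rho>2 where "\<rho>2 = (\<lambda>r. if 16 \<le> r \<and> r < 16 + M then Num 0 else \<rho>1 r)"
  have a: "addr W (2 * v + d) 0 < w" using assms(4-6) by (intro addr_less)
  have eq: "(\<lambda>r. if 16 \<le> r \<and> r < 16 + M then regs t (r - 16) else \<rho>2 r)
      = (\<lambda>r. if 16 \<le> r \<and> r < 16 + M then regs t (r - 16) else \<rho>1 r)" for t :: "('p, 'o) state"
    by (auto simp: \<rho>2_def fun_eq_iff)
  have "exec F w (build_copy M d build) (conf W \<rho> G ou k)
      = exec F w (reloc 16 1 build) (conf W \<rho>2 G ou (k + M + 2))"
    unfolding build_copy_def using assms(1,2) a
    by (simp add: exec_Seq conf_Assign eval_Adr conf_reset \<rho>2_def \<rho>1_def cong: if_cong)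
  also have "\<dots> = map_spmf (\<lambda>t. conf W (\<lambda>r. if 16 \<le> r \<and> r < 16 + M then regs t (r - 16) else \<rho>2 r)
      (G(2 * v + d := mem t)) ou (k + M + 2 + clock t))
      (exec F (word_bound c l) build \<lparr>regs = \<lambda>_. Num 0, mem = G (2 * v + d), out = [], clock = 0\<rparr>)"
    using assms addr_block[OF assms(4,7,5)]
    by (intro exec_sub) (simp_all add: \<rho>2_def \<rho>1_def preprocess_def)
  finally show ?thesis using assms(3) by (simp only: eq) (simp only: \<rho>1_def preprocess_def)
qed

text \<open>The loop invariant when \<open>v\<close> is the next node. It records only that each
  finished block is a possible outcome of its build; probabilities are left to the potential of the
  loop rule.\<close>

definition built :: "('p, 'o) prims \<Rightarrow> nat \<Rightarrow> com \<Rightarrow> (nat \<Rightarrow> 'p colored) \<Rightarrow>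
    (nat \<Rightarrow> nat \<Rightarrow> ('p, 'o) val) \<Rightarrow> nat \<Rightarrow> (nat \<Rightarrow> nat \<Rightarrow> ('p, 'o) val) \<Rightarrow> bool" where
  "built F c build ls G0 v G \<longleftrightarrow> (\<forall>x. x < 4 \<or> 2 * v + 2 \<le> x \<longrightarrow> G x = G0 x) \<and>
    (\<forall>u. 0 < u \<longrightarrow> u < v \<longrightarrow>
      (if ls u = [] then G (2 * u + 2) = G0 (2 * u + 2) \<and> G (2 * u + 3) = G0 (2 * u + 3)
       else G (2 * u + 2) \<in> mem ` set_spmf (preprocess F c build (ls u)) \<and>
            G (2 * u + 3) \<in> mem ` set_spmf (preprocess F c build (ls u))))"

lemma built_skip: "\<lbrakk>built F c build ls G0 v G; ls v = []\<rbrakk> \<Longrightarrow> built F c build ls G0 (v + 1) G"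
  unfolding built_def by (auto simp: less_Suc_eq simp del: add_2_eq_Suc add_2_eq_Suc')

lemma built_step:
  assumes "built F c build ls G0 v G" "ls v \<noteq> []" "0 < v"
    and "a \<in> set_spmf (preprocess F c build (ls v))" "b \<in> set_spmf (preprocess F c build (ls v))"
  shows "built F c build ls G0 (v + 1) (G(2 * v + 2 := mem a, 2 * v + 3 := mem b))"
  unfolding built_def
proof (intro conjI allI impI, goal_cases)
  case (1 x)
  then show ?case using assms(1,3) by (auto simp: built_def)
next
  case (2 u)
  show ?case
  proof (cases "u = v")
    case False
    then have "2 * u + 2 \<noteq> 2 * v + 2" "2 * u + 2 \<noteq> 2 * v + 3" "2 * u + 3 \<noteq> 2 * v + 2" "2 * u + 3 \<noteq> 2 * v + 3"
      by presburger+
    moreover have "u < v" using 2 False by simp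
    ultimately show ?thesis
      using assms(1) 2 by (simp add: built_def del: add_2_eq_Suc add_2_eq_Suc')
  qed (use assms in auto)
qed

text \<open>A loop rule with a free potential of the next node, the memory and the clock. It is
  enough that two fresh independent runs at one node do not raise the potential on average. A
  skipped node takes 5 units; a built one takes \<open>2 * M + 8\<close> besides its two
  runs.\<close>

lemma exec_builds:
  fixes ls :: "nat \<Rightarrow> 'p colored" and F :: "('p, 'o) prims"
    and \<Phi> :: "nat \<Rightarrow> (nat \<Rightarrow> nat \<Rightarrow> ('p, 'o) val) \<Rightarrow> nat \<Rightarrow> ennreal"
  assumes W: "(4 * N + 4) * W \<le> w" "2 * N < W"
    and G0: "stores G0 ls"
    and ls: "\<And>v. ls v \<noteq> [] \<Longrightarrow> word_bound c (ls v) \<le> W \<and> lossless_spmf (preprocess F c build (ls v))"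
    and M: "com_regs build \<subseteq> {..<M}"
    and step: "\<And>v G k. \<lbrakk>0 < v; v < 2 * N; ls v \<noteq> []\<rbrakk> \<Longrightarrow>
        dexp (preprocess F c build (ls v)) (\<lambda>a. dexp (preprocess F c build (ls v)) (\<lambda>b.
          \<Phi> (v + 1) (G(2 * v + 2 := mem a, 2 * v + 3 := mem b)) (k + 2 * M + 8 + clock a + clock b)))
        \<le> \<Phi> v G k"
    and skip: "\<And>v G k. \<lbrakk>0 < v; v < 2 * N; ls v = []\<rbrakk> \<Longrightarrow> \<Phi> (v + 1) G (k + 5) \<le> \<Phi> v G k"
    and fin: "\<And>\<rho> G k. \<lbrakk>built F c build ls G0 (2 * N) G; \<rho> 2 = Num W; \<rho> 3 = Num N\<rbrakk>
        \<Longrightarrow> g (conf W \<rho> G ou (k + 1)) \<le> \<Phi> (2 * N) G k"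
    and start: "built F c build ls G0 v G" "\<rho> 2 = Num W" "\<rho> 3 = Num N" "\<rho> 9 = Num v" "0 < v" "v \<le> 2 * N"
  shows "dexp (exec F w (builds M build) (conf W \<rho> G ou k)) g \<le> \<Phi> v G k"
  using start
proof (induction "2 * N - v" arbitrary: v G \<rho> k)
  case 0
  then have v: "v = 2 * N" by simp
  have "exec F w (builds M build) (conf W \<rho> G ou k) = return_spmf (conf W \<rho> G ou (k + 1))"
    using 0 v unfolding builds_def by (subst conf_While) simp
  then show ?case using fin[of G \<rho> k] 0 v by simp
next
  case (Suc m)
  then have v: "v < 2 * N" by simp
  have X: "3 < 4 * N + 4" "2 * v + 2 < 4 * N + 4" "2 * v + 3 < 4 * N + 4" using v by auto
  have "W \<le> (4 * N + 4) * W" by simp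
  then have Ww: "W \<le> w" using W by linarith
  have w: "v < W" "v + 1 < w" "0 < W" using v W(2) Ww by linarith+
  have G: "G 3 v = Num (length (ls v))" "G (2 * v + 2) = input_mem (ls v)" "G (2 * v + 3) = input_mem (ls v)"
    using Suc.prems(1,5) G0 by (auto simp: built_def stores_def)
  define \<rho>1 where "\<rho>1 = \<rho>(12 := Num (length (ls v)))"
  have first: "exec F w (builds M build) (conf W \<rho> G ou k)
    = bind_spmf (bind_spmf (exec F w (if ls v \<noteq> [] then Seq (build_copy M 2 build) (build_copy M 3 build) else Skip)
        (conf W \<rho>1 G ou (k + 3))) (exec F w (inc 9))) (exec F w (builds M build))"
    unfolding builds_def
    apply (subst conf_While)
    using Suc.prems(2-4) v X W(1) w G(1)
    by (simp add: exec_Seq conf_Load[where X = "4 * N + 4"] conf_Cond \<rho>1_def, simp add: eval_nat_numeral)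
  show ?case
  proof (cases "ls v = []")
    case True
    have "exec F w (builds M build) (conf W \<rho> G ou k) = exec F w (builds M build) (conf W (\<rho>1(9 := Num (v + 1))) G ou (k + 5))"
      unfolding first using True Suc.prems(4) w by (simp add: conf_Skip conf_Assign \<rho>1_def, simp add: add.commute)
    also have "dexp \<dots> g \<le> \<Phi> (v + 1) G (k + 5)"
      using built_skip[OF Suc.prems(1) True] Suc.hyps(2) Suc.prems v
      by (intro Suc.hyps(1)) (simp_all add: \<rho>1_def)
    also have "\<dots> \<le> \<Phi> v G k" using Suc.prems(5) v True by (rule skip)
    finally show ?thesis .
  next
    case False
    let ?p = "preprocess F c build (ls v)"
    define \<rho>2 :: "('p, 'o) state \<Rightarrow> nat \<Rightarrow> ('p, 'o) val"
      where "\<rho>2 a = (\<lambda>r. if 16 \<le> r \<and> r < 16 + M then regs a (r - 16)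
          else (\<rho>1(1 := Num (addr W (2 * v + 2) 0))) r)" for a
    define \<rho>3 :: "('p, 'o) state \<Rightarrow> ('p, 'o) state \<Rightarrow> nat \<Rightarrow> ('p, 'o) val"
      where "\<rho>3 a b = (\<lambda>r. if 16 \<le> r \<and> r < 16 + M then regs b (r - 16)
          else ((\<rho>2 a)(1 := Num (addr W (2 * v + 3) 0))) r)" for a b
    define G2 where "G2 a b = G(2 * v + 2 := mem a, 2 * v + 3 := mem b)" for a b :: "('p, 'o) state"
    have c1: "exec F w (build_copy M 2 build) (conf W \<rho>1 G ou (k + 3))
      = map_spmf (\<lambda>a. conf W (\<rho>2 a) (G(2 * v + 2 := mem a)) ou (k + 3 + M + 2 + clock a)) ?p"
      unfolding \<rho>2_def using Suc.prems ls[OF False] G X W w M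
      by (intro exec_build_copy) (simp_all add: \<rho>1_def)
    have c2: "exec F w (build_copy M 3 build) (conf W (\<rho>2 a) (G(2 * v + 2 := mem a)) ou j)
      = map_spmf (\<lambda>b. conf W (\<rho>3 a b) (G2 a b) ou (j + M + 2 + clock b)) ?p" for a j
      unfolding \<rho>3_def G2_def using Suc.prems ls[OF False] G X W w M
      by (intro exec_build_copy) (simp_all add: \<rho>1_def \<rho>2_def)
    have inc: "exec F w (inc 9) (conf W (\<rho>3 a b) (G2 a b) ou j)
      = return_spmf (conf W ((\<rho>3 a b)(9 := Num (v + 1))) (G2 a b) ou (j + 1))" for a b j
      using Suc.prems(4) w by (subst conf_Assign) (simp_all add: \<rho>1_def \<rho>2_def \<rho>3_def)
    have "dexp (exec F w (builds M build) (conf W \<rho> G ou k)) g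
      = dexp ?p (\<lambda>a. dexp ?p (\<lambda>b. dexp (exec F w (builds M build)
          (conf W ((\<rho>3 a b)(9 := Num (v + 1))) (G2 a b) ou (k + 3 + M + 2 + clock a + M + 2 + clock b + 1))) g))"
      unfolding first using False by (simp only: simp_thms if_True exec_Seq c1 c2 inc dexp_bind dexp_map dexp_return)
    also have "\<dots> \<le> dexp ?p (\<lambda>a. dexp ?p (\<lambda>b. \<Phi> (v + 1) (G2 a b) (k + 2 * M + 8 + clock a + clock b)))"
    proof (intro dexp_mono)
      fix a b assume ab: "a \<in> set_spmf ?p" "b \<in> set_spmf ?p"
      have clk: "k + 3 + M + 2 + clock a + M + 2 + clock b + 1 = k + 2 * M + 8 + clock a + clock b" by simp
      show "dexp (exec F w (builds M build) (conf W ((\<rho>3 a b)(9 := Num (v + 1))) (G2 a b) ou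
            (k + 3 + M + 2 + clock a + M + 2 + clock b + 1))) g
          \<le> \<Phi> (v + 1) (G2 a b) (k + 2 * M + 8 + clock a + clock b)"
        unfolding clk
      proof (rule Suc.hyps(1))
        show "built F c build ls G0 (v + 1) (G2 a b)"
          unfolding G2_def using Suc.prems(1,5) False ab by (intro built_step)
      qed (use Suc.hyps(2) Suc.prems v in \<open>simp_all add: \<rho>1_def \<rho>2_def \<rho>3_def\<close>)
    qed
    also have "\<dots> \<le> \<Phi> v G k" unfolding G2_def using Suc.prems(5) v False by (rule step)
    finally show ?thesis .
  qed
qed

section \<open>The whole preprocessing\<close>

definition depth :: "nat \<Rightarrow> nat" where
  "depth n = (LEAST L. 2 * n \<le> 2 ^ L)"

lemma depth_ge: "2 * n \<le> 2 ^ depth n"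
  unfolding depth_def by (rule LeastI[of _ "2 * n"]) (simp add: less_imp_le)

lemma depth_less:
  assumes "0 < n"
  shows "2 ^ depth n < 4 * n"
proof (cases "depth n")
  case (Suc L)
  then have "\<not> 2 * n \<le> 2 ^ L" unfolding depth_def using not_less_Least[of L] by (metis lessI)
  then show ?thesis using Suc by simp
qed (use assms in simp)

text \<open>The program finds a suitable exponent by doubling; uniqueness identifies it with
  \<open>depth n\<close>.\<close>

lemma depth_unique:
  assumes "2 * n \<le> 2 ^ L" "2 ^ L < 4 * n"
  shows "L = depth n"
proof (rule antisym)
  have "(2::nat) ^ L < 2 ^ Suc (depth n)" using assms(2) depth_ge[of n] by simp
  then show "L \<le> depth n" using power_strict_increasing_iff[of "2::nat" L "Suc (depth n)"] by simp
  show "depth n \<le> L" unfolding depth_def using assms(1) by (rule Least_le)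
qed

text \<open>Registers do not survive preprocessing, so the two numbers that a query needs are left
  in the first cells of the input array.\<close>

definition store_header :: com where
  "store_header = Seq (Store (Adr (Const 0) (Const 0)) (Reg 2)) (Store (Adr (Const 0) (Const 1)) (Reg 3))"

definition build_all :: "nat \<Rightarrow> nat \<Rightarrow> com \<Rightarrow> com" where
  "build_all c M build =
    Seq (Load 4 (Const 0))
    (Seq scan
    (Seq (Assign 2 (pow_exp (Op Add (Op Add (Reg 4) (Reg 6)) (Const 2)) (c + 3)))
    (Seq (Assign 3 (Const 1))
    (Seq double
    (Seq fill
    (Seq (Assign 5 (Const 0))
    (Seq assign
    (Seq (Assign 5 (Const 0))
    (Seq distribute
    (Seq (Assign 9 (Const 1))
    (Seq (builds M build) store_header)))))))))))"

locale tree_ds =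
  fixes F :: "('p, 'o) prims" and c M :: nat and build :: com and xs :: "'p colored"
  assumes xs: "valid_input xs"
    and M: "com_regs build \<subseteq> {..<M}"
    and lossless: "\<And>l. valid_input l \<Longrightarrow> lossless_spmf (preprocess F c build l)"
begin

definition "n = length xs"
definition "H = n + Max (snd ` set xs) + 2"
text \<open>The word bound of a structure for part of the points is at most \<open>H ^ c\<close>, so
  a block of \<open>W\<close> cells holds it. The factor \<open>H ^ 3\<close> in \<open>W\<close>
  leaves room for the host's own arrays, and the further factor \<open>H ^ 3\<close> in
  \<open>w\<close> for the \<open>4 * N + 4\<close> blocks.\<close>

definition "W = H ^ (c + 3)"
definition "w = H ^ (c + 6)"
definition N :: nat where "N = 2 ^ depth n"

definition sub :: "(nat \<Rightarrow> nat) \<Rightarrow> nat \<Rightarrow> 'p colored" where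
  "sub T u = filter (\<lambda>x. reaches (T (snd x)) u) xs"

definition leaf_table :: "(nat \<Rightarrow> nat) \<Rightarrow> bool" where
  "leaf_table T \<longleftrightarrow> inj_on T (snd ` set xs) \<and> T ` snd ` set xs \<subseteq> {N..<2 * N} \<and> {c. T c \<noteq> 0} = snd ` set xs"

definition distributed :: "(nat \<Rightarrow> nat) \<Rightarrow> (nat \<Rightarrow> nat \<Rightarrow> ('p, 'o) val) \<Rightarrow> bool" where
  "distributed T G \<longleftrightarrow> G 0 = input_mem xs \<and> G 1 = (\<lambda>y. Num (T y)) \<and> (\<forall>y\<ge>N. G 2 y = Num 0) \<and>
     G 3 0 = Num 0 \<and> stores G (sub T)"

definition ready :: "(nat \<Rightarrow> nat) \<Rightarrow> (nat \<Rightarrow> nat \<Rightarrow> ('p, 'o) val) \<Rightarrow> bool" where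
  "ready T G \<longleftrightarrow> (\<exists>G0. distributed T G0 \<and> built F c build (sub T) G0 (2 * N) G)"

definition with_header :: "(nat \<Rightarrow> nat \<Rightarrow> ('p, 'o) val) \<Rightarrow> nat \<Rightarrow> nat \<Rightarrow> ('p, 'o) val" where
  "with_header G = G(0 := (G 0)(0 := Num W, 1 := Num N))"

lemma n_pos: "0 < n"
  using xs by (simp add: n_def valid_input_def)

lemma color_le: "x \<in> set xs \<Longrightarrow> snd x \<le> Max (snd ` set xs)"
  by (intro Max_ge) auto

lemma N_bounds: "2 * n \<le> N" "N < 4 * n" "0 < N"
  using depth_ge[of n] depth_less[OF n_pos] by (auto simp: N_def)

lemma H_bounds: "n + 2 \<le> H" "3 \<le> H"
  using n_pos by (auto simp: H_def)

text \<open>The 16 matches the number of blocks: \<open>N < 4 * n\<close> gives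
  \<open>4 * N + 4 \<le> 16 * n\<close>.\<close>

lemma H_cube: "16 * n \<le> H ^ 3"
proof -
  have "16 * n \<le> (n + 2) ^ 3"
    by (cases n) (auto simp: power3_eq_cube algebra_simps)
  also have "\<dots> \<le> H ^ 3" using H_bounds by (intro power_mono) auto
  finally show ?thesis .
qed

lemma H_le_pow: "H ^ i \<le> H ^ (i + j)" "0 < H ^ i"
  using H_bounds by (auto intro!: power_increasing)

lemma W_ge: "H ^ 3 \<le> W" "H < W" "0 < W"
proof -
  show "H ^ 3 \<le> W" unfolding W_def using H_le_pow(1)[of 3 c] by (simp add: add.commute)
  moreover have "H < H ^ 3" using H_bounds power_strict_increasing[of 1 3 H] by simp
  ultimately show "H < W" "0 < W" by auto
qed

lemma w_eq: "w = H ^ 3 * W"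
  by (simp add: w_def W_def flip: power_add) (simp add: numeral_eq_Suc)

lemma bounds: "(4 * N + 4) * W \<le> w" "2 * N < W" "W < w" "4 * n < w" "2 * n + 2 < W"
proof -
  have 1: "4 * N + 4 \<le> H ^ 3" using N_bounds H_cube by linarith
  then show "(4 * N + 4) * W \<le> w" unfolding w_eq by (rule mult_le_mono1)
  show 2: "2 * N < W" using 1 W_ge by linarith
  have "1 * W < (4 * N + 4) * W" using W_ge by (intro mult_less_mono1) auto
  then show "W < w" using \<open>(4 * N + 4) * W \<le> w\<close> by (simp only: mult_1)
  then show "4 * n < w" using 2 N_bounds by linarith
  show "2 * n + 2 < W" using 1 W_ge N_bounds n_pos by linarith
qed

lemma word_bound_eq: "word_bound (c + 6) xs = w"
  by (simp add: word_bound_def w_def H_def n_def)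

lemma color_less: "x \<in> set xs \<Longrightarrow> snd x < W"
  using color_le[of x] W_ge(2) unfolding H_def by linarith

lemma sub_valid:
  assumes "sub T u \<noteq> []"
  shows "valid_input (sub T u)" "word_bound c (sub T u) \<le> W" "length (sub T u) \<le> n"
proof -
  show "valid_input (sub T u)"
    using assms xs by (auto simp: valid_input_def sub_def distinct_map_filter)
  show len: "length (sub T u) \<le> n" by (simp add: sub_def n_def)
  have "Max (snd ` set (sub T u)) \<le> Max (snd ` set xs)"
    using assms by (intro Max_mono) (auto simp: sub_def filter_empty_conv, blast)
  then have "word_bound c (sub T u) \<le> H ^ c"
    unfolding word_bound_def H_def using len by (intro power_mono) auto
  also have "\<dots> \<le> W" unfolding W_def by (rule H_le_pow)
  finally show "word_bound c (sub T u) \<le> W" .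
qed

text \<open>The input is so short compared with \<open>W\<close> that it fits into block 0.\<close>

lemma initial_flat: "input_mem xs = flat W (\<lambda>x. if x = 0 then input_mem xs else (\<lambda>_. Num 0))"
proof
  fix a
  show "input_mem xs a = flat W (\<lambda>x. if x = 0 then input_mem xs else (\<lambda>_. Num 0)) a"
  proof (cases "a < W")
    case False
    then have "2 * n + 2 < a" using bounds by linarith
    then have "\<not> (a - 1) div 2 < n" "a \<noteq> 0" by auto
    moreover have "a div W \<noteq> 0" using False W_ge by (simp add: div_eq_0_iff)
    ultimately show ?thesis by (simp add: flat_def input_mem_def Let_def n_def)
  qed (simp add: flat_def)
qed

lemma exec_header:
  assumes "\<rho> 2 = Num W" "\<rho> 3 = Num N"
  shows "exec F w store_header (conf W \<rho> G ou k) = return_spmf (conf W \<rho> (with_header G) ou (k + 2))"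
  unfolding store_header_def using assms bounds W_ge N_bounds n_pos
  by (simp add: exec_Seq conf_Store[where X = "4 * N + 4"] with_header_def)

text \<open>The rule behind both expectation bounds. \<open>\<Psi>\<close> is a potential of the
  partial color table, \<open>\<Phi>\<close> one of the partially built memory, and
  \<open>start\<close> links them once the table is complete. The deterministic phases appear only
  through their total time.\<close>

lemma exec_build_all:
  fixes \<Psi> :: "(nat \<Rightarrow> nat) \<Rightarrow> ennreal" and g :: "('p, 'o) state \<Rightarrow> ennreal"
    and \<Phi> :: "(nat \<Rightarrow> nat) \<Rightarrow> nat \<Rightarrow> (nat \<Rightarrow> nat \<Rightarrow> ('p, 'o) val) \<Rightarrow> nat \<Rightarrow> ennreal"
  assumes shuffle: "\<And>m T A e. \<lbrakk>shuffle_inv N m T A; N \<le> 2 * m; 0 < m; T e = 0\<rbrakk>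
        \<Longrightarrow> (\<Sum>j<m. \<Psi> (T(e := A j))) / of_nat m \<le> \<Psi> T"
    and step: "\<And>T v G k. \<lbrakk>leaf_table T; 0 < v; v < 2 * N; sub T v \<noteq> []\<rbrakk> \<Longrightarrow>
        dexp (preprocess F c build (sub T v)) (\<lambda>a. dexp (preprocess F c build (sub T v)) (\<lambda>b.
          \<Phi> T (v + 1) (G(2 * v + 2 := mem a, 2 * v + 3 := mem b)) (k + 2 * M + 8 + clock a + clock b)))
        \<le> \<Phi> T v G k"
    and skip: "\<And>T v G k. \<lbrakk>leaf_table T; 0 < v; v < 2 * N; sub T v = []\<rbrakk> \<Longrightarrow> \<Phi> T (v + 1) G (k + 5) \<le> \<Phi> T v G k"
    and start: "\<And>T G k. \<lbrakk>leaf_table T; distributed T G; k \<le> 75 * n * (depth n + 1)\<rbrakk> \<Longrightarrow> \<Phi> T 1 G k \<le> \<Psi> T"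
    and fin: "\<And>\<rho> T G k. \<lbrakk>leaf_table T; ready T G\<rbrakk>
        \<Longrightarrow> g (conf W \<rho> (with_header G) [] (k + 3)) \<le> \<Phi> T (2 * N) G k"
  shows "dexp (preprocess F (c + 6) (build_all c M build) xs) g \<le> \<Psi> (\<lambda>_. 0)"
proof -
  define G1 :: "nat \<Rightarrow> nat \<Rightarrow> ('p, 'o) val" where "G1 = (\<lambda>x. if x = 0 then input_mem xs else (\<lambda>_. Num 0))"
  define \<rho>1 :: "nat \<Rightarrow> ('p, 'o) val" where "\<rho>1 = (\<lambda>_. Num 0)(4 := Num n)"
  have load: "exec F w (Load 4 (Const 0)) (conf W (\<lambda>_. Num 0) G1 [] 0) = return_spmf (conf W \<rho>1 G1 [] 1)"
    using bounds W_ge by (simp add: conf_Load_low G1_def input_mem_def n_def \<rho>1_def)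
  have "\<exists>\<rho>2. exec F w scan (conf W \<rho>1 G1 [] 1) = return_spmf (conf W \<rho>2 G1 [] (1 + 4 * (length xs - 0) + 1))
    \<and> \<rho>2 6 = Num (Max (insert 0 (snd ` set (drop 0 xs)))) \<and> (\<forall>r. r \<notin> {5, 6, 11} \<longrightarrow> \<rho>2 r = \<rho>1 r)"
    using bounds W_ge color_less by (intro exec_scan) (simp_all add: \<rho>1_def G1_def n_def)
  moreover have "Max (insert 0 (snd ` set xs)) = Max (snd ` set xs)"
    using n_pos by (simp add: n_def)
  ultimately obtain \<rho>2 where scan: "exec F w scan (conf W \<rho>1 G1 [] 1) = return_spmf (conf W \<rho>2 G1 [] (4 * n + 2))"
    and r2: "\<rho>2 6 = Num (Max (snd ` set xs))" "\<And>r. r \<notin> {5, 6, 11} \<Longrightarrow> \<rho>2 r = \<rho>1 r"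
    by (auto simp: n_def)
  define \<rho>3 where "\<rho>3 = \<rho>2(2 := Num W, 3 := Num 1)"
  have pow: "eval F \<rho>2 (pow_exp (Op Add (Op Add (Reg 4) (Reg 6)) (Const 2)) (c + 3)) = Num W"
    using r2(1) r2(2)[of 4] by (simp add: eval_pow_exp \<rho>1_def W_def H_def)
  have widths: "exec F w (Assign 2 (pow_exp (Op Add (Op Add (Reg 4) (Reg 6)) (Const 2)) (c + 3))) (conf W \<rho>2 G1 [] (4 * n + 2))
      = return_spmf (conf W (\<rho>2(2 := Num W)) G1 [] (4 * n + 3))"
      "exec F w (Assign 3 (Const 1)) (conf W (\<rho>2(2 := Num W)) G1 [] (4 * n + 3)) = return_spmf (conf W \<rho>3 G1 [] (4 * n + 4))"
    using bounds pow by (subst conf_Assign; simp add: \<rho>3_def numeral_eq_Suc)+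
  have "\<exists>\<rho>' k' L. exec F w double (conf W \<rho>3 G1 [] (4 * n + 4)) = return_spmf (conf W \<rho>' G1 [] k')
    \<and> k' \<le> 4 * n + 4 + 2 * (2 * n - 2 ^ 0) + 1 \<and> \<rho>' 3 = Num (2 ^ L) \<and> 2 * n \<le> 2 ^ L \<and> 2 ^ L < 4 * n
    \<and> (\<forall>r. r \<noteq> 3 \<longrightarrow> \<rho>' r = \<rho>3 r)"
    using n_pos bounds r2(2)[of 4] by (intro exec_double) (simp_all add: \<rho>3_def \<rho>1_def)
  then obtain \<rho>4 k4 where double: "exec F w double (conf W \<rho>3 G1 [] (4 * n + 4)) = return_spmf (conf W \<rho>4 G1 [] k4)"
    and k4: "k4 \<le> 8 * n + 5" and r4: "\<rho>4 3 = Num N" "\<And>r. r \<noteq> 3 \<Longrightarrow> \<rho>4 r = \<rho>3 r"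
    unfolding N_def using depth_unique by fastforce
  define G2 where "G2 = G1(2 := \<lambda>y. if y < N then Num (N + y) else Num 0)"
  have "\<exists>\<rho>'. exec F w fill (conf W \<rho>4 G1 [] k4)
      = return_spmf (conf W \<rho>' (G1(2 := \<lambda>y. if 0 \<le> y \<and> y < N then Num (N + y) else G1 2 y)) [] (k4 + 3 * (N - 0) + 1))
    \<and> \<rho>' 7 = Num N \<and> (\<forall>r. r \<noteq> 7 \<longrightarrow> \<rho>' r = \<rho>4 r)"
  proof (rule exec_fill)
    have "3 * W \<le> (4 * N + 4) * W" by (rule mult_le_mono1) simp
    then show "3 * W \<le> w" using bounds by linarith
  qed (use bounds r4 r2(2)[of 7] in \<open>simp_all add: \<rho>3_def \<rho>1_def\<close>)
  then obtain \<rho>5 where fill: "exec F w fill (conf W \<rho>4 G1 [] k4) = return_spmf (conf W \<rho>5 G2 [] (k4 + 3 * N + 1))"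
    and r5: "\<rho>5 7 = Num N" "\<And>r. r \<noteq> 7 \<Longrightarrow> \<rho>5 r = \<rho>4 r"
    by (auto simp: G2_def G1_def cong: if_cong)
  have r: "\<rho>5 2 = Num W" "\<rho>5 3 = Num N" "\<rho>5 4 = Num n"
    using r5(2)[of 2] r5(2)[of 3] r5(2)[of 4] r4 r2(2)[of 4] by (simp_all add: \<rho>3_def \<rho>1_def)
  define \<rho>6 where "\<rho>6 = \<rho>5(5 := Num 0)"
  \<comment> \<open>The weight handed to the random assignment is the expected final weight of the
    rest of the program.\<close>
  define after where "after = (\<lambda>s. dexp (exec F w (Seq (Assign 5 (Const 0)) (Seq distribute
      (Seq (Assign 9 (Const 1)) (Seq (builds M build) store_header)))) s) g)"
  have w0: "0 < w" using bounds by linarith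
  have "preprocess F (c + 6) (build_all c M build) xs
      = exec F w (build_all c M build) (conf W (\<lambda>_. Num 0) G1 [] 0)"
    unfolding preprocess_def word_bound_eq conf_def G1_def by (subst initial_flat) simp
  then have "dexp (preprocess F (c + 6) (build_all c M build) xs) g
      = dexp (exec F w assign (conf W \<rho>6 G2 [] (k4 + 3 * N + 2))) after"
    using w0
    by (simp add: build_all_def exec_Seq[of F w "Load 4 (Const 0)"] exec_Seq[of F w scan] exec_Seq[of F w double]
      exec_Seq[of F w fill] exec_Seq[of F w assign] exec_Seq[of F w "Assign r e" for r e]
      load scan widths double fill conf_Assign[of F _ "Const 0"] dexp_bind after_def \<rho>6_def
      del: One_nat_def add_2_eq_Suc add_2_eq_Suc', simp add: add.commute)
  also have "\<dots> \<le> \<Psi> (\<lambda>_. 0)"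
  proof (rule exec_assign[where \<Psi> = \<Psi> and T = "\<lambda>_. 0" and N = N and xs = xs and ?\<rho>0.0 = \<rho>6 and ?G0.0 = G2 and i = 0 and m = N
        and A = "\<lambda>y. N + y" and ?k0.0 = "k4 + 3 * N + 2 + 11 * n"])
    have "3 * W \<le> (4 * N + 4) * W" by (rule mult_le_mono1) simp
    then show "3 * W \<le> w" using bounds by linarith
    show "shuffle_inv N N (\<lambda>_. 0) ((+) N)"
      by (auto simp: shuffle_inv_def)
    show "after (conf W \<rho> G [] (k + 1)) \<le> \<Psi> T"
      if \<rho>: "\<And>r. r \<notin> {5, 7, 8, 9, 10, 11} \<Longrightarrow> \<rho> r = \<rho>6 r"
        and G: "\<And>x. x \<noteq> 1 \<Longrightarrow> x \<noteq> 2 \<Longrightarrow> G x = G2 x" "G 1 = (\<lambda>y. Num (T y))" "\<And>y. N \<le> y \<Longrightarrow> G 2 y = G2 2 y"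
        and T: "inj_on T (snd ` set xs)" "T ` snd ` set xs \<subseteq> {N..<2 * N}" "{c. T c \<noteq> 0} = snd ` set xs"
        and k: "k \<le> k4 + 3 * N + 2 + 11 * n" for \<rho> G T k
    proof -
      have T': "leaf_table T" using T by (simp add: leaf_table_def)
      define \<rho>7 where "\<rho>7 = \<rho>(5 := Num 0)"
      have r7: "\<rho>7 2 = Num W" "\<rho>7 3 = Num N" "\<rho>7 4 = Num n"
        using \<rho>[of 2] \<rho>[of 3] \<rho>[of 4] r by (simp_all add: \<rho>7_def \<rho>6_def)
      have G': "G 0 = input_mem xs" "G 3 0 = Num 0" "\<And>y. N \<le> y \<Longrightarrow> G 2 y = Num 0"
        using G(1)[of 0] G(1)[of 3] G(3) by (simp_all add: G2_def G1_def)
      have "\<exists>\<rho>' G' k'. exec F w distribute (conf W \<rho>7 G [] (k + 2)) = return_spmf (conf W \<rho>' G' [] k')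
        \<and> (\<forall>r. r \<notin> {5, 9, 10, 11, 12} \<longrightarrow> \<rho>' r = \<rho>7 r) \<and> G' 0 = G 0 \<and> G' 1 = G 1 \<and> G' 2 = G 2 \<and> G' 3 0 = G 3 0
        \<and> stores G' (\<lambda>u. filter (\<lambda>x. reaches (T (snd x)) u) xs)
        \<and> k' \<le> k + 2 + (10 * (depth n + 1) + 6) * (length xs - 0) + 1"
      proof (rule exec_distribute)
        show "stores G (\<lambda>u. filter (\<lambda>x. reaches (T (snd x)) u) (take 0 xs))"
          using G(1) by (auto simp: stores_def G2_def G1_def input_mem_def)
        show "snd x < W \<and> T (snd x) < 2 * N" if "x \<in> set xs" for x
          using T(2) that color_less by fastforce
        show "2 * N \<le> 2 ^ (depth n + 1)" by (simp add: N_def)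
      qed (use bounds r7 G G' in \<open>simp_all add: \<rho>7_def n_def\<close>)
      then obtain \<rho>8 G8 k8 where distr: "exec F w distribute (conf W \<rho>7 G [] (k + 2)) = return_spmf (conf W \<rho>8 G8 [] k8)"
        and r8: "\<And>r. r \<notin> {5, 9, 10, 11, 12} \<Longrightarrow> \<rho>8 r = \<rho>7 r"
        and G8: "G8 0 = G 0" "G8 1 = G 1" "G8 2 = G 2" "G8 3 0 = G 3 0" "stores G8 (sub T)"
        and k8: "k8 \<le> k + 2 + (10 * (depth n + 1) + 6) * n + 1"
        unfolding sub_def n_def by auto
      have D: "distributed T G8" using G8 G' G(2) by (simp add: distributed_def)
      have "after (conf W \<rho> G [] (k + 1)) = dexp (exec F w (builds M build) (conf W (\<rho>8(9 := Num 1)) G8 [] (k8 + 1)))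
          (\<lambda>s. dexp (exec F w store_header s) g)"
        using bounds distr unfolding after_def \<rho>7_def
        by (simp add: exec_Seq conf_Assign dexp_bind)
      also have "\<dots> \<le> \<Phi> T 1 G8 (k8 + 1)"
      proof (rule exec_builds[where \<Phi> = "\<Phi> T" and N = N and ?G0.0 = G8 and ls = "sub T" and c = c])
        show "built F c build (sub T) G8 1 G8" by (simp add: built_def)
        show "dexp (exec F w store_header (conf W \<rho> G [] (k + 1))) g \<le> \<Phi> T (2 * N) G k"
          if "built F c build (sub T) G8 (2 * N) G" "\<rho> 2 = Num W" "\<rho> 3 = Num N" for \<rho> G k
        proof -
          have "ready T G" using D that by (auto simp: ready_def)
          then show ?thesis using that fin[OF T'] by (simp add: exec_header numeral_3_eq_3)
        qed
      qed (use bounds G8 sub_valid lossless M r8[of 2] r8[of 3] r7 N_bounds step[OF T'] skip[OF T'] in auto)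
      also have "\<dots> \<le> \<Psi> T"
      proof (rule start[OF T' D])
        \<comment> \<open>The contributions are scanning and doubling, filling with
          \<open>N < 4 * n\<close>, assigning, and distributing; only the last depends on the depth.
          The 75 is a generous rounding.\<close>
        have "k8 + 1 \<le> 8 * n + 5 + 3 * (4 * n) + 2 + 11 * n + 2 + (10 * (depth n + 1) + 6) * n + 2"
          using k8 k k4 N_bounds by linarith
        also have "\<dots> = 37 * n + 10 * n * (depth n + 1) + 11" by (simp add: algebra_simps)
        also have "\<dots> \<le> 65 * (n * (depth n + 1)) + 10 * n * (depth n + 1)"
          using n_pos by (simp add: algebra_simps)
        finally show "k8 + 1 \<le> 75 * n * (depth n + 1)" by simp
      qed
      finally show ?thesis .
    qed
  qed (use bounds W_ge N_bounds color_less shuffle r r5 in \<open>auto simp: n_def G2_def G1_def \<rho>6_def\<close>)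
  finally show ?thesis .
qed

end

section \<open>The query\<close>

definition probe :: "nat \<Rightarrow> nat \<Rightarrow> com \<Rightarrow> com" where
  "probe M d q = Seq (Assign 1 (Adr (Op Add (Op Mul (Const 2) (Reg 9)) (Const d)) (Const 0)))
    (Seq (reset 16 M) (Seq (Assign 16 (Reg 0)) (reloc 16 1 q)))"

definition push :: com where
  "push = Seq (Store (Adr (Const 1) (Reg 13)) (Op Mul (Const 2) (Reg 9)))
    (Seq (Store (Adr (Const 1) (Op Add (Reg 13) (Const 1))) (Op Add (Op Mul (Const 2) (Reg 9)) (Const 1)))
    (Assign 13 (Op Add (Reg 13) (Const 2))))"

text \<open>The sum of two truth values acts as a disjunction, and \<open>N < v + 1\<close>
  expresses that \<open>v\<close> is a leaf.\<close>

definition decide :: com where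
  "decide = Cond (Op Add (Reg 16) (Op Less (Reg 3) (Op Add (Reg 9) (Const 1)))) (Report (Reg 14)) push"

text \<open>Registers 16 and 18 are the guest's registers 0 and 2, its answer and the color found.
  The color moves to register 14 because the next probe clears the window.\<close>

definition respond :: "nat \<Rightarrow> com \<Rightarrow> com" where
  "respond M q1 = Cond (Reg 16) (Seq (Assign 14 (Reg 18)) (Seq (probe M 3 q1) decide)) Skip"

definition visit :: "nat \<Rightarrow> com \<Rightarrow> com \<Rightarrow> com" where
  "visit M q0 q1 = Seq (probe M 2 q0) (respond M q1)"

text \<open>Register 13 is the height of the stack. The point count of a node is looked up first,
  since nodes without points carry no structure to probe.\<close>

definition search :: "nat \<Rightarrow> com \<Rightarrow> com \<Rightarrow> com" where
  "search M q0 q1 = While (Reg 13)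
    (Seq (Assign 13 (Op Sub (Reg 13) (Const 1)))
    (Seq (Load 9 (Adr (Const 1) (Reg 13)))
    (Seq (Load 12 (Adr (Const 3) (Reg 9)))
    (Cond (Reg 12) (visit M q0 q1) Skip))))"

definition query_all :: "nat \<Rightarrow> com \<Rightarrow> com \<Rightarrow> com" where
  "query_all M q0 q1 = Seq (Load 2 (Const 0)) (Seq (Load 3 (Const 1))
    (Seq (Store (Adr (Const 1) (Const 0)) (Const 1)) (Seq (Assign 13 (Const 1)) (search M q0 q1))))"

definition state_of :: "(nat \<Rightarrow> ('p, 'o) val) \<Rightarrow> ('p, 'o) state" where
  "state_of m = \<lparr>regs = \<lambda>_. Num 0, mem = m, out = [], clock = 0\<rparr>"

lemma query_state_of: "mem s = m \<Longrightarrow> query F c q l r s = query F c q l r (state_of m)"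
  by (simp add: query_def state_of_def)

lemma exec_probe:
  fixes G :: "nat \<Rightarrow> nat \<Rightarrow> ('p, 'o) val"
  assumes "\<rho> 0 = Range r" "\<rho> 2 = Num W" "\<rho> 9 = Num v" "0 < M"
    and "2 * v + d < X" "X * W \<le> w" "0 < W" "word_bound c l \<le> W" "com_regs q \<subseteq> {..<M}"
    and "lossless_spmf (query F c q l r (state_of (G (2 * v + d))))"
  shows "exec F w (probe M d q) (conf W \<rho> G ou k)
    = map_spmf (\<lambda>t. conf W (\<lambda>r. if 16 \<le> r \<and> r < 16 + M then regs t (r - 16)
          else (\<rho>(1 := Num (addr W (2 * v + d) 0))) r) (G(2 * v + d := mem t)) ou (k + M + 3 + clock t))
        (query F c q l r (state_of (G (2 * v + d))))"
proof -
  define \<rho>1 where "\<rho>1 = \<rho>(1 := Num (addr W (2 * v + d) 0))"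
  define \<rho>2 where "\<rho>2 = (\<lambda>r. if 16 \<le> r \<and> r < 16 + M then Num 0 else \<rho>1 r)(16 := Range r)"
  have a: "addr W (2 * v + d) 0 < w" using assms by (intro addr_less)
  have eq: "(\<lambda>r. if 16 \<le> r \<and> r < 16 + M then regs t (r - 16) else \<rho>2 r)
      = (\<lambda>r. if 16 \<le> r \<and> r < 16 + M then regs t (r - 16) else \<rho>1 r)" for t :: "('p, 'o) state"
    using assms(4) by (auto simp: \<rho>2_def fun_eq_iff)
  have "exec F w (probe M d q) (conf W \<rho> G ou k)
      = exec F w (reloc 16 1 q) (conf W \<rho>2 G ou (k + M + 3))"
    unfolding probe_def using assms(1-3) a
    by (simp add: exec_Seq conf_Assign eval_Adr conf_reset \<rho>2_def \<rho>1_def cong: if_cong)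
      (simp add: numeral_3_eq_3)
  also have "\<dots> = map_spmf (\<lambda>t. conf W (\<lambda>r. if 16 \<le> r \<and> r < 16 + M then regs t (r - 16) else \<rho>2 r)
      (G(2 * v + d := mem t)) ou (k + M + 3 + clock t))
      (exec F (word_bound c l) q \<lparr>regs = (\<lambda>_. Num 0)(0 := Range r), mem = G (2 * v + d), out = [], clock = 0\<rparr>)"
    using assms addr_block[OF assms(5,8,6)]
    by (intro exec_sub) (auto simp: \<rho>2_def \<rho>1_def query_def state_of_def)
  finally show ?thesis by (simp only: eq) (simp add: \<rho>1_def query_def state_of_def cong: if_cong)
qed

lemma dexp_le_const:
  assumes "lossless_spmf p" "\<And>x. x \<in> set_spmf p \<Longrightarrow> g x \<le> B"
  shows "dexp p g \<le> B"
proof -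
  have "dexp p g \<le> dexp p (\<lambda>_. B)" by (rule dexp_mono) (rule assms)
  also have "\<dots> = B" using assms(1)
    by (simp add: dexp_lossless measure_spmf.emeasure_eq_measure lossless_weight_spmfD flip: weight_spmf_def)
  finally show ?thesis .
qed

lemma dexp_indicator:
  assumes "lossless_spmf p"
  shows "dexp p (\<lambda>t. B + indicator {t. P t} t * Y) = B + emeasure (measure_spmf p) {t. P t} * Y"
proof -
  have "emeasure (measure_spmf p) (Sigma_Algebra.space (measure_spmf p)) = 1"
    using assms
    by (simp add: measure_spmf.emeasure_eq_measure lossless_weight_spmfD flip: weight_spmf_def)
  then show ?thesis
    using assms by (simp add: dexp_lossless nn_integral_add nn_integral_multc)
qed

text \<open>A finite demonic expectation of this weight certifies termination and the right output
  on every run. A multiset fixes multiplicities, hence rules out repeated reports, but leaves the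
  order open.\<close>

definition goal :: "('p, 'o) val multiset \<Rightarrow> ('p, 'o) state \<Rightarrow> ennreal" where
  "goal tot t = (if mset (out t) = tot then of_nat (clock t) else top)"

lemma goal_finite:
  fixes xs :: "'p colored" and t :: "('p, 'o) state"
  assumes "goal (mset_set (Num ` colors_in xs r)) t < top"
  shows "distinct (out t)" "set (out t) = Num ` colors_in xs r"
proof -
  have *: "mset (out t) = mset_set (Num ` colors_in xs r)"
    using assms by (auto simp: goal_def split: if_splits)
  have fin: "finite (colors_in xs r)" by (simp add: colors_in_def)
  show "set (out t) = Num ` colors_in xs r"
    using arg_cong[OF *, of set_mset] fin by simp
  have "count (mset (out t)) x \<le> 1" for x
    unfolding * using fin by (simp add: count_mset_set')
  then show "distinct (out t)"
    unfolding distinct_count_atmost_1 by (metis count_mset_0_iff le_antisym One_nat_def Suc_leI count_greater_zero_iff set_mset_mset)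
qed

text \<open>For the memory at hand, the probability that the search proceeds below an inner node
  \<open>u\<close>; only the coins of the query count here, those of the build are averaged later.
  The value is 0 without a color in range, as the emptiness test then stops the search.\<close>

definition (in tree_ds) miss ::
  "com \<Rightarrow> 'p set \<Rightarrow> (nat \<Rightarrow> nat) \<Rightarrow> (nat \<Rightarrow> nat \<Rightarrow> ('p, 'o) val) \<Rightarrow> nat \<Rightarrow> ennreal" where
  "miss q1 r T G u = (if colors_in (sub T u) r = {} then 0
     else emeasure (measure_spmf (query F c q1 (sub T u) r (state_of (G (2 * u + 3))))) {t. no t})"

section \<open>Correctness and expected time of the search in a fixed memory\<close>

locale tree_query = tree_ds F c M build xs
  for F :: "('p, 'o) prims" and c M build xs +
  fixes T :: "nat \<Rightarrow> nat" and G0 :: "nat \<Rightarrow> nat \<Rightarrow> ('p, 'o) val" and q0 q1 :: com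
    and r :: "'p set" and t0 t1 :: nat
  assumes T: "leaf_table T"
    and regs: "3 \<le> M" "com_regs q0 \<subseteq> {..<M}" "com_regs q1 \<subseteq> {..<M}"
    and counts: "\<And>u. 0 < u \<Longrightarrow> G0 3 u = Num (length (sub T u))"
    and q0: "\<And>u. \<lbrakk>0 < u; u < 2 * N; sub T u \<noteq> []\<rbrakk>
        \<Longrightarrow> lossless_spmf (query F c q0 (sub T u) r (state_of (G0 (2 * u + 2))))"
      "\<And>u t. \<lbrakk>0 < u; u < 2 * N; sub T u \<noteq> []; t \<in> set_spmf (query F c q0 (sub T u) r (state_of (G0 (2 * u + 2))))\<rbrakk>
        \<Longrightarrow> clock t \<le> t0 \<and> (if colors_in (sub T u) r = {} then no t
          else yes t \<and> (\<exists>col \<in> colors_in (sub T u) r. regs t 2 = Num col))"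
    and q1: "\<And>u. \<lbrakk>0 < u; u < 2 * N; sub T u \<noteq> []\<rbrakk>
        \<Longrightarrow> lossless_spmf (query F c q1 (sub T u) r (state_of (G0 (2 * u + 3))))"
      "\<And>u t. \<lbrakk>0 < u; u < 2 * N; sub T u \<noteq> []; t \<in> set_spmf (query F c q1 (sub T u) r (state_of (G0 (2 * u + 3))))\<rbrakk>
        \<Longrightarrow> clock t \<le> t1 \<and> (yes t \<or> no t) \<and> (card (colors_in (sub T u) r) \<noteq> 1 \<longrightarrow> no t)"
begin

definition cols :: "nat \<Rightarrow> nat set" where
  "cols u = colors_in (sub T u) r"

definition answer :: "nat \<Rightarrow> ('p, 'o) val multiset" where
  "answer u = mset_set (Num ` cols u)"

abbreviation fail :: "nat \<Rightarrow> ennreal" where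
  "fail \<equiv> miss q1 r T G0"

text \<open>
  The head of the list \<open>st\<close> is the top of the stack. No node is visited twice, so only the structures
  of the nodes that can still be reached from the stack have to be intact.
\<close>

definition pending :: "nat list \<Rightarrow> nat list" where
  "pending st = concat (map (subtree N) st)"

definition inv :: "nat list \<Rightarrow> (nat \<Rightarrow> ('p, 'o) val) \<Rightarrow> (nat \<Rightarrow> nat \<Rightarrow> ('p, 'o) val) \<Rightarrow> bool" where
  "inv st \<rho> G \<longleftrightarrow> \<rho> 0 = Range r \<and> \<rho> 2 = Num W \<and> \<rho> 3 = Num N \<and> \<rho> 13 = Num (length st) \<and>
     (\<forall>i<length st. G 1 i = Num (rev st ! i)) \<and> G 3 = G0 3 \<and> (\<forall>v\<in>set st. 0 < v \<and> v < 2 * N) \<and>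
     distinct (pending st) \<and> (\<forall>u\<in>set (pending st). G (2 * u + 2) = G0 (2 * u + 2) \<and> G (2 * u + 3) = G0 (2 * u + 3))"

lemma leaf: "x \<in> set xs \<Longrightarrow> N \<le> T (snd x) \<and> T (snd x) < 2 * N"
  using T by (force simp: leaf_table_def)

lemma cols_eq: "cols u = {col \<in> colors_in xs r. reaches (T col) u}"
  by (auto simp: cols_def colors_in_def sub_def)

lemma finite_cols: "finite (cols u)"
  by (simp add: cols_def colors_in_def)

lemma cols_children:
  assumes "0 < u" "u < N"
  shows "cols u = cols (2 * u) \<union> cols (2 * u + 1)" "cols (2 * u) \<inter> cols (2 * u + 1) = {}"
proof -
  have "reaches (T col) u \<longleftrightarrow> reaches (T col) (2 * u) \<or> reaches (T col) (2 * u + 1)"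
    if "col \<in> colors_in xs r" for col
    using that leaf by (intro reaches_iff_children[OF assms(2)]) (auto simp: colors_in_def)
  then show "cols u = cols (2 * u) \<union> cols (2 * u + 1)" unfolding cols_eq by blast
  show "cols (2 * u) \<inter> cols (2 * u + 1) = {}"
    unfolding cols_eq using reaches_siblings[OF assms(1)] by blast
qed

lemma answer_children:
  assumes "0 < u" "u < N"
  shows "answer u = answer (2 * u) + answer (2 * u + 1)"
proof -
  have "Num ` cols (2 * u) \<inter> Num ` cols (2 * u + 1) = ({} :: ('p, 'o) val set)"
    using cols_children(2)[OF assms] by auto
  then show ?thesis
    unfolding answer_def cols_children(1)[OF assms] image_Un
    by (intro mset_set_Union finite_imageI finite_cols)
qed

text \<open>Distinct colors sit at distinct leaves. This makes a report at a leaf correct even after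
  a wrong no of the one-color test.\<close>

lemma cols_leaf:
  assumes "N \<le> u" "a \<in> cols u" "b \<in> cols u"
  shows "a = b"
proof -
  have "a \<in> snd ` set xs" "b \<in> snd ` set xs" using assms by (auto simp: cols_eq colors_in_def)
  moreover have "T a = T b"
  proof -
    have "T a = u" "T b = u"
      using assms leaf by (auto simp: cols_eq colors_in_def intro!: reaches_leaf[of _ u N])
    then show ?thesis by simp
  qed
  moreover have "inj_on T (snd ` set xs)" using T by (simp add: leaf_table_def)
  ultimately show ?thesis by (auto dest: inj_onD)
qed

lemma answer_single: "\<lbrakk>col \<in> cols u; \<And>b. b \<in> cols u \<Longrightarrow> b = col\<rbrakk> \<Longrightarrow> answer u = {#Num col#}"
proof -
  assume "col \<in> cols u" "\<And>b. b \<in> cols u \<Longrightarrow> b = col"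
  then have "cols u = {col}" by blast
  then show ?thesis by (simp add: answer_def)
qed

lemma pending_Cons:
  "pending (v # st) = subtree N v @ pending st" "pending [] = []"
  by (simp_all add: pending_def)

lemma subtree_inner:
  "\<lbrakk>0 < v; v < N\<rbrakk> \<Longrightarrow> subtree N v = v # subtree N (2 * v) @ subtree N (2 * v + 1)"
  by (subst subtree.simps) (simp only: if_True simp_thms)

text \<open>The pending nodes are distinct numbers from 1 to \<open>2 * N - 1\<close>, and each
  stack entry accounts for at least one of them; so the stack fits into its block.\<close>

lemma length_pending:
  assumes "inv st \<rho> G"
  shows "length st \<le> length (pending st)" "length (pending st) < 2 * N"
proof -
  show "length st \<le> length (pending st)"
  proof (induction st)
    case (Cons v st)
    have "subtree N v \<noteq> []" by (subst subtree.simps) simp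
    then have "1 \<le> length (subtree N v)" by (simp add: Suc_le_eq)
    then show ?case using Cons by (simp only: pending_Cons length_append list.size)
  qed (simp add: pending_Cons)
  have "set (pending st) \<subseteq> {1..<2 * N}"
  proof
    fix u assume "u \<in> set (pending st)"
    then obtain v where v: "v \<in> set st" "u \<in> set (subtree N v)" by (auto simp: pending_def)
    then have "0 < v" "v < 2 * N" using assms by (auto simp: inv_def)
    then show "u \<in> {1..<2 * N}" using subtree_bounds[OF v(2)] by auto
  qed
  then have "card (set (pending st)) \<le> card {1..<2 * N}" by (intro card_mono) auto
  moreover have "card (set (pending st)) = length (pending st)"
    using assms by (intro distinct_card) (simp add: inv_def)
  ultimately show "length (pending st) < 2 * N" using N_bounds by simp
qed

text \<open>The blocks of \<open>v\<close> may be ruined by its probes, since \<open>v\<close> does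
  not occur below the rest of the stack.\<close>

lemma inv_pop:
  assumes "inv (v # st) \<rho> G" "\<rho>' 0 = Range r" "\<rho>' 2 = Num W" "\<rho>' 3 = Num N" "\<rho>' 13 = Num (length st)"
    and G': "\<And>x. x \<noteq> 2 * v + 2 \<Longrightarrow> x \<noteq> 2 * v + 3 \<Longrightarrow> G' x = G x"
  shows "inv st \<rho>' G'"
proof -
  have v: "0 < v" "set (subtree N v) \<inter> set (pending st) = {}" "distinct (pending st)"
    using assms(1) by (auto simp: inv_def pending_Cons)
  have "G' (2 * u + 2) = G0 (2 * u + 2) \<and> G' (2 * u + 3) = G0 (2 * u + 3)" if "u \<in> set (pending st)" for u
  proof -
    have "u \<noteq> v" using that v(2) self_in_subtree[of v N] by blast
    then have "2 * u + 2 \<noteq> 2 * v + 2" "2 * u + 2 \<noteq> 2 * v + 3" "2 * u + 3 \<noteq> 2 * v + 2" "2 * u + 3 \<noteq> 2 * v + 3"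
      by presburger+
    then show ?thesis using assms(1) that by (simp add: G' inv_def pending_Cons del: add_2_eq_Suc add_2_eq_Suc')
  qed
  moreover have "G' 1 = G 1" "G' 3 = G 3" using v(1) by (auto intro!: G')
  moreover have "G 1 i = Num (rev st ! i)" if "i < length st" for i
    using assms(1) that by (auto simp: inv_def nth_append)
  ultimately show ?thesis using assms v by (simp add: inv_def)
qed

lemma inv_push:
  assumes "inv (v # st) \<rho> G" "v < N"
    and "\<rho>' 0 = Range r" "\<rho>' 2 = Num W" "\<rho>' 3 = Num N" "\<rho>' 13 = Num (length st + 2)"
    and G': "\<And>x. x \<noteq> 1 \<Longrightarrow> x \<noteq> 2 * v + 2 \<Longrightarrow> x \<noteq> 2 * v + 3 \<Longrightarrow> G' x = G x"
      "G' 1 = (G 1)(length st := Num (2 * v), length st + 1 := Num (2 * v + 1))"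
  shows "inv ((2 * v + 1) # (2 * v) # st) \<rho>' G'"
proof -
  have "0 < v" using assms(1) by (simp add: inv_def)
  then have sub: "subtree N v = v # subtree N (2 * v) @ subtree N (2 * v + 1)"
    using assms(2) by (rule subtree_inner)
  have dist: "distinct (pending ((2 * v + 1) # (2 * v) # st))" "v \<notin> set (pending ((2 * v + 1) # (2 * v) # st))"
    using assms(1) unfolding inv_def pending_Cons sub by auto
  have old: "G (2 * u + 2) = G0 (2 * u + 2) \<and> G (2 * u + 3) = G0 (2 * u + 3)"
    if "u \<in> set (pending ((2 * v + 1) # (2 * v) # st))" for u
    using assms(1) that unfolding inv_def pending_Cons sub by auto
  have "G' (2 * u + 2) = G0 (2 * u + 2) \<and> G' (2 * u + 3) = G0 (2 * u + 3)"
    if "u \<in> set (pending ((2 * v + 1) # (2 * v) # st))" for u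
  proof -
    have "u \<noteq> v" using that dist by auto
    then have "2 * u + 2 \<noteq> 2 * v + 2" "2 * u + 2 \<noteq> 2 * v + 3" "2 * u + 3 \<noteq> 2 * v + 2" "2 * u + 3 \<noteq> 2 * v + 3"
      "2 * u + 2 \<noteq> 1" "2 * u + 3 \<noteq> 1"
      by presburger+
    then show ?thesis using old[OF that] by (simp add: G'(1) del: add_2_eq_Suc add_2_eq_Suc')
  qed
  moreover have "G' 3 = G 3" using \<open>0 < v\<close> by (auto intro!: G')
  moreover have "G' 1 i = Num (rev ((2 * v + 1) # (2 * v) # st) ! i)" if "i < length st + 2" for i
  proof -
    have "G 1 i = Num (rev st ! i)" if "i < length st"
      using assms(1) that by (auto simp: inv_def nth_append)
    then show ?thesis using that unfolding G'(2) by (auto simp: nth_append less_Suc_eq)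
  qed
  ultimately show ?thesis using assms(1-6) dist(1) \<open>0 < v\<close> by (simp add: inv_def)
qed

text \<open>A visit takes 5 units to pop and check the node, \<open>M + 3 + t0\<close> for the first
  probe, 2 to keep the color, \<open>M + 3 + t1\<close> for the second probe, and at most 4 to
  report or push.\<close>

definition node_time :: nat where
  "node_time = 2 * M + 17 + t0 + t1"

text \<open>Induction on the number of pending nodes, with the potential \<open>cost\<close> on each
  stack entry: a visit consumes the 1 in the recursion of \<open>cost\<close>, and the two children
  are charged only when the one-color test fails. What is reported plus what is due from the stack
  stays equal to \<open>tot\<close>.\<close>

lemma exec_search:
  assumes "inv st \<rho> G" "mset ou + (\<Sum>v\<leftarrow>st. answer v) = tot"
  shows "dexp (exec F w (search M q0 q1) (conf W \<rho> G ou k)) (goal tot)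
    \<le> of_nat k + 1 + of_nat node_time * (\<Sum>v\<leftarrow>st. cost N fail v)"
  using assms
proof (induction "length (pending st)" arbitrary: st \<rho> G ou k rule: less_induct)
  case less
  let ?search = "exec F w (search M q0 q1)"
  note inv = less.prems(1)
  show ?case
  proof (cases st)
    case Nil
    have "?search (conf W \<rho> G ou k) = return_spmf (conf W \<rho> G ou (k + 1))"
      unfolding search_def using inv Nil by (subst conf_While) (simp add: inv_def)
    then show ?thesis using less.prems(2) Nil by (simp add: goal_def add.commute)
  next
    case (Cons v st')
    define A where "A = node_time"
    define S where "S = (\<Sum>v\<leftarrow>st'. cost N fail v)"
    define B :: ennreal where "B = of_nat (k + A) + 1 + of_nat A * S"
    have v: "0 < v" "v < 2 * N" "\<rho> 0 = Range r" "\<rho> 2 = Num W" "\<rho> 3 = Num N" "\<rho> 13 = Num (length st' + 1)"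
      "G 1 (length st') = Num v" "G 3 v = Num (length (sub T v))"
      "G (2 * v + 2) = G0 (2 * v + 2)" "G (2 * v + 3) = G0 (2 * v + 3)"
      using inv self_in_subtree[of v N] counts[of v]
      by (auto simp: Cons inv_def nth_append pending_Cons simp del: self_in_subtree)
    have len: "length st' + 1 \<le> length (pending st)" "length (pending st) < 2 * N"
      using length_pending[OF inv] Cons by auto
    have X: "1 < 4 * N + 4" "3 < 4 * N + 4" "2 * v + 2 < 4 * N + 4" "2 * v + 3 < 4 * N + 4" using v by auto
    have w: "length st' + 2 < W" "v < W" "2 * v + 1 < w" "0 < w" "W \<le> w" "length st' + 2 < w" "v + 1 < w"
    proof -
      have "(4 * N + 4) * 1 \<le> (4 * N + 4) * W" using W_ge(3) by (intro mult_le_mono2) simp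
      then have "4 * N + 4 \<le> w" using le_trans[OF _ bounds(1), of "(4 * N + 4) * 1"] by simp
      then show "length st' + 2 < W" "v < W" "2 * v + 1 < w" "0 < w" "W \<le> w" "length st' + 2 < w" "v + 1 < w"
        using v len bounds(2,3) by linarith+
    qed
    define \<rho>1 where "\<rho>1 = \<rho>(13 := Num (length st'), 9 := Num v, 12 := Num (length (sub T v)))"
    have first: "?search (conf W \<rho> G ou k)
      = bind_spmf (exec F w (if sub T v \<noteq> [] then visit M q0 q1 else Skip) (conf W \<rho>1 G ou (k + 5)))
          ?search"
      unfolding search_def
      apply (subst conf_While)
      using v X w bounds(1)
      by (simp add: exec_Seq conf_Assign conf_Load[where X = "4 * N + 4"] conf_Cond \<rho>1_def,
          simp add: eval_nat_numeral)
    have shorter: "length (pending st') < length (pending st)"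
      using length_pending(1)[of "[v]"] subtree.simps[of N v] by (simp add: Cons pending_Cons)
    \<comment> \<open>Covers every exit that leaves the part below \<open>v\<close> unexplored: no
      points, no color in range, or a report.\<close>
    have pop: "dexp (?search (conf W \<rho>' G' ou' k')) (goal tot) \<le> B"
      if "\<rho>' 0 = Range r" "\<rho>' 2 = Num W" "\<rho>' 3 = Num N" "\<rho>' 13 = Num (length st')"
        and "\<And>x. x \<noteq> 2 * v + 2 \<Longrightarrow> x \<noteq> 2 * v + 3 \<Longrightarrow> G' x = G x"
        and "mset ou' + (\<Sum>v\<leftarrow>st'. answer v) = tot" "k' \<le> k + A" for \<rho>' G' ou' k'
    proof -
      have "inv st' \<rho>' G'" using inv that(1-5) unfolding Cons by (rule inv_pop)
      then have "dexp (?search (conf W \<rho>' G' ou' k')) (goal tot)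
          \<le> of_nat k' + 1 + of_nat A * S"
        unfolding A_def S_def using shorter that(6) by (intro less.hyps) auto
      also have "\<dots> \<le> B"
        unfolding B_def using that(7) by (intro add_right_mono of_nat_mono)
      finally show ?thesis .
    qed
    have "dexp (?search (conf W \<rho> G ou k)) (goal tot)
        \<le> B + (if v < N then fail v * (of_nat A * (cost N fail (2 * v) + cost N fail (2 * v + 1))) else 0)"
    proof (cases "sub T v = []")
      case True
      then have "answer v = {#}" by (simp add: answer_def cols_def colors_in_def)
      then have "dexp (?search (conf W \<rho>1 G ou (k + 6))) (goal tot) \<le> B"
        using less.prems(2) v by (intro pop) (simp_all add: Cons \<rho>1_def A_def node_time_def)
      then show ?thesis
        unfolding first using True by (simp add: conf_Skip add_increasing2 numeral_eq_Suc)
    next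
      case False
      let ?p = "query F c q0 (sub T v) r (state_of (G (2 * v + 2)))"
      let ?q = "query F c q1 (sub T v) r (state_of (G (2 * v + 3)))"
      define Y where "Y = of_nat A * (cost N fail (2 * v) + cost N fail (2 * v + 1))"
      define G1 where "G1 t = G(2 * v + 2 := mem t)" for t :: "('p, 'o) state"
      define G2 where "G2 t u = G(2 * v + 2 := mem t, 2 * v + 3 := mem u)" for t u :: "('p, 'o) state"
      define \<rho>2 :: "('p, 'o) state \<Rightarrow> nat \<Rightarrow> ('p, 'o) val"
        where "\<rho>2 t = (\<lambda>r. if 16 \<le> r \<and> r < 16 + M then regs t (r - 16)
          else (\<rho>1(1 := Num (addr W (2 * v + 2) 0))) r)" for t
      define \<rho>3 :: "nat \<Rightarrow> ('p, 'o) state \<Rightarrow> ('p, 'o) state \<Rightarrow> nat \<Rightarrow> ('p, 'o) val"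
        where "\<rho>3 col t u = (\<lambda>r. if 16 \<le> r \<and> r < 16 + M then regs u (r - 16)
          else ((\<rho>2 t)(14 := Num col, 1 := Num (addr W (2 * v + 3) 0))) r)" for col t u
      have M3: "3 \<le> M" "0 < M" using regs by auto
      have p: "lossless_spmf ?p" "\<And>t. t \<in> set_spmf ?p \<Longrightarrow> clock t \<le> t0 \<and> (if cols v = {} then no t
          else yes t \<and> (\<exists>col \<in> cols v. regs t 2 = Num col))"
        using q0[of v] v False by (auto simp: cols_def)
      have q: "lossless_spmf ?q" "\<And>t. t \<in> set_spmf ?q \<Longrightarrow> clock t \<le> t1 \<and> (yes t \<or> no t) \<and>
          (card (cols v) \<noteq> 1 \<longrightarrow> no t)"
        using q1[of v] v False by (auto simp: cols_def)
      let ?s1 = "\<lambda>t. conf W (\<rho>2 t) (G1 t) ou (k + 5 + M + 3 + clock t)"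
      have vis: "exec F w (visit M q0 q1) (conf W \<rho>1 G ou (k + 5))
        = bind_spmf ?p (\<lambda>t. exec F w (respond M q1)
            (?s1 t))"
      proof -
        have "exec F w (probe M 2 q0) (conf W \<rho>1 G ou (k + 5))
          = map_spmf (\<lambda>t. conf W (\<rho>2 t) (G1 t) ou (k + 5 + M + 3 + clock t)) ?p"
          unfolding \<rho>2_def G1_def
          using v X bounds W_ge M3 regs sub_valid[OF False] p(1)
          by (intro exec_probe[where l = "sub T v" and c = c and X = "4 * N + 4"]) (simp_all add: \<rho>1_def)
        then show ?thesis
          by (simp only: visit_def exec_Seq[of F w "probe M 2 q0"] bind_map_spmf o_def)
      qed
      have "dexp (?search (conf W \<rho> G ou k)) (goal tot)
        = dexp ?p (\<lambda>t. dexp (exec F w (respond M q1)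
            (?s1 t))
          (\<lambda>s. dexp (?search s) (goal tot)))"
        unfolding first using False by (simp only: if_True simp_thms vis dexp_bind)
      also have "\<dots> \<le> B + (if v < N then fail v * Y else 0)"
      proof (rule dexp_le_const[OF p(1)])
        fix t assume t: "t \<in> set_spmf ?p"
        have r2: "\<rho>2 t 16 = regs t 0" "\<rho>2 t 18 = regs t 2" using M3 by (simp_all add: \<rho>2_def)
        show "dexp (exec F w (respond M q1)
            (?s1 t))
          (\<lambda>s. dexp (?search s) (goal tot)) \<le> B + (if v < N then fail v * Y else 0)"
        proof (cases "cols v = {}")
          case True
          then have no: "regs t 0 = Num 0" "clock t \<le> t0" using p(2)[OF t] by (auto simp: no_def)
          have "answer v = {#}" using True by (simp add: answer_def)
          then have "dexp (?search (conf W (\<rho>2 t) (G1 t) ou (k + 5 + M + 3 + clock t + 1 + 1))) (goal tot) \<le> B"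
            using less.prems(2) v no
            by (intro pop) (simp_all add: Cons \<rho>1_def \<rho>2_def G1_def A_def node_time_def)
          then show ?thesis using no r2
            by (simp add: respond_def conf_Cond conf_Skip add_increasing2)
        next
          case ne: False
          then obtain col where col: "col \<in> cols v" "regs t 2 = Num col"
            and yes: "regs t 0 = Num 1" "clock t \<le> t0"
            using p(2)[OF t] by (auto simp: yes_def)
          have "col \<in> snd ` set xs" using col by (auto simp: cols_eq colors_in_def)
          then have colw: "col < w" using color_less bounds(3) by fastforce
          define k2 where "k2 = k + M + 10 + clock t"
          have pr: "exec F w (probe M 3 q1) (conf W ((\<rho>2 t)(14 := Num col)) (G1 t) ou k2)
            = map_spmf (\<lambda>u. conf W (\<rho>3 col t u) (G2 t u) ou (k2 + M + 3 + clock u)) ?q"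
          proof -
            have "G1 t (2 * v + 3) = G (2 * v + 3)" by (simp add: G1_def)
            moreover have "exec F w (probe M 3 q1) (conf W ((\<rho>2 t)(14 := Num col)) (G1 t) ou k2)
              = map_spmf (\<lambda>u. conf W (\<rho>3 col t u) ((G1 t)(2 * v + 3 := mem u)) ou (k2 + M + 3 + clock u))
                  (query F c q1 (sub T v) r (state_of (G1 t (2 * v + 3))))"
              unfolding \<rho>3_def
              using v X bounds W_ge M3 regs sub_valid[OF False] q(1) calculation
              by (intro exec_probe[where l = "sub T v" and c = c and X = "4 * N + 4"])
                (simp_all add: \<rho>1_def \<rho>2_def)
            ultimately show ?thesis by (simp add: G1_def G2_def)
          qed
          have "exec F w (respond M q1)
            (?s1 t)
            = bind_spmf ?q (\<lambda>u. exec F w decide (conf W (\<rho>3 col t u) (G2 t u) ou (k2 + M + 3 + clock u)))"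
          proof -
            have "k + 5 + M + 3 + clock t + 1 + 1 = k2" by (simp add: k2_def)
            then have "exec F w (respond M q1)
              (?s1 t)
              = bind_spmf (exec F w (probe M 3 q1) (conf W ((\<rho>2 t)(14 := Num col)) (G1 t) ou k2)) (exec F w decide)"
              using yes col r2 colw by (simp add: respond_def conf_Cond exec_Seq conf_Assign)
            then show ?thesis unfolding pr by (simp only: bind_map_spmf o_def)
          qed
          then have "dexp (exec F w (respond M q1)
            (?s1 t))
            (\<lambda>s. dexp (?search s) (goal tot))
            = dexp ?q (\<lambda>u. dexp (exec F w decide (conf W (\<rho>3 col t u) (G2 t u) ou (k2 + M + 3 + clock u)))
                (\<lambda>s. dexp (?search s) (goal tot)))"
            by (simp only: dexp_bind)
          \<comment> \<open>The charge \<open>Y\<close> for the children falls due exactly on a no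
            at an inner node; its expectation is \<open>fail v\<close> times
            \<open>Y\<close>.\<close>
          also have "\<dots> \<le> dexp ?q (\<lambda>u. B + indicator {u. no u} u * (if v < N then Y else 0))"
          proof (rule dexp_mono)
            fix u assume u: "u \<in> set_spmf ?q"
            define k3 where "k3 = k2 + M + 3 + clock u"
            have k3: "k3 + 4 \<le> k + A"
              using q(2)[OF u] yes(2) by (simp add: k3_def k2_def A_def node_time_def)
            have r3: "\<rho>3 col t u 16 = regs u 0" "\<rho>3 col t u 14 = Num col" "\<rho>3 col t u 3 = Num N"
              "\<rho>3 col t u 9 = Num v" "\<rho>3 col t u 13 = Num (length st')" "\<rho>3 col t u 2 = Num W" "\<rho>3 col t u 0 = Range r"
              using M3 v by (simp_all add: \<rho>3_def \<rho>2_def \<rho>1_def)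
            show "dexp (exec F w decide (conf W (\<rho>3 col t u) (G2 t u) ou k3))
                (\<lambda>s. dexp (?search s) (goal tot))
              \<le> B + indicator {u. no u} u * (if v < N then Y else 0)"
            proof (cases "yes u \<or> N \<le> v")
              case True
              \<comment> \<open>At a leaf there is at most one color, and elsewhere a yes is never
                wrong; in both cases the color found is the whole answer.\<close>
              have "answer v = {#Num col#}"
              proof (cases "N \<le> v")
                case True
                then show ?thesis using col(1) cols_leaf[OF True] by (intro answer_single) auto
              next
                case False
                then have "yes u" "\<not> no u" using True by (auto simp: yes_def no_def)
                then have "card (cols v) = 1" using q(2)[OF u] by auto
                then show ?thesis using col(1) by (auto simp: card_1_singleton_iff answer_def)
              qed
              then have "dexp (?search (conf W (\<rho>3 col t u) (G2 t u) (ou @ [Num col]) (k3 + 2))) (goal tot) \<le> B"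
                using less.prems(2) k3 r3 by (intro pop) (simp_all add: Cons G2_def)
              moreover have "exec F w decide (conf W (\<rho>3 col t u) (G2 t u) ou k3)
                = return_spmf (conf W (\<rho>3 col t u) (G2 t u) (ou @ [Num col]) (k3 + 2))"
                using True r3 colw unfolding decide_def
                by (auto simp: conf_Cond conf_Report yes_def)
              ultimately show ?thesis by (simp add: add_increasing2)
            next
              case small: False
              then have no: "regs u 0 = Num 0" "no u" "v < N" using q(2)[OF u] by (auto simp: no_def)
              define G3 where "G3 = (G2 t u)(1 := (G2 t u 1)(length st' := Num (2 * v), length st' + 1 := Num (2 * v + 1)))"
              define \<rho>4 where "\<rho>4 = (\<rho>3 col t u)(13 := Num (length st' + 2))"
              have "exec F w decide (conf W (\<rho>3 col t u) (G2 t u) ou k3) = return_spmf (conf W \<rho>4 G3 ou (k3 + 4))"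
                unfolding decide_def push_def using no r3 w X bounds(1)
                by (simp add: conf_Cond exec_Seq conf_Store[where X = "4 * N + 4"] conf_Assign G3_def \<rho>4_def,
                    (simp add: eval_nat_numeral)?)
              moreover have "dexp (?search (conf W \<rho>4 G3 ou (k3 + 4))) (goal tot)
                \<le> of_nat (k3 + 4) + 1 + of_nat node_time * (\<Sum>v\<leftarrow>(2 * v + 1) # (2 * v) # st'. cost N fail v)"
              proof (rule less.hyps)
                show "length (pending ((2 * v + 1) # (2 * v) # st')) < length (pending st)"
                  using subtree_inner[OF v(1) no(3)] by (simp add: Cons pending_Cons)
                show "inv ((2 * v + 1) # (2 * v) # st') \<rho>4 G3"
                  using inv no(3) r3 v(1) unfolding Cons
                  by (rule_tac inv_push) (simp_all add: \<rho>4_def G3_def G2_def)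
                show "mset ou + (\<Sum>v\<leftarrow>(2 * v + 1) # (2 * v) # st'. answer v) = tot"
                  using less.prems(2) answer_children[OF v(1) no(3)] by (simp add: Cons add_ac)
              qed
              moreover have "\<dots> \<le> B + Y"
              proof -
                have "of_nat (k3 + 4) + 1 + of_nat A * (\<Sum>v\<leftarrow>(2 * v + 1) # (2 * v) # st'. cost N fail v)
                    = of_nat (k3 + 4) + 1 + of_nat A * S + Y"
                  by (simp only: Y_def S_def list.map sum_list.Cons distrib_left) (simp only: add_ac)
                also have "\<dots> \<le> B + Y"
                  unfolding B_def using k3 by (intro add_right_mono of_nat_mono)
                finally show ?thesis by (simp only: A_def)
              qed
              ultimately show ?thesis using no by (auto intro: order_trans)
            qed
          qed
          also have "\<dots> = B + emeasure (measure_spmf ?q) {u. no u} * (if v < N then Y else 0)"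
            by (rule dexp_indicator[OF q(1)])
          also have "emeasure (measure_spmf ?q) {u. no u} = fail v"
            using ne v by (simp add: miss_def cols_def)
          finally show ?thesis by (simp split: if_splits)
        qed
      qed
      finally show ?thesis unfolding Y_def .
    qed
    also have "\<dots> = of_nat k + 1 + of_nat A * (cost N fail v + S)"
      unfolding B_def by (subst cost.simps) (simp add: v(1) algebra_simps)
    finally show ?thesis by (simp add: Cons S_def A_def)
  qed
qed

lemma cols_root: "cols 1 = colors_in xs r"
proof -
  have "reaches (T col) 1" if "col \<in> colors_in xs r" for col
    using that leaf N_bounds by (intro reaches_root) (force simp: colors_in_def)
  then show ?thesis by (auto simp: cols_eq)
qed

text \<open>The 5 consists of four setup commands and the guard that ends the loop.\<close>

lemma exec_query_all:
  assumes "mem s = flat W G0" "G0 0 0 = Num W" "G0 0 1 = Num N"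
  shows "dexp (query F (c + 6) (query_all M q0 q1) xs r s) (goal (mset_set (Num ` colors_in xs r)))
    \<le> 5 + of_nat node_time * cost N fail 1"
proof -
  define \<rho> :: "nat \<Rightarrow> ('p, 'o) val" where "\<rho> = (\<lambda>_. Num 0)(0 := Range r)"
  define \<rho>1 where "\<rho>1 = \<rho>(2 := Num W, 3 := Num N, 13 := Num 1)"
  define G1 where "G1 = G0(1 := (G0 1)(0 := Num 1))"
  have "1 < W" "W < w" "0 < 4 * N + 4" "1 < w" "N < w" using bounds N_bounds by linarith+
  then have "query F (c + 6) (query_all M q0 q1) xs r s = exec F w (search M q0 q1) (conf W \<rho>1 G1 [] 4)"
    unfolding query_def query_all_def word_bound_eq assms(1) conf_def[symmetric] \<rho>_def[symmetric]
    using assms bounds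
    by (simp add: exec_Seq conf_Load_low conf_Store[where X = "4 * N + 4"] conf_Assign G1_def \<rho>1_def numeral_eq_Suc)
  moreover have "dexp (exec F w (search M q0 q1) (conf W \<rho>1 G1 [] 4)) (goal (mset_set (Num ` colors_in xs r)))
    \<le> of_nat 4 + 1 + of_nat node_time * (\<Sum>v\<leftarrow>[1]. cost N fail v)"
  proof (rule exec_search)
    show "inv [1] \<rho>1 G1"
      using N_bounds distinct_subtree[of 1 N]
      by (auto simp: inv_def \<rho>1_def \<rho>_def G1_def pending_Cons)
    show "mset [] + (\<Sum>v\<leftarrow>[1]. answer v) = mset_set (Num ` colors_in xs r)"
      using cols_root by (simp add: answer_def)
  qed
  ultimately show ?thesis by simp
qed

end

section \<open>Space and time bounds\<close>

text \<open>Double counting of the incidences between nodes and points.\<close>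

lemma sum_length_filter:
  "finite U \<Longrightarrow> (\<Sum>u\<in>U. length (filter (R u) xs)) = (\<Sum>x\<leftarrow>xs. card {u \<in> U. R u x})"
proof (induction xs)
  case (Cons x xs)
  have "(\<Sum>u\<in>U. length (filter (R u) (x # xs))) = (\<Sum>u\<in>U. (if R u x then 1 else 0) + length (filter (R u) xs))"
    by (intro sum.cong) auto
  also have "\<dots> = card {u \<in> U. R u x} + (\<Sum>u\<in>U. length (filter (R u) xs))"
    using Cons.prems by (simp add: sum.distrib sum.If_cases Int_def)
  finally show ?case using Cons by simp
qed simp

lemma sum_pairs:
  fixes f :: "nat \<Rightarrow> nat"
  shows "(\<Sum>x<2 * k + 2. f x) = f 0 + f 1 + (\<Sum>u<k. f (2 * u + 2) + f (2 * u + 3))"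
proof (induction k)
  case (Suc k)
  have "sum f {..<2 * Suc k + 2} = sum f {..<2 * k + 2} + f (2 * k + 2) + f (2 * k + 3)"
  proof -
    have "2 * Suc k + 2 = Suc (Suc (2 * k + 2))" "2 * k + 3 = Suc (2 * k + 2)" by simp_all
    then show ?thesis by (simp only: sum.lessThan_Suc)
  qed
  then show ?case using Suc by (simp only: sum.lessThan_Suc add.assoc)
qed (simp add: eval_nat_numeral)

lemma nonblank_input_subset: "{a. input_mem l a \<noteq> Num 0} \<subseteq> {..2 * length l}"
  by (auto simp: input_mem_def Let_def split: if_splits)

lemma finite_nonblank:
  assumes "s \<in> set_spmf (preprocess F c build l)"
  shows "finite {a. mem s a \<noteq> Num 0}"
proof -
  have "finite {a. mem s a \<noteq> input_mem l a}"
    using exec_support[THEN spec, THEN spec, THEN spec, THEN bspec, OF assms[unfolded preprocess_def]]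
    by simp
  moreover have "finite {a. input_mem l a \<noteq> (Num 0 :: ('a, 'b) val)}"
    using finite_subset[OF nonblank_input_subset] by blast
  ultimately show ?thesis
    by (rule finite_subset[rotated, OF finite_UnI]) auto
qed

section \<open>Total size of the node structures and space of the final memory\<close>

context tree_ds
begin

definition nodes :: "(nat \<Rightarrow> nat) \<Rightarrow> nat set" where
  "nodes T = {u. 0 < u \<and> u < 2 * N \<and> sub T u \<noteq> []}"

lemma finite_nodes: "finite (nodes T)"
  by (rule finite_subset[of _ "{..<2 * N}"]) (auto simp: nodes_def)

lemma leaf_tableD:
  assumes "leaf_table T" "x \<in> set xs"
  shows "N \<le> T (snd x)" "T (snd x) < 2 * N"
proof -
  have "T ` snd ` set xs \<subseteq> {N..<2 * N}" using assms(1) by (simp add: leaf_table_def)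
  moreover have "T (snd x) \<in> T ` snd ` set xs" using assms(2) by (intro imageI)
  ultimately have "T (snd x) \<in> {N..<2 * N}" by (rule subsetD)
  then show "N \<le> T (snd x)" "T (snd x) < 2 * N" by auto
qed

lemma sum_sub_le:
  assumes "leaf_table T"
  shows "(\<Sum>u\<in>nodes T. length (sub T u)) \<le> (depth n + 1) * n"
proof -
  have "(\<Sum>u\<in>nodes T. length (sub T u)) = (\<Sum>x\<leftarrow>xs. card {u \<in> nodes T. reaches (T (snd x)) u})"
    unfolding sub_def by (rule sum_length_filter[OF finite_nodes])
  also have "\<dots> \<le> (\<Sum>x\<leftarrow>xs. depth n + 1)"
  proof (rule sum_list_mono)
    fix x assume "x \<in> set xs"
    then have l: "T (snd x) < 2 * 2 ^ depth n" using leaf_tableD(2)[OF assms] by (simp add: N_def)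
    have "card {u \<in> nodes T. reaches (T (snd x)) u} \<le> card {u. 0 < u \<and> reaches (T (snd x)) u}"
    proof (rule card_mono)
      show "finite {u. 0 < u \<and> reaches (T (snd x)) u}"
        by (rule finite_subset[of _ "{..T (snd x)}"]) (auto dest: reaches_le)
    qed (auto simp: nodes_def)
    also have "\<dots> \<le> depth n + 1" by (rule card_reached[OF l])
    finally show "card {u \<in> nodes T. reaches (T (snd x)) u} \<le> depth n + 1" .
  qed
  also have "\<dots> = (depth n + 1) * n" by (simp add: n_def sum_list_triv)
  finally show ?thesis .
qed

text \<open>Monotonicity of \<open>f m / m\<close> gives \<open>f m \<le> m * f n / n\<close>. It
  therefore suffices to bound the number of point copies, which is done for all levels at
  once.\<close>

lemma superadditive_sum_le:
  assumes "leaf_table T" "mono_on {1..} (\<lambda>m. f m / real m)" "0 \<le> f n"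
  shows "(\<Sum>u\<in>nodes T. f (length (sub T u))) \<le> real (depth n + 1) * f n"
proof -
  have "(\<Sum>u\<in>nodes T. f (length (sub T u))) \<le> (\<Sum>u\<in>nodes T. real (length (sub T u)) * (f n / n))"
  proof (rule sum_mono)
    fix u assume "u \<in> nodes T"
    then have u: "sub T u \<noteq> []" by (simp add: nodes_def)
    then have len: "1 \<le> length (sub T u)" "length (sub T u) \<le> n"
      using sub_valid(3)[OF u] by (auto simp: Suc_le_eq)
    then have "f (length (sub T u)) / length (sub T u) \<le> f n / n"
      using n_pos by (intro mono_onD[OF assms(2)]) auto
    then show "f (length (sub T u)) \<le> real (length (sub T u)) * (f n / n)"
      using len(1) u by (simp add: divide_le_eq mult.commute)
  qed
  also have "\<dots> = real (\<Sum>u\<in>nodes T. length (sub T u)) * (f n / n)"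
    by (simp only: of_nat_sum sum_distrib_right)
  also have "\<dots> \<le> real ((depth n + 1) * n) * (f n / n)"
    using assms(3) by (intro mult_right_mono of_nat_mono sum_sub_le assms(1)) simp
  also have "\<dots> = real (depth n + 1) * f n" using n_pos by (simp only: of_nat_mult) simp
  finally show ?thesis .
qed

lemma sub_empty:
  assumes "leaf_table T" "2 * N \<le> u"
  shows "sub T u = []"
proof -
  have "\<not> reaches (T (snd x)) u" if "x \<in> set xs" for x
    using leaf_tableD(2)[OF assms(1) that] assms(2) reaches_le[of "T (snd x)" u] by auto
  then show ?thesis by (simp add: sub_def)
qed

text \<open>Blocks 0 to 3 hold at most \<open>2 * n + 2\<close>, \<open>n\<close>, \<open>N\<close>
  and \<open>2 * N\<close> nonblank cells, which \<open>N < 4 * n\<close> turns into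
  \<open>18 * n\<close>. The two blocks of a node are possible outcomes of its build, hence bounded
  by \<open>S\<close>.\<close>

lemma space_le:
  fixes S :: "nat \<Rightarrow> real"
  assumes T: "leaf_table T" and G: "ready T G" "mem s = flat W (with_header G)"
    and S: "\<And>l t. valid_input l \<Longrightarrow> t \<in> set_spmf (preprocess F c build l) \<Longrightarrow> real (space (mem t)) \<le> S (length l)"
  shows "real (space (mem s)) \<le> 18 * real n + 2 * (\<Sum>u\<in>nodes T. S (length (sub T u)))"
proof -
  obtain G0 where D: "distributed T G0" and B: "built F c build (sub T) G0 (2 * N) G"
    using G(1) by (auto simp: ready_def)
  define Z where "Z x = {y. y < W \<and> with_header G x y \<noteq> Num 0}" for x
  have finZ: "finite (Z x)" for x by (rule finite_subset[of _ "{..<W}"]) (auto simp: Z_def)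
  have blank: "input_mem [] = (\<lambda>_. Num 0 :: ('p, 'o) val)"
    by (auto simp: input_mem_def fun_eq_iff)
  have copies0: "G0 (2 * u + 2) = input_mem (sub T u)" "G0 (2 * u + 3) = input_mem (sub T u)" if "0 < u" for u
    using D that by (auto simp: distributed_def stores_def)
  \<comment> \<open>These blocks belong to numbers from \<open>2 * N\<close> on, which are no nodes;
    only finitely many blocks remain to be counted.\<close>
  have high: "with_header G x y = Num 0" if "4 * N + 2 \<le> x" for x y
  proof -
    define u where "u = (x - 2) div 2"
    have u: "2 * N \<le> u" "x = 2 * u + 2 \<or> x = 2 * u + 3" using that unfolding u_def by presburger+
    then have "G0 x = (\<lambda>_. Num 0)" using copies0[of u] sub_empty[OF T u(1)] N_bounds blank by auto
    moreover have "G x = G0 x" using B that by (simp add: built_def)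
    ultimately show ?thesis using that by (simp add: with_header_def)
  qed
  have low: "G x = G0 x" if "x < 4" for x using B that by (simp add: built_def)
  have "{a. mem s a \<noteq> Num 0} \<subseteq> (\<Union>x\<in>{..<2 * (2 * N) + 2}. addr W x ` Z x)"
  proof
    fix a assume "a \<in> {a. mem s a \<noteq> Num 0}"
    then have a: "with_header G (a div W) (a mod W) \<noteq> Num 0" by (simp add: G(2) flat_def)
    then have "a div W < 2 * (2 * N) + 2" using high[of "a div W"] by force
    moreover have "a mod W \<in> Z (a div W)" using a W_ge by (simp add: Z_def)
    moreover have "a = addr W (a div W) (a mod W)" by (simp only: addr_def div_mult_mod_eq)
    ultimately show "a \<in> (\<Union>x\<in>{..<2 * (2 * N) + 2}. addr W x ` Z x)" by blast
  qed
  then have "space (mem s) \<le> card (\<Union>x\<in>{..<2 * (2 * N) + 2}. addr W x ` Z x)"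
    unfolding space_def using finZ by (intro card_mono) auto
  also have "\<dots> \<le> (\<Sum>x<2 * (2 * N) + 2. card (addr W x ` Z x))" by (rule card_UN_le) simp
  also have "\<dots> \<le> (\<Sum>x<2 * (2 * N) + 2. card (Z x))" by (intro sum_mono card_image_le finZ)
  also have "\<dots> = card (Z 0) + card (Z 1) + (\<Sum>u<2 * N. card (Z (2 * u + 2)) + card (Z (2 * u + 3)))"
    by (rule sum_pairs)
  also have "(\<Sum>u<2 * N. card (Z (2 * u + 2)) + card (Z (2 * u + 3)))
      = card (Z 2) + card (Z 3) + (\<Sum>u\<in>{0<..<2 * N}. card (Z (2 * u + 2)) + card (Z (2 * u + 3)))"
  proof -
    have "{..<2 * N} = insert 0 {0<..<2 * N}" using N_bounds by auto
    then show ?thesis by (simp del: add_2_eq_Suc add_2_eq_Suc')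
  qed
  finally have "real (space (mem s)) \<le> real (card (Z 0) + card (Z 1) + (card (Z 2) + card (Z 3)
      + (\<Sum>u\<in>{0<..<2 * N}. card (Z (2 * u + 2)) + card (Z (2 * u + 3)))))"
    by (rule of_nat_mono)
  then have total: "real (space (mem s)) \<le> real (card (Z 0)) + real (card (Z 1)) + (real (card (Z 2)) + real (card (Z 3))
      + (\<Sum>u\<in>{0<..<2 * N}. real (card (Z (2 * u + 2))) + real (card (Z (2 * u + 3)))))"
    by (simp only: of_nat_add of_nat_sum)
  have Z0: "card (Z 0) \<le> 2 * n + 2"
  proof -
    have "Z 0 \<subseteq> {..2 * n + 1}"
      using nonblank_input_subset[of xs] D low[of 0]
      by (auto simp: Z_def with_header_def distributed_def n_def split: if_splits)
    then show ?thesis using card_mono[of "{..2 * n + 1}" "Z 0"] by simp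
  qed
  have Z1: "card (Z 1) \<le> n"
  proof -
    have "Z 1 \<subseteq> snd ` set xs"
      using T D low[of 1] by (auto simp: Z_def with_header_def distributed_def leaf_table_def)
    then have "card (Z 1) \<le> card (snd ` set xs)" by (intro card_mono) auto
    also have "\<dots> \<le> n" unfolding n_def using card_image_le[of "set xs" snd] card_length[of xs] by simp
    finally show ?thesis .
  qed
  have Z2: "card (Z 2) \<le> N"
  proof -
    have "Z 2 \<subseteq> {..<N}"
      using D low[of 2] by (auto simp: Z_def with_header_def distributed_def) (metis not_le_imp_less)
    then show ?thesis using card_mono[of "{..<N}" "Z 2"] by simp
  qed
  have Z3: "card (Z 3) \<le> 2 * N"
  proof -
    have "y < 2 * N" if "G 3 y \<noteq> Num 0" for y
    proof (rule ccontr)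
      assume "\<not> y < 2 * N"
      then have "sub T y = []" "0 < y" using sub_empty[OF T] N_bounds by auto
      then show False using that D low[of 3] by (simp add: distributed_def stores_def)
    qed
    then have "Z 3 \<subseteq> {..<2 * N}" by (auto simp: Z_def with_header_def)
    then show ?thesis using card_mono[of "{..<2 * N}" "Z 3"] by simp
  qed
  have node: "real (card (Z (2 * u + d))) \<le> (if sub T u = [] then 0 else S (length (sub T u)))"
    if u: "0 < u" "u < 2 * N" and d: "d = 2 \<or> d = 3" for u d
  proof (cases "sub T u = []")
    case True
    then have "G (2 * u + d) = (\<lambda>_. Num 0)"
      using B u d copies0[OF u(1)] blank by (auto simp: built_def simp del: add_2_eq_Suc add_2_eq_Suc')
    then show ?thesis using True u d by (auto simp: Z_def with_header_def)
  next
    case False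
    then have "G (2 * u + d) \<in> mem ` set_spmf (preprocess F c build (sub T u))"
      using B u d by (auto simp: built_def simp del: add_2_eq_Suc add_2_eq_Suc')
    then obtain t where t: "t \<in> set_spmf (preprocess F c build (sub T u))" "G (2 * u + d) = mem t" by auto
    have "Z (2 * u + d) \<subseteq> {a. mem t a \<noteq> Num 0}"
      using t(2) u by (auto simp: Z_def with_header_def split: if_splits)
    then have "card (Z (2 * u + d)) \<le> space (mem t)"
      unfolding space_def by (intro card_mono finite_nonblank[OF t(1)])
    then show ?thesis using S[OF sub_valid(1)[OF False] t(1)] False by simp
  qed
  have "(\<Sum>u\<in>{0<..<2 * N}. real (card (Z (2 * u + 2))) + real (card (Z (2 * u + 3))))
      \<le> (\<Sum>u\<in>{0<..<2 * N}. if sub T u = [] then 0 else 2 * S (length (sub T u)))"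
  proof (rule sum_mono)
    fix u assume "u \<in> {0<..<2 * N}"
    then show "real (card (Z (2 * u + 2))) + real (card (Z (2 * u + 3)))
        \<le> (if sub T u = [] then 0 else 2 * S (length (sub T u)))"
      using node[of u 2] node[of u 3] by auto
  qed
  also have "\<dots> = (\<Sum>u\<in>nodes T. 2 * S (length (sub T u)))"
    by (rule sum.mono_neutral_cong_right) (auto simp: nodes_def)
  finally have "(\<Sum>u\<in>{0<..<2 * N}. real (card (Z (2 * u + 2))) + real (card (Z (2 * u + 3))))
      \<le> 2 * (\<Sum>u\<in>nodes T. S (length (sub T u)))"
    by (simp add: sum_distrib_left)
  moreover have "real (card (Z 0)) + real (card (Z 1)) + real (card (Z 2)) + real (card (Z 3)) \<le> 18 * real n"
    using Z0 Z1 Z2 Z3 N_bounds n_pos by linarith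
  ultimately show ?thesis using total by linarith
qed

end

lemma average_ennreal:
  assumes "0 < m" "\<And>j. j < m \<Longrightarrow> 0 \<le> f j"
  shows "(\<Sum>j<m. ennreal (f j)) / of_nat m = ennreal ((\<Sum>j<m. f j) / real m)"
proof -
  have "(\<Sum>j<m. ennreal (f j)) = ennreal (\<Sum>j<m. f j)" using assms(2) by (intro sum_ennreal) auto
  moreover have "0 \<le> (\<Sum>j<m. f j)" using assms(2) by (intro sum_nonneg) auto
  ultimately show ?thesis
    using assms(1) by (simp add: ennreal_of_nat_eq_real_of_nat divide_ennreal)
qed

lemma emeasure_lossless: "lossless_spmf p \<Longrightarrow> emeasure (measure_spmf p) (Sigma_Algebra.space (measure_spmf p)) = 1"
  by (simp add: measure_spmf.emeasure_eq_measure lossless_weight_spmfD flip: weight_spmf_def)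

lemma dexp_const: "lossless_spmf p \<Longrightarrow> dexp p (\<lambda>_. B) = B"
  by (simp add: dexp_lossless emeasure_lossless)

lemma dexp_clock:
  assumes "lossless_spmf p"
  shows "dexp p (\<lambda>t. B + of_nat (clock t)) = B + expected_time p"
  using assms
  by (simp add: dexp_lossless nn_integral_add emeasure_lossless expected_time_def ennreal_of_nat_eq_real_of_nat)

section \<open>Expected time of the preprocessing and of a query\<close>

context tree_ds
begin

text \<open>The 3 is the last guard and the header, \<open>2 * M + 13\<close> covers the overhead of
  a node with or without points, and the factor 2 stands for the two copies.\<close>

definition time_bound :: "(nat \<Rightarrow> real) \<Rightarrow> real" where
  "time_bound P = 75 * real n * real (depth n + 1) + 3 + real (2 * N) * real (2 * M + 13) + 2 * (real (depth n + 1) * P n)"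

text \<open>The estimate holds for every leaf table, so \<open>\<Psi>\<close> is constant. The value
  \<open>top\<close> outside \<open>good\<close> makes the same estimate prove \<open>good\<close>
  for all outcomes.\<close>

lemma preprocessing_time:
  fixes P :: "nat \<Rightarrow> real" and good :: "('p, 'o) state \<Rightarrow> bool"
  assumes P: "\<And>l. valid_input l \<Longrightarrow> expected_time (preprocess F c build l) \<le> ennreal (P (length l))"
    and mono: "mono_on {1..} (\<lambda>m. P m / real m)" and pos: "\<And>m. 1 \<le> m \<Longrightarrow> 0 \<le> P m"
    and good: "\<And>T G \<rho> k. leaf_table T \<Longrightarrow> ready T G \<Longrightarrow> good (conf W \<rho> (with_header G) [] k)"
  shows "dexp (preprocess F (c + 6) (build_all c M build) xs) (\<lambda>t. if good t then of_nat (clock t) else top)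
    \<le> ennreal (time_bound P)"
proof -
  define \<tau> where "\<tau> T u = (if sub T u = [] then 5 else of_nat (2 * M + 8) + 2 * ennreal (P (length (sub T u))))" for T u
  define \<Phi> where "\<Phi> T v G k = of_nat k + 3 + (\<Sum>u\<in>{v..<2 * N}. \<tau> T u)"
    for T v and G :: "nat \<Rightarrow> nat \<Rightarrow> ('p, 'o) val" and k :: nat
  have nonneg: "0 \<le> time_bound P" using pos[of n] n_pos by (simp add: time_bound_def)
  have split: "(\<Sum>u\<in>{v..<2 * N}. \<tau> T u) = \<tau> T v + (\<Sum>u\<in>{v + 1..<2 * N}. \<tau> T u)" if "v < 2 * N" for T v
    using sum.atLeast_Suc_lessThan[OF that, of "\<tau> T"] by (simp only: Suc_eq_plus1)
  show ?thesis
  proof (rule exec_build_all[where \<Phi> = \<Phi> and \<Psi> = "\<lambda>_. ennreal (time_bound P)"])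
    show "(\<Sum>j<m. ennreal (time_bound P)) / of_nat m \<le> ennreal (time_bound P)" if "0 < m" for m
      using that nonneg average_ennreal[of m "\<lambda>_. time_bound P"] by simp
  next
    fix T v G k assume v: "0 < v" "v < 2 * N" "sub T v \<noteq> []"
    let ?p = "preprocess F c build (sub T v)"
    define R where "R = (\<Sum>u\<in>{v + 1..<2 * N}. \<tau> T u)"
    have p: "lossless_spmf ?p" using v(3) by (intro lossless sub_valid)
    have "dexp ?p (\<lambda>a. dexp ?p (\<lambda>b. of_nat (k + 2 * M + 8 + clock a + clock b) + 3 + R))
      = dexp ?p (\<lambda>a. dexp ?p (\<lambda>b. (of_nat (k + 2 * M + 8) + 3 + R + of_nat (clock a)) + of_nat (clock b)))"
      by (simp only: of_nat_add add_ac)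
    also have "\<dots> = dexp ?p (\<lambda>a. (of_nat (k + 2 * M + 8) + 3 + R + expected_time ?p) + of_nat (clock a))"
    proof -
      have "dexp ?p (\<lambda>a. dexp ?p (\<lambda>b. (of_nat (k + 2 * M + 8) + 3 + R + of_nat (clock a)) + of_nat (clock b)))
        = dexp ?p (\<lambda>a. of_nat (k + 2 * M + 8) + 3 + R + of_nat (clock a) + expected_time ?p)"
        by (simp only: dexp_clock[OF p])
      also have "\<dots> = dexp ?p (\<lambda>a. (of_nat (k + 2 * M + 8) + 3 + R + expected_time ?p) + of_nat (clock a))"
        by (simp only: add_ac)
      finally show ?thesis .
    qed
    also have "\<dots> = of_nat (k + 2 * M + 8) + 3 + R + expected_time ?p + expected_time ?p"
      by (simp only: dexp_clock[OF p])
    also have "\<dots> \<le> of_nat (k + 2 * M + 8) + 3 + R + ennreal (P (length (sub T v))) + ennreal (P (length (sub T v)))"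
      using P[OF sub_valid(1)[OF v(3)]] by (intro add_mono) auto
    also have "\<dots> = \<Phi> T v G k"
    proof -
      have "\<tau> T v = of_nat (2 * M + 8) + (ennreal (P (length (sub T v))) + ennreal (P (length (sub T v))))"
        using v(3) by (simp only: \<tau>_def if_False mult_2[of "ennreal (P (length (sub T v)))"])
      moreover have "(of_nat (k + 2 * M + 8) :: ennreal) = of_nat k + of_nat (2 * M + 8)"
        by (simp only: of_nat_add add.assoc)
      ultimately show ?thesis
        unfolding \<Phi>_def split[OF v(2)] R_def[symmetric] by (simp only: add_ac)
    qed
    finally show "dexp ?p (\<lambda>a. dexp ?p (\<lambda>b. \<Phi> T (v + 1) (G(2 * v + 2 := mem a, 2 * v + 3 := mem b))
        (k + 2 * M + 8 + clock a + clock b))) \<le> \<Phi> T v G k"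
      unfolding \<Phi>_def R_def .
  next
    fix T v G k assume v: "0 < v" "v < 2 * N" "sub T v = []"
    have "(of_nat (k + 5) :: ennreal) = of_nat k + 5" by simp
    then have "\<Phi> T (v + 1) G (k + 5) = \<Phi> T v G k"
      unfolding \<Phi>_def split[OF v(2)] \<tau>_def using v(3) by (simp only: if_True simp_thms add_ac)
    then show "\<Phi> T (v + 1) G (k + 5) \<le> \<Phi> T v G k" by simp
  next
    fix T G k assume T: "leaf_table T" and k: "k \<le> 75 * n * (depth n + 1)"
    have "(\<Sum>u\<in>{1..<2 * N}. \<tau> T u) \<le> (\<Sum>u\<in>{1..<2 * N}. of_nat (2 * M + 13) +
        (if sub T u = [] then 0 else 2 * ennreal (P (length (sub T u)))))"
    proof (rule sum_mono)
      fix u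
      have "(5 :: ennreal) = of_nat 5" by simp
      also have "\<dots> \<le> of_nat (2 * M + 13)" by (rule of_nat_mono) simp
      finally have "(5 :: ennreal) \<le> of_nat (2 * M + 13)" .
      moreover have "(of_nat (2 * M + 8) :: ennreal) \<le> of_nat (2 * M + 13)" by (rule of_nat_mono) simp
      ultimately show "\<tau> T u \<le> of_nat (2 * M + 13) + (if sub T u = [] then 0 else 2 * ennreal (P (length (sub T u))))"
        unfolding \<tau>_def by (cases "sub T u = []") (simp_all only: if_True if_False simp_thms add_0_right add_right_mono)
    qed
    also have "\<dots> = of_nat (2 * N - 1) * of_nat (2 * M + 13)
        + (\<Sum>u\<in>{1..<2 * N}. if sub T u = [] then 0 else 2 * ennreal (P (length (sub T u))))"
      by (simp only: sum.distrib sum_constant card_atLeastLessThan)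
    also have "(\<Sum>u\<in>{1..<2 * N}. if sub T u = [] then 0 else 2 * ennreal (P (length (sub T u))))
      = (\<Sum>u\<in>nodes T. 2 * ennreal (P (length (sub T u))))"
      by (rule sum.mono_neutral_cong_right) (auto simp: nodes_def)
    also have "\<dots> = (\<Sum>u\<in>nodes T. ennreal (2 * P (length (sub T u))))"
      by (intro sum.cong refl) (simp add: ennreal_mult' pos nodes_def Suc_le_eq)
    also have "\<dots> = ennreal (\<Sum>u\<in>nodes T. 2 * P (length (sub T u)))"
      by (intro sum_ennreal) (simp add: pos nodes_def Suc_le_eq)
    also have "(\<Sum>u\<in>nodes T. 2 * P (length (sub T u))) = 2 * (\<Sum>u\<in>nodes T. P (length (sub T u)))"
      by (simp only: sum_distrib_left)
    also have "of_nat (2 * N - 1) * of_nat (2 * M + 13) + ennreal (2 * (\<Sum>u\<in>nodes T. P (length (sub T u))))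
      \<le> ennreal (real (2 * N) * real (2 * M + 13)) + ennreal (2 * (real (depth n + 1) * P n))"
    proof (rule add_mono)
      have "(of_nat (2 * N - 1) * of_nat (2 * M + 13) :: ennreal) \<le> of_nat (2 * N * (2 * M + 13))"
        unfolding of_nat_mult[symmetric] by (intro of_nat_mono mult_le_mono1) simp
      also have "\<dots> = ennreal (real (2 * N) * real (2 * M + 13))"
        by (simp only: ennreal_of_nat_eq_real_of_nat of_nat_mult)
      finally show "(of_nat (2 * N - 1) * of_nat (2 * M + 13) :: ennreal) \<le> ennreal (real (2 * N) * real (2 * M + 13))" .
      show "ennreal (2 * (\<Sum>u\<in>nodes T. P (length (sub T u)))) \<le> ennreal (2 * (real (depth n + 1) * P n))"
        using superadditive_sum_le[OF T mono] pos[of n] n_pos by (intro ennreal_leI) simp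
    qed
    finally have sum: "(\<Sum>u\<in>{1..<2 * N}. \<tau> T u)
        \<le> ennreal (real (2 * N) * real (2 * M + 13)) + ennreal (2 * (real (depth n + 1) * P n))" .
    have "(of_nat k :: ennreal) + 3 \<le> of_nat (75 * n * (depth n + 1)) + 3"
      using k by (intro add_right_mono of_nat_mono)
    also have "\<dots> = of_nat (75 * n * (depth n + 1) + 3)" by simp
    also have "\<dots> = ennreal (75 * real n * real (depth n + 1) + 3)"
      by (simp only: ennreal_of_nat_eq_real_of_nat of_nat_add of_nat_mult of_nat_numeral)
    finally have "\<Phi> T 1 G k \<le> ennreal (75 * real n * real (depth n + 1) + 3)
        + (ennreal (real (2 * N) * real (2 * M + 13)) + ennreal (2 * (real (depth n + 1) * P n)))"
      unfolding \<Phi>_def using sum by (intro add_mono)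
    also have "\<dots> = ennreal (time_bound P)"
    proof -
      have "ennreal x + (ennreal y + ennreal z) = ennreal (x + y + z)" if "0 \<le> x" "0 \<le> y" "0 \<le> z" for x y z
        using that by (simp add: add.assoc)
      then show ?thesis unfolding time_bound_def using pos[of n] n_pos by simp
    qed
    finally show "\<Phi> T 1 G k \<le> ennreal (time_bound P)" .
  next
    fix \<rho> T G k assume "leaf_table T" "ready T G"
    then show "(if good (conf W \<rho> (with_header G) [] (k + 3)) then of_nat (clock (conf W \<rho> (with_header G) [] (k + 3))) else top)
        \<le> \<Phi> T (2 * N) G k"
      using good by (simp add: \<Phi>_def add_ac)
  qed
qed

lemma miss_le_1: "miss q1 r T G u \<le> 1"
  unfolding miss_def
  by (simp add: measure_spmf.emeasure_eq_measure measure_spmf.subprob_measure_le_1)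

text \<open>Here \<open>\<Psi>\<close> bounds the visits by the expected collisions given the leaves
  drawn so far, and \<open>\<Phi>\<close> is the cost with actual failure probabilities at built
  nodes and a priori ones elsewhere. Being a prior, the latter may be 1 at crowded nodes, where
  failure is certain anyway.\<close>

lemma query_time:
  fixes \<delta> a b :: real and g :: "('p, 'o) state \<Rightarrow> ennreal" and J :: nat
  assumes \<delta>: "0 < \<delta>" "\<delta> \<le> 1" and ab: "0 \<le> a" "0 \<le> b"
    and miss: "\<And>l. valid_input l \<Longrightarrow> card (colors_in l r) = 1 \<Longrightarrow>
        (\<integral>\<^sup>+ s. emeasure (measure_spmf (query F c q1 l r s)) {t. no t} \<partial>measure_spmf (preprocess F c build l)) \<le> ennreal (1 - \<delta>)"
    and fin: "\<And>T G \<rho> k. leaf_table T \<Longrightarrow> ready T G \<Longrightarrow>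
        g (conf W \<rho> (with_header G) [] k) \<le> ennreal a + ennreal b * cost N (miss q1 r T G) 1"
  defines "K \<equiv> colors_in xs r"
  shows "dexp (preprocess F (c + 6) (build_all c M build) xs) g
    \<le> ennreal (a + b * (1 + 2 * (2 ^ J + 4 * (real (card K))\<^sup>2 / 2 ^ J) + 2 / \<delta> * real (card K)))"
proof -
  let ?L = "depth n"
  have K: "finite K" "K \<subseteq> snd ` set xs" by (auto simp: K_def colors_in_def)
  define bound where "bound T = a + b * (1 + 2 * (2 ^ J + collisions ?L J K T) + 2 / \<delta> * real (card K))" for T
  have coll: "0 \<le> collisions L J K T" for L T
    unfolding collisions_def by (intro sum_nonneg) (auto simp: collide_nonneg)
  have bound: "0 \<le> bound T" for T
    using coll[of ?L T] \<delta> ab by (simp add: bound_def)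
  \<comment> \<open>Until \<open>v\<close> is built, \<open>prior T v\<close> stands for the probability \<open>miss q1 r T G v\<close>, whose expectation it bounds.\<close>
  define prior where "prior T u = (let j = card (colors_in (sub T u) r) in
      if j = 0 then 0 else if j = 1 then ennreal (1 - \<delta>) else 1)" for T u
  define \<theta> where "\<theta> T v G u = (if 0 < u \<and> u < v then miss q1 r T G u else prior T u)" for T v G u
  define \<Phi> where "\<Phi> T v G k = ennreal a + ennreal b * cost N (\<theta> T v G) 1"
    for T v and G :: "nat \<Rightarrow> nat \<Rightarrow> ('p, 'o) val" and k :: nat
  have sub_cols: "colors_in (sub T u) r = {col \<in> K. reaches (T col) u}" for T u
    by (auto simp: K_def colors_in_def sub_def)
  have "dexp (preprocess F (c + 6) (build_all c M build) xs) g \<le> ennreal (bound (\<lambda>_. 0))"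
  proof (rule exec_build_all[where \<Phi> = \<Phi> and \<Psi> = "\<lambda>T. ennreal (bound T)"])
    fix m T A and e :: nat assume inv: "shuffle_inv N m T A" and m: "N \<le> 2 * m" "0 < m" and e: "T e = 0"
    have A: "inj_on A {..<m}" "A i \<noteq> 0" if "i < m" for i
      using inv that N_bounds by (auto simp: shuffle_inv_def)
    have avg: "(\<Sum>j<m. collisions ?L J K (T(e := A j))) / real m \<le> collisions ?L J K T"
      using A m e by (intro average_collisions_le) (auto simp: N_def)
    have "(\<Sum>j<m. bound (T(e := A j))) / real m
      = a + b * (1 + 2 * (2 ^ J + (\<Sum>j<m. collisions ?L J K (T(e := A j))) / real m) + 2 / \<delta> * real (card K))"
      using m(2) by (simp add: bound_def sum.distrib sum_distrib_left[symmetric] field_simps)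
    also have "\<dots> \<le> bound T"
      unfolding bound_def using avg ab by (intro add_left_mono mult_left_mono) auto
    finally show "(\<Sum>j<m. ennreal (bound (T(e := A j)))) / of_nat m \<le> ennreal (bound T)"
      using m(2) bound by (subst average_ennreal) (auto intro: ennreal_leI)
  next
    fix T v G k assume v: "0 < v" "v < 2 * N" "sub T v \<noteq> []"
    let ?p = "preprocess F c build (sub T v)"
    define \<phi> :: "('p, 'o) state \<Rightarrow> ennreal" where "\<phi> s = (if colors_in (sub T v) r = {} then 0
      else emeasure (measure_spmf (query F c q1 (sub T v) r s)) {t. no t})" for s
    have valid: "valid_input (sub T v)" by (rule sub_valid(1)[OF v(3)])
    then have p: "lossless_spmf ?p" by (rule lossless)
    \<comment> \<open>Building \<open>v\<close> replaces exactly one coordinate, and only the second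
      copy matters for it.\<close>
    have \<theta>_step: "\<theta> T (v + 1) (G(2 * v + 2 := mem s, 2 * v + 3 := mem s')) = (\<theta> T v G)(v := \<phi> s')" for s s' :: "('p, 'o) state"
    proof
      fix u
      show "\<theta> T (v + 1) (G(2 * v + 2 := mem s, 2 * v + 3 := mem s')) u = ((\<theta> T v G)(v := \<phi> s')) u"
      proof (cases "u = v")
        case True
        then show ?thesis using v query_state_of[of s' "mem s'" F c q1 "sub T v" r]
          by (simp add: \<theta>_def miss_def \<phi>_def)
      next
        case False
        then have "2 * u + 3 \<noteq> 2 * v + 2" "2 * u + 3 \<noteq> 2 * v + 3" by presburger+
        moreover have "miss q1 r T (G(2 * v + 2 := mem s, 2 * v + 3 := mem s')) u = miss q1 r T G u"
        proof -
          have "(G(2 * v + 2 := mem s, 2 * v + 3 := mem s')) (2 * u + 3) = G (2 * u + 3)"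
            using calculation by (simp del: add_2_eq_Suc add_2_eq_Suc')
          then show ?thesis unfolding miss_def by (simp only:)
        qed
        ultimately show ?thesis using False by (auto simp: \<theta>_def)
      qed
    qed
    \<comment> \<open>For one color this is the success guarantee of the one-color test; otherwise
      the trivial bounds 0 and 1 suffice.\<close>
    have "(\<integral>\<^sup>+ s. \<phi> s \<partial>measure_spmf ?p) \<le> prior T v"
    proof -
      have "\<phi> s \<le> 1" for s by (simp add: \<phi>_def measure_spmf.emeasure_eq_measure measure_spmf.subprob_measure_le_1)
      then have "(\<integral>\<^sup>+ s. \<phi> s \<partial>measure_spmf ?p) \<le> (\<integral>\<^sup>+ s. 1 \<partial>measure_spmf ?p)"
        by (intro nn_integral_mono)
      then have 1: "(\<integral>\<^sup>+ s. \<phi> s \<partial>measure_spmf ?p) \<le> 1" by (simp add: emeasure_lossless[OF p])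
      show ?thesis
      proof (cases "colors_in (sub T v) r = {}")
        case False
        then have "\<phi> = (\<lambda>s. emeasure (measure_spmf (query F c q1 (sub T v) r s)) {t. no t})"
          by (simp add: \<phi>_def fun_eq_iff)
        moreover have "finite (colors_in (sub T v) r)" by (simp add: colors_in_def)
        ultimately show ?thesis using False 1 miss[OF valid] by (simp add: prior_def Let_def)
      qed (simp add: \<phi>_def)
    qed
    then have le: "((\<theta> T v G)(v := \<integral>\<^sup>+ s. \<phi> s \<partial>measure_spmf ?p)) u \<le> \<theta> T v G u" for u
      by (cases "u = v") (simp_all add: \<theta>_def)
    have "dexp ?p (\<lambda>s. dexp ?p (\<lambda>s'. \<Phi> T (v + 1) (G(2 * v + 2 := mem s, 2 * v + 3 := mem s')) (k + 2 * M + 8 + clock s + clock s')))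
      = dexp ?p (\<lambda>s. dexp ?p (\<lambda>s'. ennreal a + ennreal b * cost N ((\<theta> T v G)(v := \<phi> s')) 1))"
      unfolding \<Phi>_def \<theta>_step ..
    \<comment> \<open>The run for the emptiness copy does not occur in the integrand. The other run
      is averaged inside \<open>cost\<close>, which is affine in this coordinate.\<close>
    also have "\<dots> = ennreal a + ennreal b * cost N ((\<theta> T v G)(v := \<integral>\<^sup>+ s. \<phi> s \<partial>measure_spmf ?p)) 1"
      unfolding dexp_const[OF p] dexp_lossless[OF p] cost_expectation[OF p, symmetric]
      by (simp add: nn_integral_add nn_integral_cmult emeasure_lossless[OF p])
    also have "\<dots> \<le> \<Phi> T v G k"
      unfolding \<Phi>_def using le by (intro add_left_mono mult_left_mono cost_mono) auto
    finally show "dexp ?p (\<lambda>s. dexp ?p (\<lambda>s'. \<Phi> T (v + 1) (G(2 * v + 2 := mem s, 2 * v + 3 := mem s')) (k + 2 * M + 8 + clock s + clock s')))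
      \<le> \<Phi> T v G k" .
  next
    fix T v G k assume v: "0 < v" "v < 2 * N" "sub T v = []"
    then have "colors_in (sub T v) r = {}" by (simp add: colors_in_def)
    then have "miss q1 r T G v = 0" "prior T v = 0" by (simp_all add: miss_def prior_def)
    then have "\<theta> T (v + 1) G u = \<theta> T v G u" for u
      using v(1) by (cases "u = v") (simp_all add: \<theta>_def less_Suc_eq)
    then have "\<theta> T (v + 1) G = \<theta> T v G" by (rule ext)
    then show "\<Phi> T (v + 1) G (k + 5) \<le> \<Phi> T v G k" by (simp add: \<Phi>_def)
  next
    fix T G k assume T: "leaf_table T"
    have TK: "T col \<in> {2 ^ ?L..<2 * 2 ^ ?L}" if col: "col \<in> K" for col
    proof -
      obtain x where "x \<in> set xs" "col = snd x" using subsetD[OF K(2) col] by auto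
      then show ?thesis using leaf_tableD[OF T, of x] by (simp add: N_def)
    qed
    have card_eq: "card (colors_in (sub T u) r) = load T K u" for u
      by (simp add: sub_cols load_def)
    have prior: "\<theta> T 1 G = prior T" by (simp add: \<theta>_def fun_eq_iff)
    have c: "cost N (prior T) 1 \<le> ennreal (1 + 2 * real (length (filter (\<lambda>u. u < N \<and> 2 \<le> load T K u) (subtree N 1)))
        + 2 / \<delta> * real (load T K 1))"
    proof (rule cost_bound[OF \<delta>])
      show "load T K v = load T K (2 * v) + load T K (2 * v + 1)" if "0 < v" "v < N" for v
        using TK that by (intro load_children[OF K(1)]) (auto simp: N_def)
    qed (use \<delta> in \<open>auto simp: prior_def card_eq Let_def\<close>)
    have m: "real (length (filter (\<lambda>u. u < N \<and> 2 \<le> load T K u) (subtree N 1))) \<le> 2 ^ J + collisions ?L J K T"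
      unfolding N_def using K(1) TK by (rule multi_le)
    have l: "load T K 1 \<le> card K" unfolding load_def using K(1) by (intro card_mono) auto
    have "cost N (\<theta> T 1 G) 1 \<le> ennreal (1 + 2 * (2 ^ J + collisions ?L J K T) + 2 / \<delta> * real (card K))"
      unfolding prior using m l \<delta>
      by (intro order_trans[OF c] ennreal_leI add_mono mult_left_mono order_refl) auto
    then have "\<Phi> T 1 G k \<le> ennreal a + ennreal b * ennreal (1 + 2 * (2 ^ J + collisions ?L J K T) + 2 / \<delta> * real (card K))"
      unfolding \<Phi>_def by (intro add_left_mono mult_left_mono) auto
    also have "\<dots> = ennreal (bound T)"
      unfolding bound_def using ab coll[of ?L T] \<delta> by (simp add: ennreal_mult')
    finally show "\<Phi> T 1 G k \<le> ennreal (bound T)" .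
  next
    fix \<rho> T G k assume T: "leaf_table T" and G: "ready T G"
    have "miss q1 r T G u = 0" if "2 * N \<le> u" for u
      using sub_empty[OF T that] by (simp add: miss_def colors_in_def)
    \<comment> \<open>Monotonicity of \<open>cost\<close> compares all indices, including 0, which
      is no node. Its value is patched here and does not affect the cost of the root.\<close>
    then have "miss q1 r T G u \<le> ((\<theta> T (2 * N) G)(0 := miss q1 r T G 0)) u" for u
      by (cases "u = 0"; cases "u < 2 * N") (simp_all add: \<theta>_def)
    then have "cost N (miss q1 r T G) 1 \<le> cost N ((\<theta> T (2 * N) G)(0 := miss q1 r T G 0)) 1"
      by (rule cost_mono)
    also have "\<dots> = cost N (\<theta> T (2 * N) G) 1" by (rule cost_upd) simp
    finally have "ennreal a + ennreal b * cost N (miss q1 r T G) 1 \<le> \<Phi> T (2 * N) G k"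
      unfolding \<Phi>_def by (intro add_left_mono mult_left_mono) auto
    then show "g (conf W \<rho> (with_header G) [] (k + 3)) \<le> \<Phi> T (2 * N) G k"
      using fin[OF T G] order_trans by blast
  qed
  also have "\<dots> \<le> ennreal (a + b * (1 + 2 * (2 ^ J + 4 * (real (card K))\<^sup>2 / 2 ^ J) + 2 / \<delta> * real (card K)))"
    unfolding bound_def using collisions_empty[OF K(1)] ab
    by (intro ennreal_leI add_left_mono mult_left_mono add_right_mono) auto
  finally show ?thesis .
qed

end

section \<open>The reduction\<close>

text \<open>From \<open>2 ^ depth n < 4 * n\<close> the left side is below
  \<open>3 + log 2 n\<close>; the bound 4 needs a logarithm of at least 1, hence
  \<open>n \<ge> 2\<close>.\<close>

lemma depth_le_log:
  assumes "2 \<le> n"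
  shows "real (depth n + 1) \<le> 4 * log 2 (real n)"
proof -
  have "(2::real) ^ depth n < 4 * real n"
  proof -
    have "2 ^ depth n < 4 * n" using assms by (intro depth_less) simp
    then have "real (2 ^ depth n) < real (4 * n)" by (simp only: of_nat_less_iff)
    then show ?thesis by simp
  qed
  then have "real (depth n) < log 2 (4 * real n)"
    by (simp add: less_log_of_power)
  also have "\<dots> = log 2 4 + log 2 (real n)"
    using assms by (simp add: log_mult)
  also have "log 2 (4 :: real) = 2" using log_pow_cancel[of "2 :: real" 2] by simp
  finally have "real (depth n) < 2 + log 2 (real n)" .
  moreover have "1 \<le> log 2 (real n)" using assms by (simp add: le_log_iff)
  ultimately show ?thesis by simp
qed

lemma exec_clock: "t \<in> set_spmf (exec F w c s) \<Longrightarrow> clock s < clock t"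
  using exec_support by blast

lemma lossless_nonempty:
  assumes "lossless_spmf p"
  obtains s where "s \<in> set_spmf p"
proof (cases "set_spmf p = {}")
  case True
  then have "dexp p (\<lambda>_. 1) \<le> dexp p (\<lambda>_. 0)" by (intro dexp_mono) simp
  then show ?thesis using assms by (simp add: dexp_const)
qed (use that in blast)

lemma expected_time_ge_1:
  assumes "lossless_spmf (preprocess F c build l)"
  shows "1 \<le> expected_time (preprocess F c build l)"
proof -
  let ?p = "preprocess F c build l"
  have "1 = (\<integral>\<^sup>+ s. 1 \<partial>measure_spmf ?p)" using assms by (simp add: emeasure_lossless)
  also have "\<dots> \<le> expected_time ?p"
    unfolding expected_time_def
  proof (rule nn_integral_mono_AE)
    have "1 \<le> ennreal (real (clock s))" if "s \<in> set_spmf ?p" for s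
    proof -
      have "1 \<le> clock s" using exec_clock[OF that[unfolded preprocess_def]] by simp
      then show ?thesis by (simp flip: ennreal_1)
    qed
    then show "AE s in measure_spmf ?p. 1 \<le> ennreal (real (clock s))" by simp
  qed
  finally show ?thesis .
qed

lemma expected_time_bind:
  "expected_time (bind_spmf p f) \<le> dexp p (\<lambda>s. dexp (f s) (\<lambda>t. of_nat (clock t)))"
proof -
  have "expected_time (bind_spmf p f) = (\<integral>\<^sup>+ t. of_nat (clock t) \<partial>measure_spmf (bind_spmf p f))"
    by (simp add: expected_time_def ennreal_of_nat_eq_real_of_nat)
  also have "\<dots> \<le> dexp (bind_spmf p f) (\<lambda>t. of_nat (clock t))" by (rule dexp_ge_integral)
  finally show ?thesis by (simp add: dexp_bind)
qed

locale monte_carlo =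
  fixes F :: "('p, 'o) prims" and ranges :: "'p set set" and P S Q0 Q1 :: "nat \<Rightarrow> real"
    and c :: nat and build q0 q1 :: com and \<delta> :: real and M :: nat
  assumes build: "preprocessing_bounds F c P S build"
    and empty: "emptiness_test F c ranges Q0 build q0"
    and one: "query_always F c ranges build q1 (\<lambda>xs r t.
        real (clock t) \<le> Q1 (length xs) \<and> (yes t \<or> no t) \<and> (card (colors_in xs r) \<noteq> 1 \<longrightarrow> no t))"
    and \<delta>: "0 < \<delta>" "\<delta> \<le> 1"
      "\<And>xs r. \<lbrakk>valid_input xs; r \<in> ranges; card (colors_in xs r) = 1\<rbrakk>
        \<Longrightarrow> \<delta> \<le> measure (measure_spmf (preprocess_query F c build q1 xs r)) {t. yes t}"
    and regs: "3 \<le> M" "com_regs build \<subseteq> {..<M}" "com_regs q0 \<subseteq> {..<M}" "com_regs q1 \<subseteq> {..<M}"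
    and P: "mono_on {1..} (\<lambda>n. P n / real n)"
    and S: "mono_on {1..} (\<lambda>n. S n / real n)" "\<And>n. n \<ge> 1 \<Longrightarrow> S n > 0"
    and Q0: "mono_on {1..} Q0" and Q1: "mono_on {1..} Q1"
begin

lemma buildD:
  assumes "valid_input l"
  shows "lossless_spmf (preprocess F c build l)"
    "expected_time (preprocess F c build l) \<le> ennreal (P (length l))"
    "\<And>s. s \<in> set_spmf (preprocess F c build l) \<Longrightarrow> real (space (mem s)) \<le> S (length l)"
  using build assms by (auto simp: preprocessing_bounds_def)

lemma singleton_valid: "valid_input [(p, 0)]"
  by (simp add: valid_input_def)

text \<open>Every run takes at least one unit, so \<open>P 1 \<ge> 1\<close>, and monotonicity of
  \<open>P n / n\<close> lifts this to all \<open>n\<close>. The linear work of the host is thereby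
  absorbed into \<open>P\<close>.\<close>

lemma P_ge: "1 \<le> n \<Longrightarrow> real n \<le> P n"
proof -
  assume n: "1 \<le> n"
  have "ennreal 1 \<le> ennreal (P 1)"
    using order_trans[OF expected_time_ge_1[OF buildD(1)[OF singleton_valid[of undefined]]]
      buildD(2)[OF singleton_valid[of undefined]]] by simp
  then have "1 \<le> P 1" by simp
  moreover have "P 1 / real 1 \<le> P n / real n" using n by (intro mono_onD[OF P]) auto
  ultimately have "1 \<le> P n / real n" by simp
  then show ?thesis using n by (simp add: le_divide_eq)
qed

text \<open>Unlike a run time, the number of nonblank cells has no lower bound from the model;
  positivity of \<open>S\<close> is used instead, and \<open>S 1\<close> enters the
  constant.\<close>

lemma S_ge: "1 \<le> n \<Longrightarrow> real n \<le> S n / S 1"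
proof -
  assume n: "1 \<le> n"
  have "S 1 / real 1 \<le> S n / real n" using n by (intro mono_onD[OF S(1)]) auto
  then show ?thesis using n S(2)[of 1] by (simp add: le_divide_eq mult.commute)
qed

text \<open>A query on a single point takes at least one unit, and \<open>Q0\<close> and
  \<open>Q1\<close> are monotone. Some range must exist for a query to run at all.\<close>

lemma Q_ge:
  assumes "r \<in> ranges" "1 \<le> n"
  shows "1 \<le> Q0 n" "1 \<le> Q1 n"
proof -
  let ?l = "[(undefined :: 'p, 0 :: nat)]"
  have l: "valid_input ?l" by (rule singleton_valid)
  obtain s where s: "s \<in> set_spmf (preprocess F c build ?l)"
    using lossless_nonempty[OF buildD(1)[OF l]] .
  have clock: "1 \<le> clock t" if "t \<in> set_spmf (query F c q ?l r s)" for q t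
    using exec_clock[OF that[unfolded query_def]] by simp
  have q: "lossless_spmf (query F c q0 ?l r s)" "lossless_spmf (query F c q1 ?l r s)"
    "\<And>t. t \<in> set_spmf (query F c q0 ?l r s) \<Longrightarrow> real (clock t) \<le> Q0 (length ?l)"
    "\<And>t. t \<in> set_spmf (query F c q1 ?l r s) \<Longrightarrow> real (clock t) \<le> Q1 (length ?l)"
    using empty one s assms(1) l unfolding emptiness_test_def query_always_def by blast+
  obtain t where t: "t \<in> set_spmf (query F c q0 ?l r s)" using lossless_nonempty[OF q(1)] .
  obtain t' where t': "t' \<in> set_spmf (query F c q1 ?l r s)" using lossless_nonempty[OF q(2)] .
  have "1 \<le> Q0 1" "1 \<le> Q1 1"
    using q(3)[OF t] clock[OF t] q(4)[OF t'] clock[OF t'] by simp_all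
  moreover have "Q0 1 \<le> Q0 n" by (rule mono_onD[OF Q0]) (use assms(2) in simp_all)
  moreover have "Q1 1 \<le> Q1 n" by (rule mono_onD[OF Q1]) (use assms(2) in simp_all)
  ultimately show "1 \<le> Q0 n" "1 \<le> Q1 n" by linarith+
qed

text \<open>Averaging the failure probability over the memory gives the probability of a no in the
  joint experiment, and a no excludes a yes.\<close>

lemma miss_probability:
  assumes l: "valid_input l" and r: "r \<in> ranges" and "card (colors_in l r) = 1"
  shows "(\<integral>\<^sup>+ s. emeasure (measure_spmf (query F c q1 l r s)) {t. no t} \<partial>measure_spmf (preprocess F c build l))
    \<le> ennreal (1 - \<delta>)"
proof -
  let ?e = "preprocess_query F c build q1 l r"
  have lossless: "lossless_spmf ?e"
    using one l r buildD(1)[OF l] by (auto simp: preprocess_query_def query_always_def)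
  have "(\<integral>\<^sup>+ s. emeasure (measure_spmf (query F c q1 l r s)) {t. no t} \<partial>measure_spmf (preprocess F c build l))
    = emeasure (measure_spmf ?e) {t. no t}"
    unfolding preprocess_query_def measure_spmf_bind o_def
    by (subst emeasure_bind[where N = "count_space UNIV"]) (auto simp: space_measure_spmf)
  also have "\<dots> \<le> emeasure (measure_spmf ?e) (Sigma_Algebra.space (measure_spmf ?e) - {t. yes t})"
    by (intro emeasure_mono) (auto simp: yes_def no_def space_measure_spmf)
  also have "\<dots> = ennreal (measure (measure_spmf ?e) (Sigma_Algebra.space (measure_spmf ?e)) - measure (measure_spmf ?e) {t. yes t})"
    by (simp add: measure_spmf.emeasure_eq_measure measure_spmf.finite_measure_compl)
  also have "\<dots> \<le> ennreal (1 - \<delta>)"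
    using \<delta>(3)[OF assms] lossless
    by (intro ennreal_leI) (simp add: lossless_weight_spmfD flip: weight_spmf_def)
  finally show ?thesis .
qed

abbreviation "preprocessing \<equiv> preprocess F (c + 6) (build_all c M build)"
abbreviation "answering \<equiv> query F (c + 6) (query_all M q0 q1)"

definition "P' n = 75 * real n * real (depth n + 1) + 3
  + real (2 * 2 ^ depth n) * real (2 * M + 13) + 2 * (real (depth n + 1) * P n)"
definition "S' n = 18 * real n + 2 * (real (depth n + 1) * S n)"
text \<open>With \<open>max 1 k\<close>, since a query with empty answer still takes time at the
  root.\<close>

definition "T' n k = (5 + real (2 * M + 18) * (13 + 2 / \<delta>)) * (real (max 1 k) * (Q0 n + Q1 n))"

text \<open>Quantifying over all ranges makes one outcome of the preprocessing good for every query.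
  Finiteness of the weight stands for correctness on every run.\<close>

definition sound :: "'p colored \<Rightarrow> ('p, 'o) state \<Rightarrow> bool" where
  "sound xs s \<longleftrightarrow> real (space (mem s)) \<le> S' (length xs) \<and>
     (\<forall>r\<in>ranges. dexp (answering xs r s) (goal (mset_set (Num ` colors_in xs r))) < top)"

lemma reporting:
  assumes xs: "valid_input xs"
  shows "dexp (preprocessing xs) (\<lambda>s. if sound xs s then of_nat (clock s) else top) \<le> ennreal (P' (length xs))"
    and "r \<in> ranges \<Longrightarrow> expected_time (preprocess_query F (c + 6) (build_all c M build) (query_all M q0 q1) xs r)
      \<le> ennreal (T' (length xs) (card (colors_in xs r)))"
proof -
  interpret tree_ds F c M build xs
    using xs regs(2) buildD(1) by unfold_locales
  have n: "1 \<le> n" using n_pos by simp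
  \<comment> \<open>Clocks are natural numbers, so rounding the real bounds down loses
    nothing.\<close>
  define t0 where "t0 = nat \<lfloor>Q0 n\<rfloor>"
  define t1 where "t1 = nat \<lfloor>Q1 n\<rfloor>"
  have answer: "dexp (answering xs r (conf W \<rho> (with_header G) [] k)) (goal (mset_set (Num ` colors_in xs r)))
      \<le> 5 + of_nat (2 * M + 17 + t0 + t1) * cost N (miss q1 r T G) 1"
    if T: "leaf_table T" and G: "ready T G" and r: "r \<in> ranges" for T G r \<rho> k
  proof -
    obtain G0 where D: "distributed T G0" and B: "built F c build (sub T) G0 (2 * N) G"
      using G by (auto simp: ready_def)
    have copies: "with_header G (2 * u + 2) \<in> mem ` set_spmf (preprocess F c build (sub T u))"
        "with_header G (2 * u + 3) \<in> mem ` set_spmf (preprocess F c build (sub T u))"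
      if "0 < u" "u < 2 * N" "sub T u \<noteq> []" for u
      using B that by (auto simp: built_def with_header_def simp del: add_2_eq_Suc add_2_eq_Suc')
    have mono: "Q0 (length (sub T u)) \<le> Q0 n" "Q1 (length (sub T u)) \<le> Q1 n" if "sub T u \<noteq> []" for u
      using sub_valid(3)[OF that] that n
      by (auto intro!: mono_onD[OF Q0] mono_onD[OF Q1] simp: Suc_le_eq)
    interpret tree_query F c M build xs T "with_header G" q0 q1 r t0 t1
    proof unfold_locales
      show "leaf_table T" by (rule T)
      show "3 \<le> M" "com_regs q0 \<subseteq> {..<M}" "com_regs q1 \<subseteq> {..<M}" by (simp_all add: regs)
      show "with_header G 3 u = Num (length (sub T u))" if "0 < u" for u
        using D B that by (simp add: with_header_def built_def distributed_def stores_def)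
    next
      fix u assume u: "0 < u" "u < 2 * N" "sub T u \<noteq> []"
      obtain s where s: "s \<in> set_spmf (preprocess F c build (sub T u))" "mem s = with_header G (2 * u + 2)"
        using copies(1)[OF u] by auto
      have q: "query F c q0 (sub T u) r (state_of (with_header G (2 * u + 2))) = query F c q0 (sub T u) r s"
        using query_state_of[OF s(2)] by metis
      have ok: "lossless_spmf (query F c q0 (sub T u) r s) \<and> (\<forall>t\<in>set_spmf (query F c q0 (sub T u) r s).
         real (clock t) \<le> Q0 (length (sub T u)) \<and>
        (if \<forall>(p, col) \<in> set (sub T u). p \<notin> r then no t
         else yes t \<and> (\<exists>(p, col) \<in> set (sub T u). p \<in> r \<and> regs t 1 = Point p \<and> regs t 2 = Num col)))"
        using empty sub_valid(1)[OF u(3)] r s(1) unfolding emptiness_test_def query_always_def by blast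
      then show "lossless_spmf (query F c q0 (sub T u) r (state_of (with_header G (2 * u + 2))))"
        unfolding q by blast
      have none: "(\<forall>(p, col) \<in> set (sub T u). p \<notin> r) \<longleftrightarrow> colors_in (sub T u) r = {}"
        by (auto simp: colors_in_def)
      show "clock t \<le> t0 \<and> (if colors_in (sub T u) r = {} then no t
          else yes t \<and> (\<exists>col\<in>colors_in (sub T u) r. regs t 2 = Num col))"
        if t: "t \<in> set_spmf (query F c q0 (sub T u) r (state_of (with_header G (2 * u + 2))))" for t
      proof
        have *: "real (clock t) \<le> Q0 (length (sub T u))"
          "if colors_in (sub T u) r = {} then no t
           else yes t \<and> (\<exists>(p, col) \<in> set (sub T u). p \<in> r \<and> regs t 1 = Point p \<and> regs t 2 = Num col)"
          using ok t unfolding q none by blast+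
        show "clock t \<le> t0" unfolding t0_def using *(1) mono(1)[OF u(3)] by (intro le_nat_floor) linarith
        show "if colors_in (sub T u) r = {} then no t else yes t \<and> (\<exists>col\<in>colors_in (sub T u) r. regs t 2 = Num col)"
          using *(2) by (force simp: colors_in_def split: if_splits)
      qed
    next
      fix u assume u: "0 < u" "u < 2 * N" "sub T u \<noteq> []"
      obtain s where s: "s \<in> set_spmf (preprocess F c build (sub T u))" "mem s = with_header G (2 * u + 3)"
        using copies(2)[OF u] by auto
      have q: "query F c q1 (sub T u) r (state_of (with_header G (2 * u + 3))) = query F c q1 (sub T u) r s"
        using query_state_of[OF s(2)] by metis
      have ok: "lossless_spmf (query F c q1 (sub T u) r s) \<and> (\<forall>t\<in>set_spmf (query F c q1 (sub T u) r s).
         real (clock t) \<le> Q1 (length (sub T u)) \<and> (yes t \<or> no t) \<and> (card (colors_in (sub T u) r) \<noteq> 1 \<longrightarrow> no t))"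
        using one sub_valid(1)[OF u(3)] r s(1) unfolding query_always_def by blast
      then show "lossless_spmf (query F c q1 (sub T u) r (state_of (with_header G (2 * u + 3))))"
        unfolding q by blast
      show "clock t \<le> t1 \<and> (yes t \<or> no t) \<and> (card (colors_in (sub T u) r) \<noteq> 1 \<longrightarrow> no t)"
        if t: "t \<in> set_spmf (query F c q1 (sub T u) r (state_of (with_header G (2 * u + 3))))" for t
      proof
        have *: "real (clock t) \<le> Q1 (length (sub T u))"
          "(yes t \<or> no t) \<and> (card (colors_in (sub T u) r) \<noteq> 1 \<longrightarrow> no t)"
          using ok t unfolding q by blast+
        show "clock t \<le> t1" unfolding t1_def using *(1) mono(2)[OF u(3)] by (intro le_nat_floor) linarith
        show "(yes t \<or> no t) \<and> (card (colors_in (sub T u) r) \<noteq> 1 \<longrightarrow> no t)" by (rule *(2))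
      qed
    qed
    have "miss q1 r T (with_header G) = miss q1 r T G"
      by (simp add: miss_def with_header_def fun_eq_iff)
    then show ?thesis
      using exec_query_all[of "conf W \<rho> (with_header G) [] k"] N_bounds
      by (simp add: with_header_def node_time_def)
  qed
  show "dexp (preprocessing xs) (\<lambda>s. if sound xs s then of_nat (clock s) else top) \<le> ennreal (P' (length xs))"
    unfolding P'_def n_def[symmetric] N_def[symmetric] time_bound_def[symmetric]
  proof (rule preprocessing_time)
    show "expected_time (preprocess F c build l) \<le> ennreal (P (length l))" if "valid_input l" for l
      by (rule buildD(2)[OF that])
    show "mono_on {1..} (\<lambda>m. P m / real m)" by (rule P)
    show "0 \<le> P m" if "1 \<le> m" for m using P_ge[OF that] by linarith
  next
    fix T G \<rho> k assume T: "leaf_table T" and G: "ready T G"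
    let ?s = "conf W \<rho> (with_header G) [] k"
    have "real (space (mem ?s)) \<le> 18 * real n + 2 * (\<Sum>u\<in>nodes T. S (length (sub T u)))"
      using T G buildD(3) by (intro space_le) auto
    also have "\<dots> \<le> 18 * real n + 2 * (real (depth n + 1) * S n)"
      using superadditive_sum_le[OF T S(1)] S(2)[OF n] by simp
    finally have sp: "real (space (mem ?s)) \<le> 18 * real n + 2 * (real (depth n + 1) * S n)" .
    have "dexp (answering xs r ?s) (goal (mset_set (Num ` colors_in xs r))) < top"
      if r: "r \<in> ranges" for r
    proof -
      have "cost N (miss q1 r T G) 1 < top"
        using miss_le_1 by (intro cost_finite) (metis ennreal_one_less_top le_less_trans)
      then have "5 + of_nat (2 * M + 17 + t0 + t1) * cost N (miss q1 r T G) 1 < top"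
        by (simp add: ennreal_mult_less_top of_nat_less_top)
      then show ?thesis using answer[OF T G r, of \<rho> k] by (rule le_less_trans[rotated])
    qed
    with sp show "sound xs ?s" unfolding sound_def S'_def n_def by blast
  qed
  show "expected_time (preprocess_query F (c + 6) (build_all c M build) (query_all M q0 q1) xs r)
      \<le> ennreal (T' (length xs) (card (colors_in xs r)))"
    if r: "r \<in> ranges"
  proof -
    define K where "K = card (colors_in xs r)"
    define K' where "K' = real (max 1 K)"
    define A where "A = real (2 * M + 17 + t0 + t1)"
    \<comment> \<open>The threshold level has about \<open>k\<close> nodes; then both
      \<open>2 ^ J\<close> and \<open>k^2 / 2 ^ J\<close> are \<open>O(k)\<close>, which balances
      the two ways of counting crowded nodes.\<close>
    obtain J where J: "K \<le> 2 ^ J" "(2::real) ^ J \<le> 2 * K'"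
    proof -
      define J where "J = (LEAST J. K \<le> 2 ^ J)"
      have "K \<le> 2 ^ K" by (simp add: less_imp_le)
      then have 1: "K \<le> 2 ^ J" unfolding J_def by (rule LeastI)
      have "(2::real) ^ J \<le> 2 * K'"
      proof (cases J)
        case (Suc J')
        then have "\<not> K \<le> 2 ^ J'" unfolding J_def using not_less_Least[of J'] by (metis lessI)
        then have "(2::real) ^ J' \<le> real K" by (metis linear of_nat_le_iff of_nat_numeral of_nat_power)
        then show ?thesis using Suc by (simp add: K'_def)
      qed (simp add: K'_def)
      with 1 show ?thesis by (rule that)
    qed
    have "expected_time (preprocess_query F (c + 6) (build_all c M build) (query_all M q0 q1) xs r)
      \<le> dexp (preprocessing xs)
          (\<lambda>s. dexp (answering xs r s) (\<lambda>t. of_nat (clock t)))"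
      unfolding preprocess_query_def by (rule expected_time_bind)
    also have "\<dots> \<le> dexp (preprocessing xs)
          (\<lambda>s. dexp (answering xs r s) (goal (mset_set (Num ` colors_in xs r))))"
      by (intro dexp_mono) (simp add: goal_def)
    also have "\<dots> \<le> ennreal (5 + A * (1 + 2 * (2 ^ J + 4 * (real K)\<^sup>2 / 2 ^ J) + 2 / \<delta> * real K))"
      unfolding K_def
    proof (rule query_time[OF \<delta>(1,2), where ?q1.0 = q1])
      show "dexp (answering xs r (conf W \<rho> (with_header G) [] k)) (goal (mset_set (Num ` colors_in xs r)))
        \<le> ennreal 5 + ennreal A * cost N (miss q1 r T G) 1" if "leaf_table T" "ready T G" for T G \<rho> k
        using answer[OF that r, of \<rho> k] unfolding A_def by (simp only: ennreal_of_nat_eq_real_of_nat ennreal_numeral)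
    qed (use miss_probability r in \<open>auto simp: A_def\<close>)
    also have "\<dots> \<le> ennreal ((5 + real (2 * M + 18) * (13 + 2 / \<delta>)) * (K' * (Q0 n + Q1 n)))"
    proof (rule ennreal_leI)
      have Q: "1 \<le> Q0 n" "1 \<le> Q1 n" using Q_ge[OF r n] .
      have K: "1 \<le> K'" "real K \<le> K'" by (auto simp: K'_def)
      have "(real K)\<^sup>2 / 2 ^ J \<le> real K"
      proof -
        have "real K \<le> 2 ^ J" using J(1) by (metis of_nat_le_iff of_nat_numeral of_nat_power)
        then have "real K * real K \<le> real K * 2 ^ J" by (intro mult_left_mono) auto
        then show ?thesis by (simp add: power2_eq_square divide_le_eq)
      qed
      \<comment> \<open>The constant 13 arises as \<open>1 + 2 * (2 + 4)\<close>.\<close>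
      then have "1 + 2 * (2 ^ J + 4 * (real K)\<^sup>2 / 2 ^ J) + 2 / \<delta> * real K \<le> K' + 2 * (2 * K' + 4 * K') + 2 / \<delta> * K'"
        using J(2) K \<delta> by (intro add_mono mult_left_mono) auto
      also have "\<dots> = (13 + 2 / \<delta>) * K'" by (simp add: algebra_simps)
      finally have cost: "1 + 2 * (2 ^ J + 4 * (real K)\<^sup>2 / 2 ^ J) + 2 / \<delta> * real K \<le> (13 + 2 / \<delta>) * K'" .
      have "real t0 \<le> Q0 n" "real t1 \<le> Q1 n" using Q by (simp_all add: t0_def t1_def)
      then have "A \<le> real (2 * M + 17) * 1 + (Q0 n + Q1 n)" by (simp add: A_def)
      also have "\<dots> \<le> real (2 * M + 17) * (Q0 n + Q1 n) + (Q0 n + Q1 n)"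
        using Q by (intro add_right_mono mult_left_mono) auto
      also have "\<dots> = real (2 * M + 18) * (Q0 n + Q1 n)" by (simp add: algebra_simps)
      finally have A: "A \<le> real (2 * M + 18) * (Q0 n + Q1 n)" .
      have "A * (1 + 2 * (2 ^ J + 4 * (real K)\<^sup>2 / 2 ^ J) + 2 / \<delta> * real K)
          \<le> (real (2 * M + 18) * (Q0 n + Q1 n)) * ((13 + 2 / \<delta>) * K')"
        using cost A \<delta> K Q by (intro mult_mono) (auto simp: A_def)
      moreover have "5 \<le> 5 * (K' * (Q0 n + Q1 n))"
        using K Q mult_mono[of 1 K' 1 "Q0 n + Q1 n"] by simp
      ultimately have "5 + A * (1 + 2 * (2 ^ J + 4 * (real K)\<^sup>2 / 2 ^ J) + 2 / \<delta> * real K)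
          \<le> 5 * (K' * (Q0 n + Q1 n)) + (real (2 * M + 18) * (Q0 n + Q1 n)) * ((13 + 2 / \<delta>) * K')"
        by linarith
      also have "\<dots> = (5 + real (2 * M + 18) * (13 + 2 / \<delta>)) * (K' * (Q0 n + Q1 n))"
      proof -
        have "5 * (x * y) + (m * y) * (d * x) = (5 + m * d) * (x * y)" for x y m d :: real
          by (simp add: algebra_simps)
        then show ?thesis .
      qed
      finally show "5 + A * (1 + 2 * (2 ^ J + 4 * (real K)\<^sup>2 / 2 ^ J) + 2 / \<delta> * real K)
          \<le> (5 + real (2 * M + 18) * (13 + 2 / \<delta>)) * (K' * (Q0 n + Q1 n))" .
    qed
    finally show ?thesis unfolding T'_def K'_def K_def n_def .
  qed
qed

text \<open>With \<open>depth n + 1 \<le> 4 * L\<close> and \<open>n \<le> P n\<close>, the 311 is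
  \<open>75 * 4 + 3 + 2 * 4\<close>. The remaining 8 comes from
  \<open>2 * 2 ^ depth n \<le> 8 * n\<close>.\<close>

lemma P'_le:
  assumes n: "2 \<le> n"
  shows "P' n \<le> (311 + 8 * real (2 * M + 13)) * (P n * log 2 (real n))"
proof -
  define L where "L = log 2 (real n)"
  have P: "real n \<le> P n" using n by (intro P_ge) simp
  have L: "1 \<le> L" using n by (simp add: L_def le_log_iff)
  have d: "real (depth n + 1) \<le> 4 * L" unfolding L_def by (rule depth_le_log[OF n])
  have P1: "1 \<le> P n" "0 \<le> P n" using P n by linarith+
  have PL: "P n * 1 \<le> P n * L" using L P1 by (intro mult_left_mono) auto
  have "75 * real n * real (depth n + 1) \<le> 75 * P n * (4 * L)"
    using P d P1 by (intro mult_mono) auto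
  moreover have "3 \<le> 3 * (P n * L)" using PL P1 by linarith
  moreover have "real (2 * 2 ^ depth n) * real (2 * M + 13) \<le> (8 * (P n * L)) * real (2 * M + 13)"
  proof (rule mult_right_mono)
    have "2 ^ depth n < 4 * n" using n by (intro depth_less) simp
    then have "real (2 * 2 ^ depth n) \<le> 8 * real n" by linarith
    then show "real (2 * 2 ^ depth n) \<le> 8 * (P n * L)" using P PL by linarith
  qed simp
  moreover have "2 * (real (depth n + 1) * P n) \<le> 2 * (4 * L * P n)"
    using d P1 by (intro mult_left_mono mult_right_mono) auto
  ultimately have "P' n \<le> 75 * P n * (4 * L) + 3 * (P n * L) + (8 * (P n * L)) * real (2 * M + 13) + 2 * (4 * L * P n)"
    unfolding P'_def by linarith
  also have "\<dots> = (311 + 8 * real (2 * M + 13)) * (P n * L)"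
    by (simp add: algebra_simps)
  finally show ?thesis unfolding L_def .
qed

lemma S'_le:
  assumes n: "2 \<le> n"
  shows "S' n \<le> (18 / S 1 + 8) * (S n * log 2 (real n))"
proof -
  define L where "L = log 2 (real n)"
  have S1: "0 < S 1" "0 < S n" using S(2) n by auto
  have Sn: "real n \<le> S n / S 1" using n by (intro S_ge) simp
  have L: "1 \<le> L" using n by (simp add: L_def le_log_iff)
  have d: "real (depth n + 1) \<le> 4 * L" unfolding L_def by (rule depth_le_log[OF n])
  have "18 * real n \<le> 18 * (S n / S 1 * L)"
    using Sn L S1 mult_left_mono[of 1 L "S n / S 1"] by simp
  moreover have "2 * (real (depth n + 1) * S n) \<le> 2 * (4 * L * S n)"
    using d S1 by (intro mult_left_mono mult_right_mono) auto
  ultimately have "S' n \<le> 18 * (S n / S 1 * L) + 2 * (4 * L * S n)"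
    unfolding S'_def by linarith
  also have "\<dots> = (18 / S 1 + 8) * (S n * L)"
    by (simp add: algebra_simps)
  finally show ?thesis unfolding L_def .
qed

end

theorem theorem8:
  fixes F :: "('p, 'o) prims"
    and ranges :: "'p set set"
    and P S Q0 Q1 :: "nat \<Rightarrow> real"
  assumes "monte_carlo_ds F ranges P S Q0 Q1"
    and "mono_on {1..} (\<lambda>n. P n / real n)"
    and "mono_on {1..} (\<lambda>n. S n / real n)"
    and "\<And>n. n \<ge> 1 \<Longrightarrow> S n > 0"
    and "mono_on {1..} Q0"
    and "mono_on {1..} Q1"
  shows "\<exists>P' S' T.
      las_vegas_reporting_ds F ranges P' S' T \<and>
      (\<exists>C. \<forall>n\<ge>2. P' n \<le> C * (P n * log 2 (real n))) \<and>
      (\<exists>C. \<forall>n\<ge>2. S' n \<le> C * (S n * log 2 (real n))) \<and>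
      (\<exists>C. \<forall>n\<ge>1. \<forall>k. T n k \<le> C * (real (max 1 k) * (Q0 n + Q1 n)))"
proof -
  obtain c build q0 q1 where mc: "preprocessing_bounds F c P S build" "emptiness_test F c ranges Q0 build q0"
    "one_color_test F c ranges Q1 build q1"
    using assms(1) by (auto simp: monte_carlo_ds_def)
  obtain \<delta>0 where \<delta>0: "0 < \<delta>0" "\<And>xs r. valid_input xs \<Longrightarrow> r \<in> ranges \<Longrightarrow> card (colors_in xs r) = 1 \<Longrightarrow>
      \<delta>0 \<le> measure (measure_spmf (preprocess_query F c build q1 xs r)) {t. yes t}"
    using mc(3) unfolding one_color_test_def by blast
  \<comment> \<open>If no query has exactly one color, \<open>\<delta>0\<close> is unconstrained and
    may exceed 1.\<close>
  define \<delta> where "\<delta> = min \<delta>0 1"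
  \<comment> \<open>Inserting 2 ensures that the window contains registers 0, 1 and 2, in which the
    given queries leave their results.\<close>
  define M where "M = Suc (Max (insert 2 (com_regs build \<union> com_regs q0 \<union> com_regs q1)))"
  have M: "i < M" if "i \<in> insert 2 (com_regs build \<union> com_regs q0 \<union> com_regs q1)" for i
    unfolding M_def less_Suc_eq_le using that by (intro Max_ge) (auto simp: finite_com_regs)
  interpret monte_carlo F ranges P S Q0 Q1 c build q0 q1 \<delta> M
  proof unfold_locales
    show "query_always F c ranges build q1 (\<lambda>xs r t.
        real (clock t) \<le> Q1 (length xs) \<and> (yes t \<or> no t) \<and> (card (colors_in xs r) \<noteq> 1 \<longrightarrow> no t))"
      using mc(3) unfolding one_color_test_def by blast
    show "\<delta> \<le> measure (measure_spmf (preprocess_query F c build q1 xs r)) {t. yes t}"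
      if "valid_input xs" "r \<in> ranges" "card (colors_in xs r) = 1" for xs r
      using \<delta>0(2)[OF that] by (simp add: \<delta>_def)
    show "3 \<le> M" using M[of 2] by simp
    show "com_regs build \<subseteq> {..<M}" "com_regs q0 \<subseteq> {..<M}" "com_regs q1 \<subseteq> {..<M}"
      using M by auto
    show "0 < \<delta>" "\<delta> \<le> 1" using \<delta>0(1) by (simp_all add: \<delta>_def)
  qed (fact mc(1) mc(2) assms)+
  let ?build = "build_all c M build" and ?qry = "query_all M q0 q1"
  have good: "lossless_spmf (preprocessing xs)" "expected_time (preprocessing xs) \<le> ennreal (P' (length xs))"
      "\<And>s. s \<in> set_spmf (preprocessing xs) \<Longrightarrow> sound xs s"
    if "valid_input xs" for xs
  proof -
    \<comment> \<open>One finite bound on this weight yields losslessness, soundness of every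
      outcome and the expected time.\<close>
    define g where "g s = (if sound xs s then of_nat (clock s) else (top :: ennreal))" for s
    have le: "dexp (preprocessing xs) g \<le> ennreal (P' (length xs))"
      using reporting(1)[OF that] unfolding g_def .
    then have fin: "dexp (preprocessing xs) g < top" by (rule le_less_trans) simp
    show "lossless_spmf (preprocessing xs)" by (rule dexp_finiteD(1)[OF fin])
    show "sound xs s" if "s \<in> set_spmf (preprocessing xs)" for s
      using dexp_finiteD(2)[OF fin that] unfolding g_def by (auto split: if_splits)
    have "expected_time (preprocessing xs) \<le> (\<integral>\<^sup>+ s. g s \<partial>measure_spmf (preprocessing xs))"
      unfolding expected_time_def by (intro nn_integral_mono) (simp add: g_def ennreal_of_nat_eq_real_of_nat)
    also have "\<dots> \<le> dexp (preprocessing xs) g" by (rule dexp_ge_integral)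
    finally show "expected_time (preprocessing xs) \<le> ennreal (P' (length xs))" using le by (rule order_trans)
  qed
  have "las_vegas_reporting_ds F ranges P' S' T'"
    unfolding las_vegas_reporting_ds_def
  proof (rule exI[of _ "c + 6"], rule exI[of _ ?build], rule exI[of _ ?qry], intro conjI)
    show "preprocessing_bounds F (c + 6) P' S' ?build"
      unfolding preprocessing_bounds_def using good sound_def by blast
    show "query_always F (c + 6) ranges ?build ?qry (\<lambda>xs r t. distinct (out t) \<and> set (out t) = Num ` colors_in xs r)"
      unfolding query_always_def
    proof (intro allI impI ballI)
      fix xs r s assume *: "valid_input xs" "r \<in> ranges" "s \<in> set_spmf (preprocessing xs)"
      then have fin: "dexp (answering xs r s) (goal (mset_set (Num ` colors_in xs r))) < top"
        using good(3)[OF *(1,3)] by (simp add: sound_def)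
      show "lossless_spmf (answering xs r s) \<and>
        (\<forall>t\<in>set_spmf (answering xs r s). distinct (out t) \<and> set (out t) = Num ` colors_in xs r)"
        using dexp_finiteD[OF fin] goal_finite by blast
    qed
    show "\<forall>xs. valid_input xs \<longrightarrow> (\<forall>r\<in>ranges. expected_time (preprocess_query F (c + 6) ?build ?qry xs r)
        \<le> ennreal (T' (length xs) (card (colors_in xs r))))"
      using reporting(2) by blast
  qed
  moreover have "\<exists>C. \<forall>n\<ge>2. P' n \<le> C * (P n * log 2 (real n))" using P'_le by blast
  moreover have "\<exists>C. \<forall>n\<ge>2. S' n \<le> C * (S n * log 2 (real n))" using S'_le by blast
  moreover have "\<exists>C. \<forall>n\<ge>1. \<forall>k. T' n k \<le> C * (real (max 1 k) * (Q0 n + Q1 n))"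
    unfolding T'_def by blast
  ultimately show ?thesis by blast
qed

end
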